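(* Let $\Gamma$ be a finite abelian group and $\kappa:\Gamma\times\Gamma\to\Bbbk^\times$ a $\Gamma$-bicharacter. Let $(\mathcal C,\otimes,\mathbf 1,\beta)$ be a $\Bbbk$-linear braided monoidal category and $A$ a $\Gamma$-graded algebra in $\mathcal C$ that is graded-commutative with respect to $\kappa$. (i) The category $\mathrm{ind}\text{-}A$ of induced right $A$-modules can be endowed with the structure of a $(\Gamma,\kappa)$-graded-monoidal category, with $\kappa$-twisted monoidal structure obtained by transporting the product $\overline\otimes$ from the Kleisli category $\mathcal C_{\mathbb A}$ to $\mathrm{ind}\text{-}A$ (along the equivalence $\mathcal C_{\mathbb A}\simeq\mathrm{ind}\text{-}A$). (ii) If in addition the tensor product $\otimes_A$ of $A$-bimodules exists and $A$ is coproduct-separable Frobenius, then the restriction of $\overline\otimes$ to the subcategory $\mathrm{ind}^\circ\text{-}A$ is isomorphic to the tensor product $\widetilde\otimes$ on $\mathrm{ind}^\circ\text{-}A$ that is induced from the bimodule tensor product $\otimes_A$.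
   Context: $\Bbbk$ is an algebraically closed field with characteristic coprime to $|\Gamma|$; $\Gamma$ is written additively; all categories are additive and $\Bbbk$-linear; associators and unitors of $\mathcal C$ are suppressed; $\mathrm{Hom}(\mathbf 1,\mathbf 1)\cong\Bbbk$. Graded algebra: $A=(A,\mu,\eta)$ with $A=\bigoplus_{i\in\Gamma}A_i$ such that $\mu$ restricts to $\mu_{i,j}:A_i\otimes A_j\to A_{i+j}$. It is graded-commutative with respect to $\kappa$ iff $\mu_{j,i}\circ\beta_{A_i,A_j}=\kappa(i,j)\,\mu_{i,j}$ for all $i,j\in\Gamma$. Induced modules: $\mathrm{Ind}(x)=(x\otimes A,\mathrm{id}_x\otimes\mu)$ for $x\in\mathcal C$; $\mathrm{ind}\text{-}A$ is the full subcategory of right $A$-modules on these objects. $\mathrm{Ind}(x)$ is $\Gamma$-graded with components $x\otimes A_i$; $\mathrm{Hom}_A(\mathrm{Ind}(x),\mathrm{Ind}(y))\cong\mathrm{Hom}(x,y\otimes A)=\bigoplus_i\mathrm{Hom}(x,y\otimes A_i)$ is a $\Gamma$-graded vector space. $\mathrm{ind}^\circ\text{-}A$ is the wide subcategory of $\mathrm{ind}\text{-}A$ whose morphisms are the grade-preserving (grade $0$) module morphisms. Kleisli category: $\mathbb A$ is the monad on $\mathcal C$ with endofunctor $-\otimes A$, multiplication $\mathrm{id}_c\otimes\mu$ and unit $\mathrm{id}_c\otimes\eta$. $\mathcal C_{\mathbb A}$ has the objects of $\mathcal C$ (written $\overline x$), $\mathrm{Hom}_{\mathcal C_{\mathbb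 A}}(\overline x,\overline y)=\mathrm{Hom}_{\mathcal C}(x,y\otimes A)$, composition $g\,\overline\circ\,f=(\mathrm{id}_z\otimes\mu)\circ(g\otimes\mathrm{id}_A)\circ f$ for $f:x\to y\otimes A$, $g:y\to z\otimes A$, and identities $\mathrm{id}_x\otimes\eta$. A morphism $x\to y\otimes A_i$ has grade $i$. The equivalence $\mathcal C_{\mathbb A}\to\mathrm{ind}\text{-}A$ sends $\overline x$ to $\mathrm{Ind}(x)$ and $f:x\to y\otimes A$ to $(\mathrm{id}_y\otimes\mu)\circ(f\otimes\mathrm{id}_A)$. The product $\overline\otimes$ on $\mathcal C_{\mathbb A}$ is $\overline x\,\overline\otimes\,\overline y=\overline{x\otimes y}$ on objects, and for $f:x\to x'\otimes A$, $g:y\to y'\otimes A$, $$f\,\overline\otimes\,g=(\mathrm{id}_{x'}\otimes\mathrm{id}_{y'}\otimes\mu)\circ(\mathrm{id}_{x'}\otimes\beta_{A,y'}\otimes\mathrm{id}_A)\circ(f\otimes g).$$ $(\Gamma,\kappa)$-graded-monoidal category: a $\Gamma$-graded $\Bbbk$-linear category is a category enriched over the symmetric monoidal category of $\Gamma$-graded $\Bbbk$-vector spaces with grade-preserving linear maps; a $\Gamma$-graded $\Bbbk$-linear functor is a functor enriched over the latter. For $\Gamma$-graded $\Bbbk$-linear categories $\mathcal D,\mathcal E$, the $\kappa$-twisted Cartesian product $\mathcal D\circledast^\kappa\mathcal E$ has as objects pairs $(d,e)$ and as morphism spaces the tensor products $\mathrm{Hom}_{\mathcal D}(d,d')\otimes\mathrm{Hom}_{\mathcal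 E}(e,e')$, with composition given on homogeneous morphisms by $$(f'\otimes^\kappa g')\circ(f\otimes^\kappa g)=\kappa(|g'|,|f|)\,(f'\circ f)\otimes^\kappa(g'\circ g),$$ where $|\cdot|$ denotes the grade. A $(\Gamma,\kappa)$-graded-monoidal category is a $\Gamma$-graded $\Bbbk$-linear category $\mathcal D$ together with a unit object and a $\Gamma$-graded $\Bbbk$-linear functor $\otimes^\kappa:\mathcal D\circledast^\kappa\mathcal D\to\mathcal D$ that satisfy the same unitality and associativity axioms as in the case of a strict monoidal category. Part (ii): a Frobenius algebra $(A,\mu,\eta,\Delta,\varepsilon)$ is an algebra and coalgebra such that $(\mu\otimes\mathrm{id})\circ(\mathrm{id}\otimes\Delta)=\Delta\circ\mu=(\mathrm{id}\otimes\mu)\circ(\Delta\otimes\mathrm{id})$; coproduct-separable means $\mu\circ\Delta=\mathrm{id}_A$. For a right module $(m,\rho^{r}_m)$ and a left module $(n,\rho^{l}_n)$, $m\otimes_A n$ is the coequalizer of $\rho^r_m\otimes\mathrm{id}_n$ and $\mathrm{id}_m\otimes\rho^l_n$ from $m\otimes A\otimes n$ to $m\otimes n$; "$\otimes_A$ exists" means that these coequalizers exist and are preserved by $\otimes$. A $\Gamma$-graded right $A$-module $m=\bigoplus_i m_i$, with action components $\rho^r_{j,i}:m_j\otimes A_i\to m_{i+j}$, becomes an $A$-bimodule with left action components $\rho^{l}_{i,j}:=\kappa(i,j)^{-1}\rho^r_{j,i}\circ\beta_{A_i,m_j}:A_i\otimes m_j\to m_{i+j}$, and $m\,\widetilde\otimes\,n$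 is the right module underlying the bimodule tensor product $m\otimes_A n$ of the so obtained bimodules.
   Formalization: In (i) the graded-monoidal structure is for the transposed bicharacter (i,j) ↦ κ(j,i) rather than κ: with the stated conventions the twist is κ(|f|,|g'|), so the claim with κ fails for non-symmetric κ; for symmetric κ the two agree. *)

theory Defs
  imports "HOL-Computational_Algebra.Computational_Algebra" "HOL-Library.Function_Algebras" "HOL-Library.Cardinality"
begin

section \<open>Categories and functors\<close>

text \<open>Hom sets of different pairs of objects may overlap, so composition is indexed:
  \<open>Comp D x y z g f\<close> is the composite of \<open>f : x \<rightarrow> y\<close> and \<open>g : y \<rightarrow> z\<close>.
  In the same way the morphism part of a functor is indexed by source and target.\<close>

record ('o, 'm) cat =
  Obj :: "'o set"
  Hom :: "'o \<Rightarrow> 'o \<Rightarrow> 'm set"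
  Idm :: "'o \<Rightarrow> 'm"
  Comp :: "'o \<Rightarrow> 'o \<Rightarrow> 'o \<Rightarrow> 'm \<Rightarrow> 'm \<Rightarrow> 'm"

locale category =
  fixes D :: "('o, 'm, 'x) cat_scheme"
  assumes id_hom: "x \<in> Obj D \<Longrightarrow> Idm D x \<in> Hom D x x"
    and comp_hom: "\<lbrakk>x \<in> Obj D; y \<in> Obj D; z \<in> Obj D; f \<in> Hom D x y; g \<in> Hom D y z\<rbrakk>
          \<Longrightarrow> Comp D x y z g f \<in> Hom D x z"
    and id_left: "\<lbrakk>x \<in> Obj D; y \<in> Obj D; f \<in> Hom D x y\<rbrakk> \<Longrightarrow> Comp D x y y (Idm D y) f = f"
    and id_right: "\<lbrakk>x \<in> Obj D; y \<in> Obj D; f \<in> Hom D x y\<rbrakk> \<Longrightarrow> Comp D x x y f (Idm D x) = f"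
    and comp_assoc: "\<lbrakk>w \<in> Obj D; x \<in> Obj D; y \<in> Obj D; z \<in> Obj D;
            f \<in> Hom D w x; g \<in> Hom D x y; h \<in> Hom D y z\<rbrakk>
          \<Longrightarrow> Comp D w x z (Comp D x y z h g) f = Comp D w y z h (Comp D w x y g f)"

definition is_functor ::
  "('o, 'm, 'x) cat_scheme \<Rightarrow> ('p, 'n, 'y) cat_scheme \<Rightarrow> ('o \<Rightarrow> 'p) \<Rightarrow> ('o \<Rightarrow> 'o \<Rightarrow> 'm \<Rightarrow> 'n) \<Rightarrow> bool"
  where "is_functor D E Fo Fm \<longleftrightarrow>
    (\<forall>x \<in> Obj D. Fo x \<in> Obj E) \<and>
    (\<forall>x \<in> Obj D. \<forall>y \<in> Obj D. \<forall>f \<in> Hom D x y. Fm x y f \<in> Hom E (Fo x) (Fo y)) \<and>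
    (\<forall>x \<in> Obj D. Fm x x (Idm D x) = Idm E (Fo x)) \<and>
    (\<forall>x \<in> Obj D. \<forall>y \<in> Obj D. \<forall>z \<in> Obj D. \<forall>f \<in> Hom D x y. \<forall>g \<in> Hom D y z.
       Fm x z (Comp D x y z g f) = Comp E (Fo x) (Fo y) (Fo z) (Fm y z g) (Fm x y f))"

definition natural_isomorphism ::
  "('o, 'm, 'x) cat_scheme \<Rightarrow> ('p, 'n, 'y) cat_scheme
   \<Rightarrow> ('o \<Rightarrow> 'p) \<Rightarrow> ('o \<Rightarrow> 'o \<Rightarrow> 'm \<Rightarrow> 'n) \<Rightarrow> ('o \<Rightarrow> 'p) \<Rightarrow> ('o \<Rightarrow> 'o \<Rightarrow> 'm \<Rightarrow> 'n)
   \<Rightarrow> ('o \<Rightarrow> 'n) \<Rightarrow> bool"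
  where "natural_isomorphism D E Fo Fm Go Gm \<phi> \<longleftrightarrow>
    is_functor D E Fo Fm \<and> is_functor D E Go Gm \<and>
    (\<forall>x \<in> Obj D. \<phi> x \<in> Hom E (Fo x) (Go x) \<and>
       (\<exists>\<psi> \<in> Hom E (Go x) (Fo x).
          Comp E (Fo x) (Go x) (Fo x) \<psi> (\<phi> x) = Idm E (Fo x) \<and>
          Comp E (Go x) (Fo x) (Go x) (\<phi> x) \<psi> = Idm E (Go x))) \<and>
    (\<forall>x \<in> Obj D. \<forall>y \<in> Obj D. \<forall>f \<in> Hom D x y.
       Comp E (Fo x) (Fo y) (Go y) (\<phi> y) (Fm x y f) = Comp E (Fo x) (Go x) (Go y) (Gm x y f) (\<phi> x))"

definition product_category ::
  "('o, 'm, 'x) cat_scheme \<Rightarrow> ('p, 'n, 'y) cat_scheme \<Rightarrow> ('o \<times> 'p, 'm \<times> 'n) cat"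
  where "product_category D E =
    \<lparr>Obj = Obj D \<times> Obj E,
     Hom = (\<lambda>(d, e) (d', e'). Hom D d d' \<times> Hom E e e'),
     Idm = (\<lambda>(d, e). (Idm D d, Idm E e)),
     Comp = (\<lambda>(d, e) (d', e') (d'', e'') (f', g') (f, g).
       (Comp D d d' d'' f' f, Comp E e e' e'' g' g))\<rparr>"


section \<open>Graded linear categories\<close>

text \<open>The Hom spaces are subspaces of the vector space given by the type \<open>'m\<close> with scalar
  multiplication \<open>Scl\<close>. This is no restriction: any linear category is isomorphic to one of this
  form, with the direct sum of all Hom spaces as the ambient vector space.\<close>

record ('o, 'm, 'g, 'k) gcat = "('o, 'm) cat" +
  Grd :: "'g \<Rightarrow> 'o \<Rightarrow> 'o \<Rightarrow> 'm set"
  Scl :: "'k \<Rightarrow> 'm \<Rightarrow> 'm"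

definition direct_sum_of :: "('m::ab_group_add) set \<Rightarrow> ('g::finite \<Rightarrow> 'm set) \<Rightarrow> bool"
  where "direct_sum_of V W \<longleftrightarrow>
    (\<forall>i. W i \<subseteq> V) \<and> (\<forall>v \<in> V. \<exists>!w. (\<forall>i. w i \<in> W i) \<and> v = (\<Sum>i\<in>UNIV. w i))"

definition component :: "('g::finite \<Rightarrow> ('m::ab_group_add) set) \<Rightarrow> 'g \<Rightarrow> 'm \<Rightarrow> 'm"
  where "component W i v = (THE w. (\<forall>j. w j \<in> W j) \<and> v = (\<Sum>j\<in>UNIV. w j)) i"

locale graded_category = category D + vector_space "Scl D"
  for D :: "('o, 'm::ab_group_add, 'g::{finite, ab_group_add}, 'k::field) gcat" +
  assumes hom_subspace: "\<lbrakk>x \<in> Obj D; y \<in> Obj D\<rbrakk> \<Longrightarrow> module.subspace (Scl D) (Hom D x y)"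
    and grd_subspace: "\<lbrakk>x \<in> Obj D; y \<in> Obj D\<rbrakk> \<Longrightarrow> module.subspace (Scl D) (Grd D i x y)"
    and grd_direct_sum: "\<lbrakk>x \<in> Obj D; y \<in> Obj D\<rbrakk> \<Longrightarrow> direct_sum_of (Hom D x y) (\<lambda>i. Grd D i x y)"
    and comp_add_left: "\<lbrakk>x \<in> Obj D; y \<in> Obj D; z \<in> Obj D;
            f \<in> Hom D x y; g \<in> Hom D y z; g' \<in> Hom D y z\<rbrakk>
          \<Longrightarrow> Comp D x y z (g + g') f = Comp D x y z g f + Comp D x y z g' f"
    and comp_add_right: "\<lbrakk>x \<in> Obj D; y \<in> Obj D; z \<in> Obj D;
            f \<in> Hom D x y; f' \<in> Hom D x y; g \<in> Hom D y z\<rbrakk>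
          \<Longrightarrow> Comp D x y z g (f + f') = Comp D x y z g f + Comp D x y z g f'"
    and comp_scale_left: "\<lbrakk>x \<in> Obj D; y \<in> Obj D; z \<in> Obj D; f \<in> Hom D x y; g \<in> Hom D y z\<rbrakk>
          \<Longrightarrow> Comp D x y z (Scl D c g) f = Scl D c (Comp D x y z g f)"
    and comp_scale_right: "\<lbrakk>x \<in> Obj D; y \<in> Obj D; z \<in> Obj D; f \<in> Hom D x y; g \<in> Hom D y z\<rbrakk>
          \<Longrightarrow> Comp D x y z g (Scl D c f) = Scl D c (Comp D x y z g f)"
    and id_grade: "x \<in> Obj D \<Longrightarrow> Idm D x \<in> Grd D 0 x x"
    and comp_grade: "\<lbrakk>x \<in> Obj D; y \<in> Obj D; z \<in> Obj D; f \<in> Grd D i x y; g \<in> Grd D j y z\<rbrakk>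
          \<Longrightarrow> Comp D x y z g f \<in> Grd D (i + j) x z"

definition graded_functor ::
  "('o, 'm::ab_group_add, 'g, 'k) gcat \<Rightarrow> ('p, 'n::ab_group_add, 'g, 'k) gcat
   \<Rightarrow> ('o \<Rightarrow> 'p) \<Rightarrow> ('o \<Rightarrow> 'o \<Rightarrow> 'm \<Rightarrow> 'n) \<Rightarrow> bool"
  where "graded_functor D E Fo Fm \<longleftrightarrow>
    is_functor D E Fo Fm \<and>
    (\<forall>x \<in> Obj D. \<forall>y \<in> Obj D.
       (\<forall>f \<in> Hom D x y. \<forall>f' \<in> Hom D x y. Fm x y (f + f') = Fm x y f + Fm x y f') \<and>
       (\<forall>c. \<forall>f \<in> Hom D x y. Fm x y (Scl D c f) = Scl E c (Fm x y f)) \<and>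
       (\<forall>i. \<forall>f \<in> Grd D i x y. Fm x y f \<in> Grd E i (Fo x) (Fo y)))"


section \<open>Tensor products of vector spaces\<close>

text \<open>For subspaces \<open>V\<close>, \<open>W\<close> the tensor product is realised inside the dual of the space of
  bilinear forms on \<open>V \<times> W\<close>, with \<open>v \<otimes> w\<close> acting as evaluation at \<open>(v, w)\<close>. Over a field the
  canonical map from the tensor product to this dual is injective;
  see \<open>tensor_universal\<close> below.\<close>

definition bilinear_form ::
  "('k::field \<Rightarrow> 'm::ab_group_add \<Rightarrow> 'm) \<Rightarrow> ('k \<Rightarrow> 'n::ab_group_add \<Rightarrow> 'n)
   \<Rightarrow> 'm set \<Rightarrow> 'n set \<Rightarrow> ('m \<Rightarrow> 'n \<Rightarrow> 'k) \<Rightarrow> bool"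
  where "bilinear_form s t V W b \<longleftrightarrow>
    (\<forall>v \<in> V. \<forall>v' \<in> V. \<forall>w \<in> W. b (v + v') w = b v w + b v' w) \<and>
    (\<forall>v \<in> V. \<forall>w \<in> W. \<forall>w' \<in> W. b v (w + w') = b v w + b v w') \<and>
    (\<forall>c. \<forall>v \<in> V. \<forall>w \<in> W. b (s c v) w = c * b v w \<and> b v (t c w) = c * b v w)"

definition ptensor ::
  "('k::field \<Rightarrow> 'm::ab_group_add \<Rightarrow> 'm) \<Rightarrow> ('k \<Rightarrow> 'n::ab_group_add \<Rightarrow> 'n)
   \<Rightarrow> 'm set \<Rightarrow> 'n set \<Rightarrow> 'm \<Rightarrow> 'n \<Rightarrow> (('m \<Rightarrow> 'n \<Rightarrow> 'k) \<Rightarrow> 'k)"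
  where "ptensor s t V W v w = (\<lambda>b. if bilinear_form s t V W b then b v w else 0)"

definition fun_scale :: "'k::field \<Rightarrow> ('a \<Rightarrow> 'k) \<Rightarrow> ('a \<Rightarrow> 'k)"
  where "fun_scale c F = (\<lambda>b. c * F b)"

definition tensor_space ::
  "('k::field \<Rightarrow> 'm::ab_group_add \<Rightarrow> 'm) \<Rightarrow> ('k \<Rightarrow> 'n::ab_group_add \<Rightarrow> 'n)
   \<Rightarrow> 'm set \<Rightarrow> 'n set \<Rightarrow> (('m \<Rightarrow> 'n \<Rightarrow> 'k) \<Rightarrow> 'k) set"
  where "tensor_space s t V W =
    module.span fun_scale {ptensor s t V W v w | v w. v \<in> V \<and> w \<in> W}"

lemma vector_space_fun_scale: "vector_space (fun_scale :: 'k::field \<Rightarrow> ('a \<Rightarrow> 'k) \<Rightarrow> 'a \<Rightarrow> 'k)"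
  by unfold_locales (auto simp: fun_scale_def fun_eq_iff algebra_simps)

lemma functionals_separate:
  fixes u :: "'k::field \<Rightarrow> 'u::ab_group_add \<Rightarrow> 'u"
  assumes u: "vector_space u"
    and eq: "\<And>\<phi>. (\<And>x y. \<phi> (x + y) = \<phi> x + \<phi> y) \<Longrightarrow> (\<And>c x. \<phi> (u c x) = c * \<phi> x) \<Longrightarrow> \<phi> a = (\<phi> b :: 'k)"
  shows "a = b"
proof (rule ccontr)
  assume ne: "a \<noteq> b"
  interpret vector_space_pair u "(*) :: 'k \<Rightarrow> 'k \<Rightarrow> 'k"
    by (intro vector_space_pair.intro u) (unfold_locales, auto simp: algebra_simps)
  have "vs1.independent {a - b}"
    using ne by simp
  then obtain \<phi> where \<phi>: "Vector_Spaces.linear u (*) \<phi>" "\<forall>x\<in>{a - b}. \<phi> x = 1"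
    using linear_independent_extend[of "{a - b}" "\<lambda>_. 1"] by blast
  interpret l: Vector_Spaces.linear u "(*)" \<phi> by (rule \<phi>)
  have "\<phi> a = \<phi> b" by (rule eq) (simp_all add: l.add l.scale)
  moreover have "\<phi> a - \<phi> b = 1" using \<phi>(2) l.diff by simp
  ultimately show False by simp
qed

theorem tensor_universal:
  fixes s :: "'k::field \<Rightarrow> 'm::ab_group_add \<Rightarrow> 'm" and t :: "'k \<Rightarrow> 'n::ab_group_add \<Rightarrow> 'n"
    and u :: "'k \<Rightarrow> 'u::ab_group_add \<Rightarrow> 'u" and B :: "'m \<Rightarrow> 'n \<Rightarrow> 'u"
  assumes u: "vector_space u"
    and B: "\<And>v v' w. \<lbrakk>v \<in> V; v' \<in> V; w \<in> W\<rbrakk> \<Longrightarrow> B (v + v') w = B v w + B v' w"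
      "\<And>v w w'. \<lbrakk>v \<in> V; w \<in> W; w' \<in> W\<rbrakk> \<Longrightarrow> B v (w + w') = B v w + B v w'"
      "\<And>c v w. \<lbrakk>v \<in> V; w \<in> W\<rbrakk> \<Longrightarrow> B (s c v) w = u c (B v w)"
      "\<And>c v w. \<lbrakk>v \<in> V; w \<in> W\<rbrakk> \<Longrightarrow> B v (t c w) = u c (B v w)"
  shows "\<exists>L. (\<forall>F \<in> tensor_space s t V W. \<forall>G \<in> tensor_space s t V W. L (F + G) = L F + L G) \<and>
    (\<forall>c. \<forall>F \<in> tensor_space s t V W. L (fun_scale c F) = u c (L F)) \<and>
    (\<forall>v \<in> V. \<forall>w \<in> W. L (ptensor s t V W v w) = B v w)"
proof -
  interpret u: vector_space u by (rule u)
  interpret fs: vector_space "fun_scale :: 'k \<Rightarrow> (('m \<Rightarrow> 'n \<Rightarrow> 'k) \<Rightarrow> 'k) \<Rightarrow> _"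
    by (rule vector_space_fun_scale)
  define lin where "lin \<phi> \<longleftrightarrow> (\<forall>x y. \<phi> (x + y) = \<phi> x + \<phi> y) \<and> (\<forall>c x. \<phi> (u c x) = c * \<phi> x)"
    for \<phi> :: "'u \<Rightarrow> 'k"
  define rel where "rel F x \<longleftrightarrow> (\<forall>\<phi>. lin \<phi> \<longrightarrow> \<phi> x = F (\<lambda>v w. \<phi> (B v w)))"
    for F :: "('m \<Rightarrow> 'n \<Rightarrow> 'k) \<Rightarrow> 'k" and x
  have uniq: "x = y" if "rel F x" "rel F y" for F x y
    by (rule functionals_separate[OF u]) (use that[unfolded rel_def] in \<open>simp add: lin_def\<close>)
  have gen: "rel (ptensor s t V W v w) (B v w)" if "v \<in> V" "w \<in> W" for v w
    unfolding rel_def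
  proof (intro allI impI)
    fix \<phi> assume "lin \<phi>"
    then have "bilinear_form s t V W (\<lambda>v w. \<phi> (B v w))"
      by (auto simp: bilinear_form_def lin_def B)
    then show "\<phi> (B v w) = ptensor s t V W v w (\<lambda>v w. \<phi> (B v w))"
      by (simp add: ptensor_def)
  qed
  have zero: "rel 0 0"
  proof -
    have "\<phi> 0 = 0" if "lin \<phi>" for \<phi>
      using that unfolding lin_def by (metis add_cancel_right_right)
    then show ?thesis by (simp add: rel_def)
  qed
  have add: "rel (F + G) (x + y)" if "rel F x" "rel G y" for F G x y
    using that by (auto simp: rel_def lin_def)
  have scale: "rel (fun_scale c F) (u c x)" if "rel F x" for c F x
    using that by (auto simp: rel_def lin_def fun_scale_def)
  have ex: "\<exists>x. rel F x" if "F \<in> tensor_space s t V W" for F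
    using that unfolding tensor_space_def
  proof (induction rule: fs.span_induct_alt)
    case base
    then show ?case using zero by blast
  next
    case (step c x y)
    then obtain v w z where "x = ptensor s t V W v w" "v \<in> V" "w \<in> W" "rel y z" by blast
    then show ?case using add[OF scale[OF gen]] by blast
  qed
  define L where "L F = (THE x. rel F x)" for F
  have L: "L F = x" if "rel F x" for F x
    unfolding L_def using that uniq by blast
  show ?thesis
  proof (intro exI[of _ L] conjI ballI allI)
    fix F G assume "F \<in> tensor_space s t V W" "G \<in> tensor_space s t V W"
    then show "L (F + G) = L F + L G" using ex L add by metis
  next
    fix c F assume "F \<in> tensor_space s t V W"
    then show "L (fun_scale c F) = u c (L F)" using ex L scale by metis
  next
    fix v w assume "v \<in> V" "w \<in> W"
    then show "L (ptensor s t V W v w) = B v w" using L gen by blast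
  qed
qed


section \<open>Twisted products and graded-monoidal categories\<close>

abbreviation hom_tensor ::
  "('o, 'm::ab_group_add, 'g, 'k::field) gcat \<Rightarrow> ('p, 'n::ab_group_add, 'g, 'k) gcat
   \<Rightarrow> 'o \<times> 'p \<Rightarrow> 'o \<times> 'p \<Rightarrow> 'm \<Rightarrow> 'n \<Rightarrow> (('m \<Rightarrow> 'n \<Rightarrow> 'k) \<Rightarrow> 'k)"
  where "hom_tensor D E P Q \<equiv>
    ptensor (Scl D) (Scl E) (Hom D (fst P) (fst Q)) (Hom E (snd P) (snd Q))"

text \<open>The composition below is the bilinear extension of
  \<open>(f' \<otimes> g') \<circ> (f \<otimes> g) = \<kappa>(|g'|, |f|) (f' \<circ> f) \<otimes> (g' \<circ> g)\<close> for homogeneous morphisms,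
  see \<open>twisted_product_comp\<close>: tensors are functionals on bilinear forms, and \<open>i\<close>, \<open>j\<close>
  run over the grades of the components of \<open>f\<close> and \<open>g'\<close>.\<close>

definition twisted_product ::
  "('g::{finite, ab_group_add} \<Rightarrow> 'g \<Rightarrow> 'k::field)
   \<Rightarrow> ('o, 'm::ab_group_add, 'g, 'k) gcat \<Rightarrow> ('p, 'n::ab_group_add, 'g, 'k) gcat
   \<Rightarrow> ('o \<times> 'p, ('m \<Rightarrow> 'n \<Rightarrow> 'k) \<Rightarrow> 'k, 'g, 'k) gcat"
  where "twisted_product \<kappa> D E =
    \<lparr>Obj = Obj D \<times> Obj E,
     Hom = (\<lambda>P Q. tensor_space (Scl D) (Scl E) (Hom D (fst P) (fst Q)) (Hom E (snd P) (snd Q))),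
     Idm = (\<lambda>P. hom_tensor D E P P (Idm D (fst P)) (Idm E (snd P))),
     Comp = (\<lambda>P Q R S T b.
       if bilinear_form (Scl D) (Scl E) (Hom D (fst P) (fst R)) (Hom E (snd P) (snd R)) b
       then S (\<lambda>f' g'. T (\<lambda>f g. \<Sum>i\<in>UNIV. \<Sum>j\<in>UNIV. \<kappa> j i *
              b (Comp D (fst P) (fst Q) (fst R) f' (component (\<lambda>i. Grd D i (fst P) (fst Q)) i f))
                (Comp E (snd P) (snd Q) (snd R) (component (\<lambda>i. Grd E i (snd Q) (snd R)) j g') g)))
       else 0),
     Grd = (\<lambda>k P Q. module.span fun_scale
       {hom_tensor D E P Q f g | f g i j.
          f \<in> Grd D i (fst P) (fst Q) \<and> g \<in> Grd E j (snd P) (snd Q) \<and> i + j = k}),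
     Scl = fun_scale\<rparr>"

context graded_category
begin

lemma component_unique:
  assumes "x \<in> Obj D" "y \<in> Obj D" "\<And>i. w i \<in> Grd D i x y"
  shows "component (\<lambda>i. Grd D i x y) i (\<Sum>j\<in>UNIV. w j) = w i"
proof -
  have "\<forall>i. Grd D i x y \<subseteq> Hom D x y"
    using grd_direct_sum[OF assms(1,2)] by (simp add: direct_sum_of_def)
  then have "(\<Sum>j\<in>UNIV. w j) \<in> Hom D x y"
    using assms(3) by (intro subspace_sum hom_subspace assms) blast
  then have "\<exists>!w'. (\<forall>j. w' j \<in> Grd D j x y) \<and> (\<Sum>j\<in>UNIV. w j) = (\<Sum>j\<in>UNIV. w' j)"
    using grd_direct_sum[OF assms(1,2)] by (simp add: direct_sum_of_def)
  then have "(THE w'. (\<forall>j. w' j \<in> Grd D j x y) \<and> (\<Sum>j\<in>UNIV. w j) = (\<Sum>j\<in>UNIV. w' j)) = w"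
    using assms(3) by (intro the1_equality) auto
  then show ?thesis by (simp add: component_def)
qed

lemma grd_hom: "\<lbrakk>x \<in> Obj D; y \<in> Obj D; f \<in> Grd D i x y\<rbrakk> \<Longrightarrow> f \<in> Hom D x y"
  using grd_direct_sum by (auto simp: direct_sum_of_def)

lemma decompE:
  assumes "x \<in> Obj D" "y \<in> Obj D" "f \<in> Hom D x y"
  obtains w where "\<And>i. w i \<in> Grd D i x y" "f = (\<Sum>j\<in>UNIV. w j)"
    "\<And>i. component (\<lambda>i. Grd D i x y) i f = w i"
proof -
  obtain w where w: "\<And>i. w i \<in> Grd D i x y" "f = (\<Sum>j\<in>UNIV. w j)"
    using grd_direct_sum[OF assms(1,2)] assms(3) unfolding direct_sum_of_def by meson
  then show ?thesis using component_unique[OF assms(1,2) w(1)] that by auto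
qed

lemma component_hom:
  assumes "x \<in> Obj D" "y \<in> Obj D" "f \<in> Hom D x y"
  shows "component (\<lambda>i. Grd D i x y) i f \<in> Hom D x y"
  using decompE[OF assms] grd_hom[OF assms(1,2)] by metis

lemma component_add:
  assumes "x \<in> Obj D" "y \<in> Obj D" "f \<in> Hom D x y" "g \<in> Hom D x y"
  shows "component (\<lambda>i. Grd D i x y) i (f + g) =
    component (\<lambda>i. Grd D i x y) i f + component (\<lambda>i. Grd D i x y) i g"
proof -
  obtain v where v: "\<And>i. v i \<in> Grd D i x y" "f = (\<Sum>j\<in>UNIV. v j)"
    "\<And>i. component (\<lambda>i. Grd D i x y) i f = v i" by (rule decompE[OF assms(1-3)]) blast
  obtain w where w: "\<And>i. w i \<in> Grd D i x y" "g = (\<Sum>j\<in>UNIV. w j)"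
    "\<And>i. component (\<lambda>i. Grd D i x y) i g = w i" by (rule decompE[OF assms(1,2,4)]) blast
  have "component (\<lambda>i. Grd D i x y) i (\<Sum>j\<in>UNIV. v j + w j) = v i + w i"
    using v(1) w(1) by (intro component_unique assms subspace_add grd_subspace)
  then show ?thesis using v(2,3) w(2,3) by (simp add: sum.distrib)
qed

lemma component_scale:
  assumes "x \<in> Obj D" "y \<in> Obj D" "f \<in> Hom D x y"
  shows "component (\<lambda>i. Grd D i x y) i (Scl D c f) = Scl D c (component (\<lambda>i. Grd D i x y) i f)"
proof -
  obtain v where v: "\<And>i. v i \<in> Grd D i x y" "f = (\<Sum>j\<in>UNIV. v j)"
    "\<And>i. component (\<lambda>i. Grd D i x y) i f = v i" by (rule decompE[OF assms]) blast
  have "component (\<lambda>i. Grd D i x y) i (\<Sum>j\<in>UNIV. Scl D c (v j)) = Scl D c (v i)"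
    using v(1) by (intro component_unique assms subspace_scale grd_subspace)
  then show ?thesis using v(2,3) by (simp add: scale_sum_right)
qed

lemma component_homogeneous:
  assumes "x \<in> Obj D" "y \<in> Obj D" "f \<in> Grd D a x y"
  shows "component (\<lambda>i. Grd D i x y) i f = (if i = a then f else 0)"
proof -
  have "component (\<lambda>i. Grd D i x y) i (\<Sum>j\<in>UNIV. if j = a then f else 0) = (if i = a then f else 0)"
    using assms by (intro component_unique) (auto intro: subspace_0 grd_subspace)
  then show ?thesis by simp
qed

end

lemma bilinear_form_zero:
  assumes "bilinear_form s t V W b" "vector_space s" "vector_space t"
    "module.subspace s V" "module.subspace t W"
  shows "w \<in> W \<Longrightarrow> b 0 w = 0" "v \<in> V \<Longrightarrow> b v 0 = 0"
proof -
  interpret s: vector_space s by fact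
  interpret t: vector_space t by fact
  note 0 = s.subspace_0[OF assms(4)] t.subspace_0[OF assms(5)]
  show "b 0 w = 0" if "w \<in> W"
  proof -
    have "b (0 + 0) w = b 0 w + b 0 w" using assms(1) 0 that unfolding bilinear_form_def by blast
    then show ?thesis unfolding add_0_left by (rule add_cancel_right_right[THEN iffD1])
  qed
  show "b v 0 = 0" if "v \<in> V"
  proof -
    have "b v (0 + 0) = b v 0 + b v 0" using assms(1) 0 that unfolding bilinear_form_def by blast
    then show ?thesis unfolding add_0_left by (rule add_cancel_right_right[THEN iffD1])
  qed
qed

theorem twisted_product_comp:
  fixes D :: "('o, 'm::ab_group_add, 'g::{finite, ab_group_add}, 'k::field) gcat"
    and E :: "('p, 'n::ab_group_add, 'g, 'k) gcat"
  assumes "graded_category D" "graded_category E"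
    and P: "P \<in> Obj D \<times> Obj E" and Q: "Q \<in> Obj D \<times> Obj E" and R: "R \<in> Obj D \<times> Obj E"
    and f: "f \<in> Grd D i (fst P) (fst Q)" and f': "f' \<in> Hom D (fst Q) (fst R)"
    and g: "g \<in> Hom E (snd P) (snd Q)" and g': "g' \<in> Grd E j (snd Q) (snd R)"
  shows "Comp (twisted_product \<kappa> D E) P Q R (hom_tensor D E Q R f' g') (hom_tensor D E P Q f g) =
    fun_scale (\<kappa> j i) (hom_tensor D E P R (Comp D (fst P) (fst Q) (fst R) f' f)
                                           (Comp E (snd P) (snd Q) (snd R) g' g))"
proof
  interpret D: graded_category D by fact
  interpret E: graded_category E by fact
  obtain p1 p2 q1 q2 r1 r2 where e: "P = (p1, p2)" "Q = (q1, q2)" "R = (r1, r2)"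
    by (metis surj_pair)
  have ob: "p1 \<in> Obj D" "q1 \<in> Obj D" "r1 \<in> Obj D" "p2 \<in> Obj E" "q2 \<in> Obj E" "r2 \<in> Obj E"
    using P Q R e by auto
  note dh = D.component_hom[OF ob(1,2)] and eh = E.component_hom[OF ob(5,6)]
  let ?V = "Hom D p1 r1" and ?W = "Hom E p2 r2"
  fix b :: "'m \<Rightarrow> 'n \<Rightarrow> 'k"
  let ?in = "\<lambda>f' g' f g. \<Sum>i\<in>UNIV. \<Sum>j\<in>UNIV. \<kappa> j i *
              b (Comp D p1 q1 r1 f' (component (\<lambda>i. Grd D i p1 q1) i f))
                (Comp E p2 q2 r2 (component (\<lambda>i. Grd E i q2 r2) j g') g)"
  show "Comp (twisted_product \<kappa> D E) P Q R (hom_tensor D E Q R f' g') (hom_tensor D E P Q f g) b =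
    fun_scale (\<kappa> j i) (hom_tensor D E P R (Comp D (fst P) (fst Q) (fst R) f' f)
                                           (Comp E (snd P) (snd Q) (snd R) g' g)) b"
  proof (cases "bilinear_form (Scl D) (Scl E) ?V ?W b")
    case False
    then show ?thesis by (simp add: twisted_product_def ptensor_def fun_scale_def e)
  next
    case b: True
    have bl: "b (v + v') w = b v w + b v' w" if "v \<in> ?V" "v' \<in> ?V" "w \<in> ?W" for v v' w
      using b that by (auto simp: bilinear_form_def)
    have br: "b v (w + w') = b v w + b v w'" if "v \<in> ?V" "w \<in> ?W" "w' \<in> ?W" for v w w'
      using b that by (auto simp: bilinear_form_def)
    have bs: "b (Scl D c v) w = c * b v w" "b v (Scl E c w) = c * b v w"
      if "v \<in> ?V" "w \<in> ?W" for c v w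
      using b that by (auto simp: bilinear_form_def)
    have ch: "Comp D p1 q1 r1 h' h \<in> ?V" if "h \<in> Hom D p1 q1" "h' \<in> Hom D q1 r1" for h h'
      using D.comp_hom ob that by blast
    have ce: "Comp E p2 q2 r2 h' h \<in> ?W" if "h \<in> Hom E p2 q2" "h' \<in> Hom E q2 r2" for h h'
      using E.comp_hom ob that by blast
    have bil1: "bilinear_form (Scl D) (Scl E) (Hom D p1 q1) (Hom E p2 q2) (?in u w)"
      if "u \<in> Hom D q1 r1" "w \<in> Hom E q2 r2" for u w
      unfolding bilinear_form_def using that ob
      by (simp add: D.component_add D.component_scale D.comp_add_right E.comp_add_right
          D.comp_scale_right E.comp_scale_right dh eh bl br bs ch ce distrib_left sum.distrib
          sum_distrib_left mult.left_commute)
    have eq1: "Comp (twisted_product \<kappa> D E) P Q R (hom_tensor D E Q R f' g') (hom_tensor D E P Q f g) b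
      = ptensor (Scl D) (Scl E) (Hom D q1 r1) (Hom E q2 r2) f' g'
          (\<lambda>u w. ptensor (Scl D) (Scl E) (Hom D p1 q1) (Hom E p2 q2) f g (?in u w))"
      using b by (simp add: twisted_product_def e)
    have fh: "f \<in> Hom D p1 q1" "g \<in> Hom E p2 q2" "f' \<in> Hom D q1 r1" "g' \<in> Hom E q2 r2"
      using f g f' g' e ob by (auto intro: D.grd_hom E.grd_hom)
    have bil2: "bilinear_form (Scl D) (Scl E) (Hom D q1 r1) (Hom E q2 r2)
        (\<lambda>u w. ptensor (Scl D) (Scl E) (Hom D p1 q1) (Hom E p2 q2) f g (?in u w))"
    proof -
      have "bilinear_form (Scl D) (Scl E) (Hom D q1 r1) (Hom E q2 r2) (\<lambda>u w. ?in u w f g)"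
        unfolding bilinear_form_def using ob fh
        by (simp add: E.component_add E.component_scale D.comp_add_left E.comp_add_left
            D.comp_scale_left E.comp_scale_left dh eh bl br bs ch ce distrib_left sum.distrib
            sum_distrib_left mult.left_commute)
      moreover have "ptensor (Scl D) (Scl E) (Hom D p1 q1) (Hom E p2 q2) f g (?in u w) = ?in u w f g"
        if "u \<in> Hom D q1 r1" "w \<in> Hom E q2 r2" for u w
        using bil1[OF that] by (simp add: ptensor_def)
      moreover have "module.subspace (Scl D) (Hom D q1 r1)" "module.subspace (Scl E) (Hom E q2 r2)"
        using D.hom_subspace E.hom_subspace ob by auto
      ultimately show ?thesis
        by (simp add: bilinear_form_def D.subspace_add E.subspace_add D.subspace_scale E.subspace_scale)
    qed
    note eq1
    also have "ptensor (Scl D) (Scl E) (Hom D q1 r1) (Hom E q2 r2) f' g'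
          (\<lambda>u w. ptensor (Scl D) (Scl E) (Hom D p1 q1) (Hom E p2 q2) f g (?in u w)) = ?in f' g' f g"
      using bil2 bil1[OF fh(3,4)] by (simp add: ptensor_def)
    also have "\<dots> = (\<Sum>i'\<in>UNIV. \<Sum>j'\<in>UNIV. if i' = i \<and> j' = j then
        \<kappa> j i * b (Comp D p1 q1 r1 f' f) (Comp E p2 q2 r2 g' g) else 0)"
    proof (intro sum.cong refl)
      fix i' j' :: 'g
      have z1: "Comp D p1 q1 r1 f' 0 = 0"
        using D.comp_scale_right[OF ob(1-3) fh(1,3), of 0] by simp
      have z2: "Comp E p2 q2 r2 0 g = 0"
        using E.comp_scale_left[OF ob(4-6) fh(2,4), of 0] by simp
      note bz = bilinear_form_zero[OF b D.vector_space_axioms E.vector_space_axioms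
          D.hom_subspace[OF ob(1,3)] E.hom_subspace[OF ob(4,6)]]
      have "b 0 (Comp E p2 q2 r2 g' g) = 0" "b (Comp D p1 q1 r1 f' f) 0 = 0" "b 0 0 = 0"
        using bz ch ce fh E.subspace_0[OF E.hom_subspace[OF ob(4,6)]] by auto
      then show "\<kappa> j' i' * b (Comp D p1 q1 r1 f' (component (\<lambda>i. Grd D i p1 q1) i' f))
                (Comp E p2 q2 r2 (component (\<lambda>i. Grd E i q2 r2) j' g') g)
         = (if i' = i \<and> j' = j then
            \<kappa> j i * b (Comp D p1 q1 r1 f' f) (Comp E p2 q2 r2 g' g) else 0)"
        using f g' e z1 z2 by (simp add: D.component_homogeneous[OF ob(1,2)]
            E.component_homogeneous[OF ob(5,6)])
    qed
    also have "\<dots> = (\<Sum>i'\<in>UNIV. if i' = i then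
        \<kappa> j i * b (Comp D p1 q1 r1 f' f) (Comp E p2 q2 r2 g' g) else 0)"
      by (intro sum.cong refl) simp
    finally show ?thesis using b
      by (simp add: ptensor_def fun_scale_def e)
  qed
qed

locale graded_monoidal_category = graded_category D
  for \<kappa> :: "'g::{finite, ab_group_add} \<Rightarrow> 'g \<Rightarrow> 'k::field"
    and D :: "('o, 'm::ab_group_add, 'g, 'k) gcat"
    and I :: 'o
    and tob :: "'o \<Rightarrow> 'o \<Rightarrow> 'o"
    and tmor :: "'o \<times> 'o \<Rightarrow> 'o \<times> 'o \<Rightarrow> (('m \<Rightarrow> 'm \<Rightarrow> 'k) \<Rightarrow> 'k) \<Rightarrow> 'm" +
  assumes unit_obj: "I \<in> Obj D"
    and tensor_functor: "graded_functor (twisted_product \<kappa> D D) D (\<lambda>(x, y). tob x y) tmor"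
    and tob_assoc: "\<lbrakk>x \<in> Obj D; y \<in> Obj D; z \<in> Obj D\<rbrakk> \<Longrightarrow> tob (tob x y) z = tob x (tob y z)"
    and tob_unit_left: "x \<in> Obj D \<Longrightarrow> tob I x = x"
    and tob_unit_right: "x \<in> Obj D \<Longrightarrow> tob x I = x"
    and tmor_assoc: "\<lbrakk>x \<in> Obj D; y \<in> Obj D; z \<in> Obj D; x' \<in> Obj D; y' \<in> Obj D; z' \<in> Obj D;
            f \<in> Hom D x x'; g \<in> Hom D y y'; h \<in> Hom D z z'\<rbrakk>
          \<Longrightarrow> tmor (tob x y, z) (tob x' y', z') (hom_tensor D D (tob x y, z) (tob x' y', z')
                (tmor (x, y) (x', y') (hom_tensor D D (x, y) (x', y') f g)) h)
            = tmor (x, tob y z) (x', tob y' z') (hom_tensor D D (x, tob y z) (x', tob y' z')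
                f (tmor (y, z) (y', z') (hom_tensor D D (y, z) (y', z') g h)))"
    and tmor_unit_left: "\<lbrakk>x \<in> Obj D; y \<in> Obj D; f \<in> Hom D x y\<rbrakk>
          \<Longrightarrow> tmor (I, x) (I, y) (hom_tensor D D (I, x) (I, y) (Idm D I) f) = f"
    and tmor_unit_right: "\<lbrakk>x \<in> Obj D; y \<in> Obj D; f \<in> Hom D x y\<rbrakk>
          \<Longrightarrow> tmor (x, I) (y, I) (hom_tensor D D (x, I) (y, I) f (Idm D I)) = f"


section \<open>Linear braided monoidal categories\<close>

text \<open>The base category is strict monoidal. As above its Hom spaces are subspaces of the type
  \<open>'m\<close>; here composition and tensor product of morphisms need no object indices, since the direct
  sum of all Hom spaces carries them as (non-unital) bilinear products.\<close>

record ('o, 'm, 'k) bmcat =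
  ob :: "'o set"
  hom :: "'o \<Rightarrow> 'o \<Rightarrow> 'm set"
  idt :: "'o \<Rightarrow> 'm" (\<open>\<i>\<d>\<index>\<close>)
  cmp :: "'m \<Rightarrow> 'm \<Rightarrow> 'm" (infixl \<open>\<cdot>\<index>\<close> 65)
  scl :: "'k \<Rightarrow> 'm \<Rightarrow> 'm"
  unt :: 'o (\<open>\<one>\<index>\<close>)
  tob :: "'o \<Rightarrow> 'o \<Rightarrow> 'o" (infixr \<open>\<odot>\<index>\<close> 70)
  tmr :: "'m \<Rightarrow> 'm \<Rightarrow> 'm" (infixr \<open>\<otimes>\<index>\<close> 70)
  brd :: "'o \<Rightarrow> 'o \<Rightarrow> 'm" (\<open>\<beta>\<index>\<close>)

locale linear_category = vector_space "scl C"
  for C :: "('o, 'm::ab_group_add, 'k::field) bmcat" (structure) +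
  assumes hom_subspace: "\<lbrakk>x \<in> ob C; y \<in> ob C\<rbrakk> \<Longrightarrow> module.subspace (scl C) (hom C x y)"
    and id_hom: "x \<in> ob C \<Longrightarrow> \<i>\<d> x \<in> hom C x x"
    and cmp_hom: "\<lbrakk>x \<in> ob C; y \<in> ob C; z \<in> ob C; f \<in> hom C x y; g \<in> hom C y z\<rbrakk>
          \<Longrightarrow> g \<cdot> f \<in> hom C x z"
    and id_left: "\<lbrakk>x \<in> ob C; y \<in> ob C; f \<in> hom C x y\<rbrakk> \<Longrightarrow> \<i>\<d> y \<cdot> f = f"
    and id_right: "\<lbrakk>x \<in> ob C; y \<in> ob C; f \<in> hom C x y\<rbrakk> \<Longrightarrow> f \<cdot> \<i>\<d> x = f"
    and cmp_assoc: "\<lbrakk>w \<in> ob C; x \<in> ob C; y \<in> ob C; z \<in> ob C;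
            f \<in> hom C w x; g \<in> hom C x y; h \<in> hom C y z\<rbrakk> \<Longrightarrow> (h \<cdot> g) \<cdot> f = h \<cdot> (g \<cdot> f)"
    and cmp_add_left: "\<lbrakk>x \<in> ob C; y \<in> ob C; z \<in> ob C; f \<in> hom C x y; g \<in> hom C y z; g' \<in> hom C y z\<rbrakk>
          \<Longrightarrow> (g + g') \<cdot> f = (g \<cdot> f) + (g' \<cdot> f)"
    and cmp_add_right: "\<lbrakk>x \<in> ob C; y \<in> ob C; z \<in> ob C; f \<in> hom C x y; f' \<in> hom C x y; g \<in> hom C y z\<rbrakk>
          \<Longrightarrow> g \<cdot> (f + f') = (g \<cdot> f) + (g \<cdot> f')"
    and cmp_scale_left: "\<lbrakk>x \<in> ob C; y \<in> ob C; z \<in> ob C; f \<in> hom C x y; g \<in> hom C y z\<rbrakk>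
          \<Longrightarrow> scl C c g \<cdot> f = scl C c (g \<cdot> f)"
    and cmp_scale_right: "\<lbrakk>x \<in> ob C; y \<in> ob C; z \<in> ob C; f \<in> hom C x y; g \<in> hom C y z\<rbrakk>
          \<Longrightarrow> g \<cdot> scl C c f = scl C c (g \<cdot> f)"

locale additive_category = linear_category +
  assumes zero_object: "\<exists>z \<in> ob C. \<forall>x \<in> ob C. hom C x z = {0} \<and> hom C z x = {0}"
    and biproducts: "\<lbrakk>x \<in> ob C; y \<in> ob C\<rbrakk> \<Longrightarrow>
          \<exists>s \<in> ob C. \<exists>i \<in> hom C x s. \<exists>j \<in> hom C y s. \<exists>p \<in> hom C s x. \<exists>q \<in> hom C s y.
            p \<cdot> i = \<i>\<d> x \<and> q \<cdot> j = \<i>\<d> y \<and> p \<cdot> j = 0 \<and> q \<cdot> i = 0 \<and> (i \<cdot> p) + (j \<cdot> q) = \<i>\<d> s"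

locale linear_monoidal_category = additive_category +
  assumes unt_ob: "\<one> \<in> ob C"
    and tob_ob: "\<lbrakk>x \<in> ob C; y \<in> ob C\<rbrakk> \<Longrightarrow> x \<odot> y \<in> ob C"
    and tob_assoc: "\<lbrakk>x \<in> ob C; y \<in> ob C; z \<in> ob C\<rbrakk> \<Longrightarrow> (x \<odot> y) \<odot> z = x \<odot> (y \<odot> z)"
    and tob_unit_left: "x \<in> ob C \<Longrightarrow> \<one> \<odot> x = x"
    and tob_unit_right: "x \<in> ob C \<Longrightarrow> x \<odot> \<one> = x"
    and tmr_hom: "\<lbrakk>x \<in> ob C; y \<in> ob C; x' \<in> ob C; y' \<in> ob C; f \<in> hom C x x'; g \<in> hom C y y'\<rbrakk>
          \<Longrightarrow> f \<otimes> g \<in> hom C (x \<odot> y) (x' \<odot> y')"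
    and tmr_id: "\<lbrakk>x \<in> ob C; y \<in> ob C\<rbrakk> \<Longrightarrow> \<i>\<d> x \<otimes> \<i>\<d> y = \<i>\<d> (x \<odot> y)"
    and tmr_cmp: "\<lbrakk>x \<in> ob C; x' \<in> ob C; x'' \<in> ob C; y \<in> ob C; y' \<in> ob C; y'' \<in> ob C;
            f \<in> hom C x x'; f' \<in> hom C x' x''; g \<in> hom C y y'; g' \<in> hom C y' y''\<rbrakk>
          \<Longrightarrow> (f' \<otimes> g') \<cdot> (f \<otimes> g) = (f' \<cdot> f) \<otimes> (g' \<cdot> g)"
    and tmr_add_left: "\<lbrakk>x \<in> ob C; y \<in> ob C; x' \<in> ob C; y' \<in> ob C;
            f \<in> hom C x x'; f' \<in> hom C x x'; g \<in> hom C y y'\<rbrakk>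
          \<Longrightarrow> (f + f') \<otimes> g = (f \<otimes> g) + (f' \<otimes> g)"
    and tmr_add_right: "\<lbrakk>x \<in> ob C; y \<in> ob C; x' \<in> ob C; y' \<in> ob C;
            f \<in> hom C x x'; g \<in> hom C y y'; g' \<in> hom C y y'\<rbrakk>
          \<Longrightarrow> f \<otimes> (g + g') = (f \<otimes> g) + (f \<otimes> g')"
    and tmr_scale_left: "\<lbrakk>x \<in> ob C; y \<in> ob C; x' \<in> ob C; y' \<in> ob C; f \<in> hom C x x'; g \<in> hom C y y'\<rbrakk>
          \<Longrightarrow> scl C c f \<otimes> g = scl C c (f \<otimes> g)"
    and tmr_scale_right: "\<lbrakk>x \<in> ob C; y \<in> ob C; x' \<in> ob C; y' \<in> ob C; f \<in> hom C x x'; g \<in> hom C y y'\<rbrakk>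
          \<Longrightarrow> f \<otimes> scl C c g = scl C c (f \<otimes> g)"
    and tmr_assoc: "\<lbrakk>x \<in> ob C; y \<in> ob C; z \<in> ob C; x' \<in> ob C; y' \<in> ob C; z' \<in> ob C;
            f \<in> hom C x x'; g \<in> hom C y y'; h \<in> hom C z z'\<rbrakk>
          \<Longrightarrow> (f \<otimes> g) \<otimes> h = f \<otimes> (g \<otimes> h)"
    and tmr_unit_left: "\<lbrakk>x \<in> ob C; y \<in> ob C; f \<in> hom C x y\<rbrakk> \<Longrightarrow> \<i>\<d> \<one> \<otimes> f = f"
    and tmr_unit_right: "\<lbrakk>x \<in> ob C; y \<in> ob C; f \<in> hom C x y\<rbrakk> \<Longrightarrow> f \<otimes> \<i>\<d> \<one> = f"
    and end_unit: "bij_betw (\<lambda>c. scl C c (\<i>\<d> \<one>)) UNIV (hom C \<one> \<one>)"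

locale linear_braided_category = linear_monoidal_category +
  assumes brd_hom: "\<lbrakk>x \<in> ob C; y \<in> ob C\<rbrakk> \<Longrightarrow> \<beta> x y \<in> hom C (x \<odot> y) (y \<odot> x)"
    and brd_iso: "\<lbrakk>x \<in> ob C; y \<in> ob C\<rbrakk> \<Longrightarrow>
          \<exists>b \<in> hom C (y \<odot> x) (x \<odot> y). b \<cdot> \<beta> x y = \<i>\<d> (x \<odot> y) \<and> \<beta> x y \<cdot> b = \<i>\<d> (y \<odot> x)"
    and brd_natural: "\<lbrakk>x \<in> ob C; y \<in> ob C; x' \<in> ob C; y' \<in> ob C; f \<in> hom C x x'; g \<in> hom C y y'\<rbrakk>
          \<Longrightarrow> \<beta> x' y' \<cdot> (f \<otimes> g) = (g \<otimes> f) \<cdot> \<beta> x y"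
    and hexagon_right: "\<lbrakk>x \<in> ob C; y \<in> ob C; z \<in> ob C\<rbrakk>
          \<Longrightarrow> \<beta> x (y \<odot> z) = (\<i>\<d> y \<otimes> \<beta> x z) \<cdot> (\<beta> x y \<otimes> \<i>\<d> z)"
    and hexagon_left: "\<lbrakk>x \<in> ob C; y \<in> ob C; z \<in> ob C\<rbrakk>
          \<Longrightarrow> \<beta> (x \<odot> y) z = (\<beta> x z \<otimes> \<i>\<d> y) \<cdot> (\<i>\<d> x \<otimes> \<beta> y z)"


section \<open>Graded algebras and their modules\<close>

definition bicharacter :: "('g::ab_group_add \<Rightarrow> 'g \<Rightarrow> 'k::field) \<Rightarrow> bool"
  where "bicharacter \<kappa> \<longleftrightarrow>
    (\<forall>i j. \<kappa> i j \<noteq> 0) \<and>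
    (\<forall>i j k. \<kappa> (i + j) k = \<kappa> i k * \<kappa> j k) \<and>
    (\<forall>i j k. \<kappa> i (j + k) = \<kappa> i j * \<kappa> i k)"

record ('o, 'm, 'g) gobj =
  tot :: 'o
  cpt :: "'g \<Rightarrow> 'o"
  emb :: "'g \<Rightarrow> 'm"
  prj :: "'g \<Rightarrow> 'm"

record ('o, 'm, 'g) galg = "('o, 'm, 'g) gobj" +
  mul :: 'm
  eta :: 'm

record ('o, 'm, 'g) gmod = "('o, 'm, 'g) gobj" +
  act :: 'm

context
  fixes C :: "('o, 'm::ab_group_add, 'k::field) bmcat" (structure)
begin

definition graded_object :: "('o, 'm, 'g::finite, 'x) gobj_scheme \<Rightarrow> bool"
  where "graded_object X \<longleftrightarrow>
    tot X \<in> ob C \<and> (\<forall>i. cpt X i \<in> ob C) \<and>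
    (\<forall>i. emb X i \<in> hom C (cpt X i) (tot X) \<and> prj X i \<in> hom C (tot X) (cpt X i)) \<and>
    (\<forall>i j. prj X i \<cdot> emb X j = (if i = j then \<i>\<d> (cpt X i) else 0)) \<and>
    (\<Sum>i\<in>UNIV. emb X i \<cdot> prj X i) = \<i>\<d> (tot X)"

definition mul_cpt :: "('o, 'm, 'g::{finite, ab_group_add}) galg \<Rightarrow> 'g \<Rightarrow> 'g \<Rightarrow> 'm"
  where "mul_cpt A i j = prj A (i + j) \<cdot> (mul A \<cdot> (emb A i \<otimes> emb A j))"

definition graded_algebra :: "('o, 'm, 'g::{finite, ab_group_add}) galg \<Rightarrow> bool"
  where "graded_algebra A \<longleftrightarrow>
    graded_object A \<and>
    mul A \<in> hom C (tot A \<odot> tot A) (tot A) \<and> eta A \<in> hom C \<one> (tot A) \<and>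
    mul A \<cdot> (mul A \<otimes> \<i>\<d> (tot A)) = mul A \<cdot> (\<i>\<d> (tot A) \<otimes> mul A) \<and>
    mul A \<cdot> (eta A \<otimes> \<i>\<d> (tot A)) = \<i>\<d> (tot A) \<and>
    mul A \<cdot> (\<i>\<d> (tot A) \<otimes> eta A) = \<i>\<d> (tot A) \<and>
    (\<forall>i j. mul A \<cdot> (emb A i \<otimes> emb A j) = emb A (i + j) \<cdot> mul_cpt A i j)"

definition graded_commutative ::
  "('g \<Rightarrow> 'g \<Rightarrow> 'k) \<Rightarrow> ('o, 'm, 'g::{finite, ab_group_add}) galg \<Rightarrow> bool"
  where "graded_commutative \<kappa> A \<longleftrightarrow>
    (\<forall>i j. mul_cpt A j i \<cdot> \<beta> (cpt A i) (cpt A j) = scl C (\<kappa> i j) (mul_cpt A i j))"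

definition right_module :: "('o, 'm, 'g) galg \<Rightarrow> 'o \<times> 'm \<Rightarrow> bool"
  where "right_module A = (\<lambda>(m, r).
    m \<in> ob C \<and> r \<in> hom C (m \<odot> tot A) m \<and>
    r \<cdot> (r \<otimes> \<i>\<d> (tot A)) = r \<cdot> (\<i>\<d> m \<otimes> mul A) \<and> r \<cdot> (\<i>\<d> m \<otimes> eta A) = \<i>\<d> m)"

definition left_module :: "('o, 'm, 'g) galg \<Rightarrow> 'o \<times> 'm \<Rightarrow> bool"
  where "left_module A = (\<lambda>(n, l).
    n \<in> ob C \<and> l \<in> hom C (tot A \<odot> n) n \<and>
    l \<cdot> (\<i>\<d> (tot A) \<otimes> l) = l \<cdot> (mul A \<otimes> \<i>\<d> n) \<and> l \<cdot> (eta A \<otimes> \<i>\<d> n) = \<i>\<d> n)"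

definition right_module_hom :: "('o, 'm, 'g) galg \<Rightarrow> 'o \<times> 'm \<Rightarrow> 'o \<times> 'm \<Rightarrow> 'm set"
  where "right_module_hom A = (\<lambda>(m, r) (n, s).
    {f \<in> hom C m n. f \<cdot> r = s \<cdot> (f \<otimes> \<i>\<d> (tot A))})"

definition right_modules :: "('o, 'm, 'g) galg \<Rightarrow> ('o \<times> 'm, 'm) cat"
  where "right_modules A =
    \<lparr>Obj = Collect (right_module A), Hom = right_module_hom A,
     Idm = (\<lambda>M. \<i>\<d> (fst M)), Comp = (\<lambda>_ _ _ g f. g \<cdot> f)\<rparr>"


section \<open>Kleisli category and induced modules\<close>

definition kleisli :: "('o, 'm, 'g) galg \<Rightarrow> ('o, 'm, 'g, 'k) gcat"
  where "kleisli A =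
    \<lparr>Obj = ob C,
     Hom = (\<lambda>x y. hom C x (y \<odot> tot A)),
     Idm = (\<lambda>x. \<i>\<d> x \<otimes> eta A),
     Comp = (\<lambda>x y z g f. (\<i>\<d> z \<otimes> mul A) \<cdot> ((g \<otimes> \<i>\<d> (tot A)) \<cdot> f)),
     Grd = (\<lambda>i x y. {(\<i>\<d> y \<otimes> emb A i) \<cdot> h | h. h \<in> hom C x (y \<odot> cpt A i)}),
     Scl = scl C\<rparr>"

text \<open>Here \<open>f : x \<rightarrow> x' \<otimes> A\<close> and \<open>g : y \<rightarrow> y' \<otimes> A\<close>. With \<open>\<mu>\<^bsub>j,i\<^esub> \<circ> \<beta> = \<kappa>(i, j) \<mu>\<^bsub>i,j\<^esub>\<close> as graded
  commutativity, this product satisfies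
  \<open>(f' \<otimes> g') \<circ> (f \<otimes> g) = \<kappa>(|f|, |g'|) (f' \<circ> f) \<otimes> (g' \<circ> g)\<close>, since it is \<open>A\<^bsub>|f|\<^esub>\<close> that gets braided past
  \<open>A\<^bsub>|g'|\<^esub>\<close>. In terms of \<open>twisted_product\<close> the twist is thus the transpose \<open>\<lambda>i j. \<kappa> j i\<close>, which is
  \<open>\<kappa>\<close> itself if \<open>\<kappa>\<close> is symmetric.\<close>

definition kleisli_tensor :: "('o, 'm, 'g) galg \<Rightarrow> 'o \<Rightarrow> 'o \<Rightarrow> 'm \<Rightarrow> 'm \<Rightarrow> 'm"
  where "kleisli_tensor A x' y' f g =
    (\<i>\<d> x' \<otimes> \<i>\<d> y' \<otimes> mul A) \<cdot> ((\<i>\<d> x' \<otimes> \<beta> (tot A) y' \<otimes> \<i>\<d> (tot A)) \<cdot> (f \<otimes> g))"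

definition Ind :: "('o, 'm, 'g) galg \<Rightarrow> 'o \<Rightarrow> ('o, 'm, 'g) gmod"
  where "Ind A x =
    \<lparr>tot = x \<odot> tot A, cpt = (\<lambda>i. x \<odot> cpt A i),
     emb = (\<lambda>i. \<i>\<d> x \<otimes> emb A i), prj = (\<lambda>i. \<i>\<d> x \<otimes> prj A i),
     act = \<i>\<d> x \<otimes> mul A\<rparr>"

definition underlying :: "('o, 'm, 'g) gmod \<Rightarrow> 'o \<times> 'm"
  where "underlying X = (tot X, act X)"

definition kleisli_to_ind :: "('o, 'm, 'g) galg \<Rightarrow> 'o \<Rightarrow> 'o \<Rightarrow> 'm \<Rightarrow> 'm"
  where "kleisli_to_ind A x y f = (\<i>\<d> y \<otimes> mul A) \<cdot> (f \<otimes> \<i>\<d> (tot A))"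

text \<open>The object \<open>Ind(x)\<close> of the category of induced modules is represented by \<open>x\<close>: its grading
  depends on \<open>x\<close>, and different \<open>x\<close> may a priori give the same module \<open>(x \<otimes> A, id \<otimes> \<mu>)\<close>.
  The grading of the Hom spaces is the one obtained from \<open>Hom(x, y \<otimes> A)\<close>.\<close>

definition induced_modules :: "('o, 'm, 'g) galg \<Rightarrow> ('o, 'm, 'g, 'k) gcat"
  where "induced_modules A =
    \<lparr>Obj = ob C,
     Hom = (\<lambda>x y. right_module_hom A (underlying (Ind A x)) (underlying (Ind A y))),
     Idm = (\<lambda>x. \<i>\<d> (x \<odot> tot A)),
     Comp = (\<lambda>_ _ _ g f. g \<cdot> f),
     Grd = (\<lambda>i x y. kleisli_to_ind A x y ` Grd (kleisli A) i x y),
     Scl = scl C\<rparr>"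

definition induced_modules_0 :: "('o, 'm, 'g::ab_group_add) galg \<Rightarrow> ('o, 'm) cat"
  where "induced_modules_0 A =
    \<lparr>Obj = Obj (induced_modules A), Hom = Grd (induced_modules A) 0,
     Idm = Idm (induced_modules A), Comp = Comp (induced_modules A)\<rparr>"

text \<open>The transported product, for \<open>f : Ind(x) \<rightarrow> Ind(x')\<close> and \<open>g : Ind(y) \<rightarrow> Ind(y')\<close>.\<close>

definition ind_tensor :: "('o, 'm, 'g) galg \<Rightarrow> 'o \<times> 'o \<Rightarrow> 'o \<times> 'o \<Rightarrow> 'm \<Rightarrow> 'm \<Rightarrow> 'm"
  where "ind_tensor A = (\<lambda>(x, y) (x', y') f g.
    kleisli_to_ind A (x \<odot> y) (x' \<odot> y')
      (kleisli_tensor A x' y'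
        (inv_into (Hom (kleisli A) x x') (kleisli_to_ind A x x') f)
        (inv_into (Hom (kleisli A) y y') (kleisli_to_ind A y y') g)))"


section \<open>Frobenius algebras and the tensor product over an algebra\<close>

definition coproduct_separable_Frobenius :: "('o, 'm, 'g) galg \<Rightarrow> bool"
  where "coproduct_separable_Frobenius A \<longleftrightarrow>
    (\<exists>\<Delta> \<in> hom C (tot A) (tot A \<odot> tot A). \<exists>\<epsilon> \<in> hom C (tot A) \<one>.
       (\<Delta> \<otimes> \<i>\<d> (tot A)) \<cdot> \<Delta> = (\<i>\<d> (tot A) \<otimes> \<Delta>) \<cdot> \<Delta> \<and>
       (\<epsilon> \<otimes> \<i>\<d> (tot A)) \<cdot> \<Delta> = \<i>\<d> (tot A) \<and> (\<i>\<d> (tot A) \<otimes> \<epsilon>) \<cdot> \<Delta> = \<i>\<d> (tot A) \<and>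
       (mul A \<otimes> \<i>\<d> (tot A)) \<cdot> (\<i>\<d> (tot A) \<otimes> \<Delta>) = \<Delta> \<cdot> mul A \<and>
       (\<i>\<d> (tot A) \<otimes> mul A) \<cdot> (\<Delta> \<otimes> \<i>\<d> (tot A)) = \<Delta> \<cdot> mul A \<and>
       mul A \<cdot> \<Delta> = \<i>\<d> (tot A))"

definition is_coequalizer :: "'o \<Rightarrow> 'o \<Rightarrow> 'm \<Rightarrow> 'm \<Rightarrow> 'o \<Rightarrow> 'm \<Rightarrow> bool"
  where "is_coequalizer a b f g Q q \<longleftrightarrow>
    Q \<in> ob C \<and> q \<in> hom C b Q \<and> q \<cdot> f = q \<cdot> g \<and>
    (\<forall>z \<in> ob C. \<forall>h \<in> hom C b z. h \<cdot> f = h \<cdot> g \<longrightarrow> (\<exists>!u. u \<in> hom C Q z \<and> u \<cdot> q = h))"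

text \<open>\<open>TA\<close> is a choice of coequalizers \<open>q : m \<otimes> n \<rightarrow> Q\<close>, as pairs \<open>(Q, q)\<close>, for all right modules
  \<open>m\<close> and left modules \<open>n\<close>, and these are preserved by tensoring from either side.\<close>

definition tensor_over :: "('o, 'm, 'g) galg \<Rightarrow> ('o \<times> 'm \<Rightarrow> 'o \<times> 'm \<Rightarrow> 'o \<times> 'm) \<Rightarrow> bool"
  where "tensor_over A TA \<longleftrightarrow>
    (\<forall>m r n l Q q. right_module A (m, r) \<and> left_module A (n, l) \<and> TA (m, r) (n, l) = (Q, q) \<longrightarrow>
       is_coequalizer (m \<odot> tot A \<odot> n) (m \<odot> n) (r \<otimes> \<i>\<d> n) (\<i>\<d> m \<otimes> l) Q q \<and>
       (\<forall>z \<in> ob C.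
         is_coequalizer (z \<odot> m \<odot> tot A \<odot> n) (z \<odot> m \<odot> n)
           (\<i>\<d> z \<otimes> r \<otimes> \<i>\<d> n) (\<i>\<d> z \<otimes> \<i>\<d> m \<otimes> l) (z \<odot> Q) (\<i>\<d> z \<otimes> q) \<and>
         is_coequalizer (m \<odot> tot A \<odot> n \<odot> z) (m \<odot> n \<odot> z)
           (r \<otimes> \<i>\<d> n \<otimes> \<i>\<d> z) (\<i>\<d> m \<otimes> l \<otimes> \<i>\<d> z) (Q \<odot> z) (q \<otimes> \<i>\<d> z)))"

text \<open>Bimodules are triples \<open>(m, l, r)\<close> of an object, a left action and a right action.\<close>

definition bimodule :: "('o, 'm, 'g) galg \<Rightarrow> 'o \<times> 'm \<times> 'm \<Rightarrow> bool"
  where "bimodule A = (\<lambda>(m, l, r).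
    left_module A (m, l) \<and> right_module A (m, r) \<and>
    r \<cdot> (l \<otimes> \<i>\<d> (tot A)) = l \<cdot> (\<i>\<d> (tot A) \<otimes> r))"

definition bimodule_proj ::
  "('o \<times> 'm \<Rightarrow> 'o \<times> 'm \<Rightarrow> 'o \<times> 'm) \<Rightarrow> 'o \<times> 'm \<times> 'm \<Rightarrow> 'o \<times> 'm \<times> 'm \<Rightarrow> 'o \<times> 'm"
  where "bimodule_proj TA = (\<lambda>(m, lm, rm) (n, ln, rn). TA (m, rm) (n, ln))"

definition bimodule_tensor ::
  "('o, 'm, 'g) galg \<Rightarrow> ('o \<times> 'm \<Rightarrow> 'o \<times> 'm \<Rightarrow> 'o \<times> 'm)
   \<Rightarrow> 'o \<times> 'm \<times> 'm \<Rightarrow> 'o \<times> 'm \<times> 'm \<Rightarrow> 'o \<times> 'm \<times> 'm"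
  where "bimodule_tensor A TA = (\<lambda>(m, lm, rm) (n, ln, rn).
    let (Q, q) = bimodule_proj TA (m, lm, rm) (n, ln, rn) in
    (Q,
     THE l. l \<in> hom C (tot A \<odot> Q) Q \<and> l \<cdot> (\<i>\<d> (tot A) \<otimes> q) = q \<cdot> (lm \<otimes> \<i>\<d> n),
     THE r. r \<in> hom C (Q \<odot> tot A) Q \<and> r \<cdot> (q \<otimes> \<i>\<d> (tot A)) = q \<cdot> (\<i>\<d> m \<otimes> rn)))"

text \<open>\<open>f : M \<rightarrow> M'\<close> and \<open>g : N \<rightarrow> N'\<close>; the induced morphism between the coequalizers.\<close>

definition bimodule_tensor_mor ::
  "('o \<times> 'm \<Rightarrow> 'o \<times> 'm \<Rightarrow> 'o \<times> 'm)
   \<Rightarrow> 'o \<times> 'm \<times> 'm \<Rightarrow> 'o \<times> 'm \<times> 'm \<Rightarrow> 'o \<times> 'm \<times> 'm \<Rightarrow> 'o \<times> 'm \<times> 'm \<Rightarrow> 'm \<Rightarrow> 'm \<Rightarrow> 'm"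
  where "bimodule_tensor_mor TA M N M' N' f g =
    (let (Q, q) = bimodule_proj TA M N; (Q', q') = bimodule_proj TA M' N' in
     THE h. h \<in> hom C Q Q' \<and> h \<cdot> q = q' \<cdot> (f \<otimes> g))"

definition act_cpt ::
  "('o, 'm, 'g::{finite, ab_group_add}) galg \<Rightarrow> ('o, 'm, 'g) gmod \<Rightarrow> 'g \<Rightarrow> 'g \<Rightarrow> 'm"
  where "act_cpt A X j i = prj X (i + j) \<cdot> (act X \<cdot> (emb X j \<otimes> emb A i))"

definition graded_bimodule ::
  "('g \<Rightarrow> 'g \<Rightarrow> 'k) \<Rightarrow> ('o, 'm, 'g::{finite, ab_group_add}) galg \<Rightarrow> ('o, 'm, 'g) gmod
   \<Rightarrow> 'o \<times> 'm \<times> 'm"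
  where "graded_bimodule \<kappa> A X =
    (tot X,
     \<Sum>i\<in>UNIV. \<Sum>j\<in>UNIV. emb X (i + j) \<cdot>
       (scl C (inverse (\<kappa> i j)) (act_cpt A X j i \<cdot> \<beta> (cpt A i) (cpt X j)) \<cdot> (prj A i \<otimes> prj X j)),
     act X)"

definition tilde_tensor ::
  "('g \<Rightarrow> 'g \<Rightarrow> 'k) \<Rightarrow> ('o, 'm, 'g::{finite, ab_group_add}) galg
   \<Rightarrow> ('o \<times> 'm \<Rightarrow> 'o \<times> 'm \<Rightarrow> 'o \<times> 'm) \<Rightarrow> ('o, 'm, 'g) gmod \<Rightarrow> ('o, 'm, 'g) gmod \<Rightarrow> 'o \<times> 'm"
  where "tilde_tensor \<kappa> A TA X Y =
    (case bimodule_tensor A TA (graded_bimodule \<kappa> A X) (graded_bimodule \<kappa> A Y) of (Q, l, r) \<Rightarrow> (Q, r))"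

definition tilde_tensor_mor ::
  "('g \<Rightarrow> 'g \<Rightarrow> 'k) \<Rightarrow> ('o, 'm, 'g::{finite, ab_group_add}) galg
   \<Rightarrow> ('o \<times> 'm \<Rightarrow> 'o \<times> 'm \<Rightarrow> 'o \<times> 'm)
   \<Rightarrow> ('o, 'm, 'g) gmod \<Rightarrow> ('o, 'm, 'g) gmod \<Rightarrow> ('o, 'm, 'g) gmod \<Rightarrow> ('o, 'm, 'g) gmod
   \<Rightarrow> 'm \<Rightarrow> 'm \<Rightarrow> 'm"
  where "tilde_tensor_mor \<kappa> A TA X Y X' Y' =
    bimodule_tensor_mor TA (graded_bimodule \<kappa> A X) (graded_bimodule \<kappa> A Y)
      (graded_bimodule \<kappa> A X') (graded_bimodule \<kappa> A Y')"

text \<open>\<open>X \<otimes>~ Y\<close> carries the grading for which the projection \<open>q : X \<otimes> Y \<rightarrow> X \<otimes>~ Y\<close>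
  is grade-preserving. As \<open>q\<close> is epi, \<open>h : X \<otimes>~ Y \<rightarrow> Z\<close> preserves the grade iff
  \<open>h \<circ> q\<close> maps each \<open>X\<^sub>i \<otimes> Y\<^sub>j\<close> to \<open>Z\<^bsub>i+j\<^esub>\<close>.\<close>

definition tilde_grade_preserving ::
  "('g \<Rightarrow> 'g \<Rightarrow> 'k) \<Rightarrow> ('o, 'm, 'g::{finite, ab_group_add}) galg
   \<Rightarrow> ('o \<times> 'm \<Rightarrow> 'o \<times> 'm \<Rightarrow> 'o \<times> 'm)
   \<Rightarrow> ('o, 'm, 'g) gmod \<Rightarrow> ('o, 'm, 'g) gmod \<Rightarrow> ('o, 'm, 'g) gmod \<Rightarrow> 'm \<Rightarrow> bool"
  where "tilde_grade_preserving \<kappa> A TA X Y Z h \<longleftrightarrow>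
    (\<forall>i j. \<exists>u \<in> hom C (cpt X i \<odot> cpt Y j) (cpt Z (i + j)).
       h \<cdot> (snd (bimodule_proj TA (graded_bimodule \<kappa> A X) (graded_bimodule \<kappa> A Y))
            \<cdot> (emb X i \<otimes> emb Y j))
       = emb Z (i + j) \<cdot> u)"

end


end

theory Submission
  imports Defs
begin

text \<open>Under the equivalence with the Kleisli category, the product of module maps
  \<open>f : x \<otimes> A \<rightarrow> x' \<otimes> A\<close> and \<open>g : y \<otimes> A \<rightarrow> y' \<otimes> A\<close> becomes the composite of \<open>id\<^sub>x \<otimes> g\<close> with the conjugate
  of \<open>f \<otimes> id\<close> by the braiding of \<open>A\<close> with \<open>y'\<close>. Both factors are plainly functorial, so
  associativity and unitality reduce to the hexagon identities. The factors commute up to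
  \<open>\<kappa>(|f|, |g|)\<close>, because interchanging them swaps two factors of \<open>A\<close> in front of the
  multiplication; this is the twisted interchange law.

  For the second part, \<open>\<kappa>\<close> cancels in the left action on an induced module, which becomes
  \<open>l = (id\<^sub>y \<otimes> \<mu>) \<circ> (\<beta>\<^bsub>A,y\<^esub> \<otimes> id\<^sub>A)\<close>. The coequalizer pair of \<open>Ind(x)\<close> and \<open>Ind(y)\<close> is split by the unit
  of \<open>A\<close>, with quotient map \<open>id\<^sub>x \<otimes> l\<close> onto \<open>Ind(x \<otimes> y)\<close>. Maps of degree \<open>0\<close> are natural for \<open>l\<close>,
  which gives the natural isomorphism.\<close>

section \<open>Monoidal structures from bilinear families\<close>

text \<open>Working with module maps instead of Kleisli morphisms turns Kleisli composition into
  plain composition. The price is an inverse braiding in the conjugated factor, which is got rid of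
  by precomposing with a braiding.

  The order of passage fixes the twist: in \<open>(f' \<otimes> g') \<circ> (f \<otimes> g)\<close>
  it is \<open>g'\<close> that moves past \<open>f\<close>, at the cost of \<kappa>(|f|, |g'|),
  whereas \<open>twisted_product \<kappa>\<close> prescribes \<kappa>(|g'|, |f|). Hence the
  transposed bicharacter in the theorem.

  Two facts about degrees are not axioms. That the unit of \<open>A\<close> lies in degree 0,
  without which identities would not have degree 0, is derived from the unit laws. That maps of
  degree 0 commute with the left action rests on \<kappa>(i, 0) = 1, a consequence of the
  bicharacter law.

  Tensors are encoded as functionals on bilinear forms, so a map out of a tensor space is only
  available through its universal property. The passage from a bilinear family to a functor on the
  twisted product is therefore done once, for an arbitrary graded category.\<close>

lemma ptensor_add_left:
  "v \<in> V \<Longrightarrow> v' \<in> V \<Longrightarrow> w \<in> W \<Longrightarrow>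
    ptensor s t V W (v + v') w = ptensor s t V W v w + ptensor s t V W v' w"
  by (auto simp: ptensor_def bilinear_form_def fun_eq_iff)

lemma ptensor_add_right:
  "v \<in> V \<Longrightarrow> w \<in> W \<Longrightarrow> w' \<in> W \<Longrightarrow>
    ptensor s t V W v (w + w') = ptensor s t V W v w + ptensor s t V W v w'"
  by (auto simp: ptensor_def bilinear_form_def fun_eq_iff)

lemma ptensor_in_tensor_space:
  fixes s :: "'k::field \<Rightarrow> 'm::ab_group_add \<Rightarrow> 'm" and t :: "'k \<Rightarrow> 'n::ab_group_add \<Rightarrow> 'n"
  assumes "v \<in> V" "w \<in> W"
  shows "ptensor s t V W v w \<in> tensor_space s t V W"
proof -
  interpret fs: vector_space "fun_scale :: 'k \<Rightarrow> (('m \<Rightarrow> 'n \<Rightarrow> 'k) \<Rightarrow> 'k) \<Rightarrow> _"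
    by (rule vector_space_fun_scale)
  show ?thesis unfolding tensor_space_def using assms by (intro fs.span_base) auto
qed

section \<open>Tensor spaces of Hom spaces and their homogeneous generators\<close>

context graded_category
begin

abbreviation homt :: "'o \<times> 'o \<Rightarrow> 'o \<times> 'o \<Rightarrow> 'm \<Rightarrow> 'm \<Rightarrow> ('m \<Rightarrow> 'm \<Rightarrow> 'k) \<Rightarrow> 'k"
  where "homt \<equiv> hom_tensor D D"

abbreviation homts :: "'o \<times> 'o \<Rightarrow> 'o \<times> 'o \<Rightarrow> (('m \<Rightarrow> 'm \<Rightarrow> 'k) \<Rightarrow> 'k) set"
  where "homts P Q \<equiv>
    tensor_space (Scl D) (Scl D) (Hom D (fst P) (fst Q)) (Hom D (snd P) (snd Q))"

lemma homts_subspace: "module.subspace fun_scale (homts P Q)"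
proof -
  interpret fs: vector_space "fun_scale :: 'k \<Rightarrow> (('m \<Rightarrow> 'm \<Rightarrow> 'k) \<Rightarrow> 'k) \<Rightarrow> _"
    by (rule vector_space_fun_scale)
  show ?thesis unfolding tensor_space_def by (rule fs.subspace_span)
qed

lemma sum_grd_hom:
  assumes "x \<in> Obj D" "y \<in> Obj D" "\<And>i. w i \<in> Grd D i x y"
  shows "(\<Sum>i\<in>S. w i) \<in> Hom D x y"
  using assms by (intro subspace_sum hom_subspace) (auto intro: grd_hom)

lemma homt_zero:
  assumes "x \<in> Obj D" "y \<in> Obj D" "x' \<in> Obj D" "y' \<in> Obj D"
  shows "g \<in> Hom D y y' \<Longrightarrow> homt (x, y) (x', y') 0 g = 0"
    and "f \<in> Hom D x x' \<Longrightarrow> homt (x, y) (x', y') f 0 = 0"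
  using bilinear_form_zero[OF _ vector_space_axioms vector_space_axioms hom_subspace hom_subspace] assms
  by (auto simp: ptensor_def fun_eq_iff)

lemma homt_sum_left:
  assumes "x \<in> Obj D" "y \<in> Obj D" "x' \<in> Obj D" "y' \<in> Obj D"
    and "\<And>i. w i \<in> Grd D i x x'" "g \<in> Hom D y y'"
  shows "homt (x, y) (x', y') (\<Sum>i\<in>S. w i) g = (\<Sum>i\<in>S. homt (x, y) (x', y') (w i) g)"
proof (induction S rule: infinite_finite_induct)
  case (insert i S)
  then show ?case
    using assms by (simp add: ptensor_add_left sum_grd_hom grd_hom[of _ _ "w i" i])
qed (use homt_zero assms in auto)

lemma homt_sum_right:
  assumes "x \<in> Obj D" "y \<in> Obj D" "x' \<in> Obj D" "y' \<in> Obj D"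
    and "f \<in> Hom D x x'" "\<And>i. w i \<in> Grd D i y y'"
  shows "homt (x, y) (x', y') f (\<Sum>i\<in>S. w i) = (\<Sum>i\<in>S. homt (x, y) (x', y') f (w i))"
proof (induction S rule: infinite_finite_induct)
  case (insert i S)
  then show ?case
    using assms by (simp add: ptensor_add_right sum_grd_hom grd_hom[of _ _ "w i" i])
qed (use homt_zero assms in auto)

text \<open>Splitting both factors into components expands a pure tensor into homogeneous ones.
  These are the generators to use, since composition in the twisted product has a closed formula
  only on them.\<close>

lemma homts_span_homogeneous:
  assumes "P \<in> Obj D \<times> Obj D" "Q \<in> Obj D \<times> Obj D"
  shows "homts P Q = module.span fun_scale
    {homt P Q f g | f g i j. f \<in> Grd D i (fst P) (fst Q) \<and> g \<in> Grd D j (snd P) (snd Q)}"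
    (is "_ = module.span _ ?S")
proof -
  interpret fs: vector_space "fun_scale :: 'k \<Rightarrow> (('m \<Rightarrow> 'm \<Rightarrow> 'k) \<Rightarrow> 'k) \<Rightarrow> _"
    by (rule vector_space_fun_scale)
  obtain x y x' y' where e: "P = (x, y)" "Q = (x', y')" by (metis surj_pair)
  have ob: "x \<in> Obj D" "y \<in> Obj D" "x' \<in> Obj D" "y' \<in> Obj D" using assms e by auto
  have "homt P Q f g \<in> fs.span ?S" if f: "f \<in> Hom D x x'" and g: "g \<in> Hom D y y'" for f g
  proof -
    obtain v where v: "\<And>i. v i \<in> Grd D i x x'" "f = (\<Sum>i\<in>UNIV. v i)" using decompE f ob by metis
    obtain w where w: "\<And>i. w i \<in> Grd D i y y'" "g = (\<Sum>i\<in>UNIV. w i)" using decompE g ob by metis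
    have "homt P Q f g = (\<Sum>i\<in>UNIV. \<Sum>j\<in>UNIV. homt P Q (v i) (w j))"
      using g[unfolded w(2)] unfolding e v(2) w(2)
      by (simp add: homt_sum_left[simplified] homt_sum_right[simplified] ob v(1) w(1) grd_hom[OF ob(1,3) v(1)])
    also have "\<dots> \<in> fs.span ?S"
      using v(1) w(1) unfolding e by (intro fs.span_sum fs.span_base) force
    finally show ?thesis .
  qed
  then have "homts P Q \<subseteq> fs.span ?S"
    unfolding tensor_space_def by (intro fs.span_minimal fs.subspace_span) (auto simp: e)
  moreover have "fs.span ?S \<subseteq> homts P Q"
    using grd_hom ob by (intro fs.span_minimal homts_subspace) (auto simp: e intro!: ptensor_in_tensor_space)
  ultimately show ?thesis by auto
qed

text \<open>Evaluating a tensor on a form which is not bilinear gives \<open>0\<close>, so additivity of the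
  composition in its second argument rests on the bilinearity shown here.\<close>

lemma twisted_comp_form:
  assumes P: "P \<in> Obj D \<times> Obj D" and Q: "Q \<in> Obj D \<times> Obj D" and R: "R \<in> Obj D \<times> Obj D"
    and b: "bilinear_form (Scl D) (Scl D) (Hom D (fst P) (fst R)) (Hom D (snd P) (snd R)) b"
    and T: "T \<in> homts P Q"
  shows "bilinear_form (Scl D) (Scl D) (Hom D (fst Q) (fst R)) (Hom D (snd Q) (snd R))
    (\<lambda>f' g'. T (\<lambda>f g. \<Sum>i\<in>UNIV. \<Sum>j\<in>UNIV. \<kappa> j i *
      b (Comp D (fst P) (fst Q) (fst R) f' (component (\<lambda>i. Grd D i (fst P) (fst Q)) i f))
        (Comp D (snd P) (snd Q) (snd R) (component (\<lambda>i. Grd D i (snd Q) (snd R)) j g') g)))"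
    (is "bilinear_form _ _ ?V ?W (\<lambda>f' g'. T (?in f' g'))")
proof -
  interpret fs: vector_space "fun_scale :: 'k \<Rightarrow> (('m \<Rightarrow> 'm \<Rightarrow> 'k) \<Rightarrow> 'k) \<Rightarrow> _"
    by (rule vector_space_fun_scale)
  obtain x y x' y' x'' y'' where e: "P = (x, y)" "Q = (x', y')" "R = (x'', y'')" by (metis surj_pair)
  have ob: "x \<in> Obj D" "y \<in> Obj D" "x' \<in> Obj D" "y' \<in> Obj D" "x'' \<in> Obj D" "y'' \<in> Obj D"
    using P Q R e by auto
  note sub = hom_subspace[THEN subspace_add] hom_subspace[THEN subspace_scale]
  have bl: "b (v + v') w = b v w + b v' w"
    if "v \<in> Hom D x x''" "v' \<in> Hom D x x''" "w \<in> Hom D y y''" for v v' w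
    using b that by (auto simp: bilinear_form_def e)
  have br: "b v (w + w') = b v w + b v w'"
    if "v \<in> Hom D x x''" "w \<in> Hom D y y''" "w' \<in> Hom D y y''" for v w w'
    using b that by (auto simp: bilinear_form_def e)
  have bs: "b (Scl D c v) w = c * b v w" "b v (Scl D c w) = c * b v w"
    if "v \<in> Hom D x x''" "w \<in> Hom D y y''" for c v w
    using b that by (auto simp: bilinear_form_def e)
  note rules = ob component_hom component_add component_scale comp_add_left comp_add_right
    comp_scale_left comp_scale_right bl br bs comp_hom distrib_left sum.distrib sum_distrib_left
    mult.left_commute sub
  have in_bil: "bilinear_form (Scl D) (Scl D) (Hom D x x') (Hom D y y') (?in f' g')"
    if "f' \<in> Hom D x' x''" "g' \<in> Hom D y' y''" for f' g'
    using that by (simp add: bilinear_form_def e rules)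
  let ?good = "\<lambda>T. bilinear_form (Scl D) (Scl D) ?V ?W (\<lambda>f' g'. T (?in f' g'))"
  show "?good T"
    using T unfolding tensor_space_def
  proof (induction rule: fs.span_induct_alt)
    case base
    then show ?case by (simp add: bilinear_form_def)
  next
    case (step c F G)
    then obtain f g where F: "F = homt P Q f g" and fg: "f \<in> Hom D x x'" "g \<in> Hom D y y'"
      by (auto simp: e)
    have "bilinear_form (Scl D) (Scl D) ?V ?W (\<lambda>f' g'. ?in f' g' f g)"
      using fg by (simp add: bilinear_form_def e rules)
    moreover have "F (?in f' g') = ?in f' g' f g" if "f' \<in> Hom D x' x''" "g' \<in> Hom D y' y''" for f' g'
      using in_bil[OF that] by (simp add: F ptensor_def e)
    ultimately have "?good F"
      using ob by (simp add: bilinear_form_def e sub)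
    then show ?case
      using step.IH unfolding bilinear_form_def
      by (simp add: fun_scale_def distrib_left mult.left_commute)
  qed
qed

text \<open>Span induction over homogeneous generators which also remembers that the partial sums
  stay in the tensor space. The linear extensions below are additive only there, so the bare
  induction would be too weak.\<close>

lemma homts_induct [consumes 3, case_names zero step]:
  assumes PQ: "P \<in> Obj D \<times> Obj D" "Q \<in> Obj D \<times> Obj D" and F: "F \<in> homts P Q"
    and zero: "X 0"
    and step: "\<And>c f g i j G. f \<in> Grd D i (fst P) (fst Q) \<Longrightarrow> g \<in> Grd D j (snd P) (snd Q) \<Longrightarrow>
      G \<in> homts P Q \<Longrightarrow> X G \<Longrightarrow> X (fun_scale c (homt P Q f g) + G)"
  shows "X F"
proof -
  interpret fs: vector_space "fun_scale :: 'k \<Rightarrow> (('m \<Rightarrow> 'm \<Rightarrow> 'k) \<Rightarrow> 'k) \<Rightarrow> _"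
    by (rule vector_space_fun_scale)
  have "F \<in> homts P Q \<and> X F"
    using F unfolding homts_span_homogeneous[OF PQ]
  proof (induction rule: fs.span_induct_alt)
    case base
    then show ?case using zero fs.span_zero by blast
  next
    case (step c F G)
    then obtain f g i j where "F = homt P Q f g"
        "f \<in> Grd D i (fst P) (fst Q)" "g \<in> Grd D j (snd P) (snd Q)" by blast
    moreover have "G \<in> homts P Q" unfolding homts_span_homogeneous[OF PQ] using step.IH ..
    ultimately have "X (fun_scale c F + G)" using assms(5) step.IH by blast
    then show ?case
      using fs.span_add[OF fs.span_scale[OF fs.span_base[OF step.hyps]]] step.IH by blast
  qed
  then show ?thesis by blast
qed

text \<open>Bilinearity lets \<open>B\<close> extend to tensors by the universal property. All
  axioms but functoriality concern pure tensors, where the extension is \<open>B\<close> itself;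
  functoriality is reduced to homogeneous generators by linearity in both arguments, so
  \<open>B_comp\<close> may restrict \<open>f\<close> and \<open>g'\<close> to be
  homogeneous.\<close>

lemma ex_graded_monoidal_category:
  fixes B :: "'o \<times> 'o \<Rightarrow> 'o \<times> 'o \<Rightarrow> 'm \<Rightarrow> 'm \<Rightarrow> 'm"
  assumes I: "I \<in> Obj D"
    and tb: "\<And>x y. x \<in> Obj D \<Longrightarrow> y \<in> Obj D \<Longrightarrow> tb x y \<in> Obj D"
    and assoc: "\<And>x y z. x \<in> Obj D \<Longrightarrow> y \<in> Obj D \<Longrightarrow> z \<in> Obj D \<Longrightarrow> tb (tb x y) z = tb x (tb y z)"
    and unit: "\<And>x. x \<in> Obj D \<Longrightarrow> tb I x = x" "\<And>x. x \<in> Obj D \<Longrightarrow> tb x I = x"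
    and B_hom: "\<And>x y x' y' f g. \<lbrakk>x \<in> Obj D; y \<in> Obj D; x' \<in> Obj D; y' \<in> Obj D;
        f \<in> Hom D x x'; g \<in> Hom D y y'\<rbrakk> \<Longrightarrow> B (x, y) (x', y') f g \<in> Hom D (tb x y) (tb x' y')"
    and B_add_left: "\<And>x y x' y' f f' g. \<lbrakk>x \<in> Obj D; y \<in> Obj D; x' \<in> Obj D; y' \<in> Obj D;
        f \<in> Hom D x x'; f' \<in> Hom D x x'; g \<in> Hom D y y'\<rbrakk>
      \<Longrightarrow> B (x, y) (x', y') (f + f') g = B (x, y) (x', y') f g + B (x, y) (x', y') f' g"
    and B_add_right: "\<And>x y x' y' f g g'. \<lbrakk>x \<in> Obj D; y \<in> Obj D; x' \<in> Obj D; y' \<in> Obj D;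
        f \<in> Hom D x x'; g \<in> Hom D y y'; g' \<in> Hom D y y'\<rbrakk>
      \<Longrightarrow> B (x, y) (x', y') f (g + g') = B (x, y) (x', y') f g + B (x, y) (x', y') f g'"
    and B_scale_left: "\<And>x y x' y' c f g. \<lbrakk>x \<in> Obj D; y \<in> Obj D; x' \<in> Obj D; y' \<in> Obj D;
        f \<in> Hom D x x'; g \<in> Hom D y y'\<rbrakk>
      \<Longrightarrow> B (x, y) (x', y') (Scl D c f) g = Scl D c (B (x, y) (x', y') f g)"
    and B_scale_right: "\<And>x y x' y' c f g. \<lbrakk>x \<in> Obj D; y \<in> Obj D; x' \<in> Obj D; y' \<in> Obj D;
        f \<in> Hom D x x'; g \<in> Hom D y y'\<rbrakk>
      \<Longrightarrow> B (x, y) (x', y') f (Scl D c g) = Scl D c (B (x, y) (x', y') f g)"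
    and B_grade: "\<And>x y x' y' f g i j. \<lbrakk>x \<in> Obj D; y \<in> Obj D; x' \<in> Obj D; y' \<in> Obj D;
        f \<in> Grd D i x x'; g \<in> Grd D j y y'\<rbrakk>
      \<Longrightarrow> B (x, y) (x', y') f g \<in> Grd D (i + j) (tb x y) (tb x' y')"
    and B_id: "\<And>x y. \<lbrakk>x \<in> Obj D; y \<in> Obj D\<rbrakk> \<Longrightarrow> B (x, y) (x, y) (Idm D x) (Idm D y) = Idm D (tb x y)"
    and B_comp: "\<And>x y x' y' x'' y'' f g f' g' i j. \<lbrakk>x \<in> Obj D; y \<in> Obj D; x' \<in> Obj D; y' \<in> Obj D;
        x'' \<in> Obj D; y'' \<in> Obj D; f \<in> Grd D i x x'; g \<in> Hom D y y';
        f' \<in> Hom D x' x''; g' \<in> Grd D j y' y''\<rbrakk>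
      \<Longrightarrow> Comp D (tb x y) (tb x' y') (tb x'' y'') (B (x', y') (x'', y'') f' g') (B (x, y) (x', y') f g)
        = Scl D (\<kappa> j i) (B (x, y) (x'', y'') (Comp D x x' x'' f' f) (Comp D y y' y'' g' g))"
    and B_assoc: "\<And>x y z x' y' z' f g h. \<lbrakk>x \<in> Obj D; y \<in> Obj D; z \<in> Obj D;
        x' \<in> Obj D; y' \<in> Obj D; z' \<in> Obj D; f \<in> Hom D x x'; g \<in> Hom D y y'; h \<in> Hom D z z'\<rbrakk>
      \<Longrightarrow> B (tb x y, z) (tb x' y', z') (B (x, y) (x', y') f g) h
        = B (x, tb y z) (x', tb y' z') f (B (y, z) (y', z') g h)"
    and B_unit_left: "\<And>x y f. \<lbrakk>x \<in> Obj D; y \<in> Obj D; f \<in> Hom D x y\<rbrakk>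
      \<Longrightarrow> B (I, x) (I, y) (Idm D I) f = f"
    and B_unit_right: "\<And>x y f. \<lbrakk>x \<in> Obj D; y \<in> Obj D; f \<in> Hom D x y\<rbrakk>
      \<Longrightarrow> B (x, I) (y, I) f (Idm D I) = f"
  shows "\<exists>T. graded_monoidal_category \<kappa> D I tb T \<and>
    (\<forall>x \<in> Obj D. \<forall>y \<in> Obj D. \<forall>x' \<in> Obj D. \<forall>y' \<in> Obj D. \<forall>f \<in> Hom D x x'. \<forall>g \<in> Hom D y y'.
      T (x, y) (x', y') (homt (x, y) (x', y') f g) = B (x, y) (x', y') f g)"
proof -
  \<comment> \<open>Tensors are functions here; with these rules active the simplifier would
    evaluate sums of tensors pointwise instead of treating them as vectors.\<close>
  note plus_fun_apply [simp del] zero_fun_apply [simp del]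
  interpret fs: vector_space "fun_scale :: 'k \<Rightarrow> (('m \<Rightarrow> 'm \<Rightarrow> 'k) \<Rightarrow> 'k) \<Rightarrow> _"
    by (rule vector_space_fun_scale)
  let ?TP = "twisted_product \<kappa> D D"
  \<comment> \<open>The extension is only known to be linear on \<open>homts P Q\<close>, not on all
    functionals; this is why memberships in \<open>homts\<close> accompany every later step.\<close>
  define ext where "ext P Q L \<longleftrightarrow>
      (\<forall>F \<in> homts P Q. \<forall>G \<in> homts P Q. L (F + G) = L F + L G) \<and>
      (\<forall>c. \<forall>F \<in> homts P Q. L (fun_scale c F) = Scl D c (L F)) \<and>
      (\<forall>f \<in> Hom D (fst P) (fst Q). \<forall>g \<in> Hom D (snd P) (snd Q). L (homt P Q f g) = B P Q f g)" for P Q L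
  have "\<exists>L. ext P Q L" if "P \<in> Obj D \<times> Obj D" "Q \<in> Obj D \<times> Obj D" for P Q
  proof -
    obtain x y x' y' where "P = (x, y)" "Q = (x', y')" by (metis surj_pair)
    then show ?thesis
      using that unfolding ext_def
      by (intro tensor_universal vector_space_axioms)
         (auto simp: B_add_left B_add_right B_scale_left B_scale_right)
  qed
  then obtain T where ext: "P \<in> Obj D \<times> Obj D \<Longrightarrow> Q \<in> Obj D \<times> Obj D \<Longrightarrow> ext P Q (T P Q)" for P Q
    by metis
  note T = ext[unfolded ext_def, THEN conjunct1, rule_format]
    ext[unfolded ext_def, THEN conjunct2, THEN conjunct1, rule_format]
    ext[unfolded ext_def, THEN conjunct2, THEN conjunct2, rule_format]
  have TB: "T (x, y) (x', y') (ptensor (Scl D) (Scl D) (Hom D x x') (Hom D y y') f g) = B (x, y) (x', y') f g"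
    if "x \<in> Obj D" "y \<in> Obj D" "x' \<in> Obj D" "y' \<in> Obj D" "f \<in> Hom D x x'" "g \<in> Hom D y y'"
    for x y x' y' f g
    using T(3)[of "(x, y)" "(x', y')" f g] that by simp
  have T0: "T P Q 0 = 0" if "P \<in> Obj D \<times> Obj D" "Q \<in> Obj D \<times> Obj D" for P Q
    using T(2)[OF that, of 0 0] fs.subspace_0[OF homts_subspace] by (simp add: fun_scale_def zero_fun_def)
  \<comment> \<open>Serves both for Hom spaces and for graded pieces: each is a subspace, so it
    suffices to locate the images of generators.\<close>
  have T_span: "T P Q F \<in> U" if PQ: "P \<in> Obj D \<times> Obj D" "Q \<in> Obj D \<times> Obj D"
    and F: "F \<in> fs.span S" and S: "S \<subseteq> homts P Q" and U: "subspace U" and gen: "\<And>F. F \<in> S \<Longrightarrow> T P Q F \<in> U"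
    for P Q F S U
  proof -
    have "F \<in> homts P Q \<and> T P Q F \<in> U"
      using F
    proof (induction rule: fs.span_induct_alt)
      case base
      show ?case by (metis T0[OF PQ] subspace_0[OF U] fs.subspace_0[OF homts_subspace])
    next
      case (step c F G)
      then have "fun_scale c F \<in> homts P Q" "F \<in> homts P Q"
        using S fs.subspace_scale[OF homts_subspace] by auto
      then show ?case using step gen PQ U T(1,2) fs.subspace_add[OF homts_subspace]
        by (simp add: subspace_add subspace_scale)
    qed
    then show ?thesis by blast
  qed
  have is_fun: "graded_functor ?TP D (\<lambda>(x, y). tb x y) T"
    unfolding graded_functor_def is_functor_def
  proof (intro conjI ballI allI)
    fix P assume P: "P \<in> Obj ?TP"
    then obtain x y where e: "P = (x, y)" and ob: "x \<in> Obj D" "y \<in> Obj D"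
      by (auto simp: twisted_product_def)
    then show "(case P of (x, y) \<Rightarrow> tb x y) \<in> Obj D" by (simp add: tb)
    show "T P P (Idm ?TP P) = Idm D (case P of (x, y) \<Rightarrow> tb x y)"
      using ob by (simp add: e twisted_product_def TB id_hom B_id)
    fix Q assume Q: "Q \<in> Obj ?TP"
    then obtain x' y' where e': "Q = (x', y')" and ob': "x' \<in> Obj D" "y' \<in> Obj D"
      by (auto simp: twisted_product_def)
    have PQ: "P \<in> Obj D \<times> Obj D" "Q \<in> Obj D \<times> Obj D" using ob ob' e e' by auto
    show "T P Q F \<in> Hom D (case P of (x, y) \<Rightarrow> tb x y) (case Q of (x, y) \<Rightarrow> tb x y)"
      if "F \<in> Hom ?TP P Q" for F
    proof (rule T_span[OF PQ])
      show "F \<in> fs.span {homt P Q f g | f g. f \<in> Hom D (fst P) (fst Q) \<and> g \<in> Hom D (snd P) (snd Q)}"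
        using that by (simp add: twisted_product_def tensor_space_def)
      show "subspace (Hom D (case P of (x, y) \<Rightarrow> tb x y) (case Q of (x, y) \<Rightarrow> tb x y))"
        using ob ob' e e' tb by (simp add: hom_subspace)
    qed (use PQ TB B_hom ob ob' in \<open>auto simp: e e' intro!: ptensor_in_tensor_space\<close>)
    show "T P Q F \<in> Grd D k (case P of (x, y) \<Rightarrow> tb x y) (case Q of (x, y) \<Rightarrow> tb x y)"
      if "F \<in> Grd ?TP k P Q" for F k
    proof (rule T_span[OF PQ])
      show "F \<in> fs.span {homt P Q f g | f g i j.
          f \<in> Grd D i (fst P) (fst Q) \<and> g \<in> Grd D j (snd P) (snd Q) \<and> i + j = k}"
        using that by (simp add: twisted_product_def)
      show "subspace (Grd D k (case P of (x, y) \<Rightarrow> tb x y) (case Q of (x, y) \<Rightarrow> tb x y))"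
        using ob ob' e e' tb by (simp add: grd_subspace)
    qed (use PQ TB B_grade ob ob' grd_hom in \<open>auto simp: e e' intro!: ptensor_in_tensor_space\<close>)
    show "T P Q (F + G) = T P Q F + T P Q G" if "F \<in> Hom ?TP P Q" "G \<in> Hom ?TP P Q" for F G
      using that T(1) PQ by (simp add: twisted_product_def)
    show "T P Q (Scl ?TP c F) = Scl D c (T P Q F)" if "F \<in> Hom ?TP P Q" for F c
      using that T(2) PQ by (simp add: twisted_product_def)
    fix R assume R: "R \<in> Obj ?TP"
    then obtain x'' y'' where e'': "R = (x'', y'')" and ob'': "x'' \<in> Obj D" "y'' \<in> Obj D"
      by (auto simp: twisted_product_def)
    have R': "R \<in> Obj D \<times> Obj D" using ob'' e'' by auto
    let ?c = "Comp ?TP P Q R"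
    let ?d = "Comp D (tb x y) (tb x' y') (tb x'' y'')"
    note tob = tb[OF ob] tb[OF ob'] tb[OF ob'']
    have T_hom: "T P Q F \<in> Hom D (tb x y) (tb x' y')" if "F \<in> homts P Q" for F
    proof (rule T_span[OF PQ])
      show "F \<in> fs.span {homt P Q f g | f g. f \<in> Hom D (fst P) (fst Q) \<and> g \<in> Hom D (snd P) (snd Q)}"
        using that by (simp add: tensor_space_def)
    qed (use PQ TB B_hom ob ob' hom_subspace tb in \<open>auto simp: e e' intro!: ptensor_in_tensor_space\<close>)
    have T_hom': "T Q R F \<in> Hom D (tb x' y') (tb x'' y'')" if "F \<in> homts Q R" for F
    proof (rule T_span[OF PQ(2) R'])
      show "F \<in> fs.span {homt Q R f g | f g. f \<in> Hom D (fst Q) (fst R) \<and> g \<in> Hom D (snd Q) (snd R)}"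
        using that by (simp add: tensor_space_def)
    qed (use R' PQ TB B_hom ob'' ob' hom_subspace tb in \<open>auto simp: e' e'' intro!: ptensor_in_tensor_space\<close>)
    \<comment> \<open>Membership is proved together with the equation, because the induction steps
      need it before they can use linearity of \<open>T P R\<close>.\<close>
    have gen: "?c (homt Q R f' g') (homt P Q f g) \<in> homts P R \<and>
        T P R (?c (homt Q R f' g') (homt P Q f g)) = ?d (T Q R (homt Q R f' g')) (T P Q (homt P Q f g))"
      if "f \<in> Grd D i x x'" "g \<in> Grd D j y y'" "f' \<in> Grd D k x' x''" "g' \<in> Grd D l y' y''"
      for f g f' g' i j k l
    proof -
      have h: "f \<in> Hom D x x'" "g \<in> Hom D y y'" "f' \<in> Hom D x' x''" "g' \<in> Hom D y' y''"
        using that ob ob' ob'' grd_hom by blast+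
      have eq: "?c (homt Q R f' g') (homt P Q f g) =
          fun_scale (\<kappa> l i) (homt P R (Comp D x x' x'' f' f) (Comp D y y' y'' g' g))"
        using twisted_product_comp[OF graded_category_axioms graded_category_axioms PQ R', of f i f' g g' l \<kappa>]
          that h by (simp add: e e' e'')
      have in_R: "homt P R (Comp D x x' x'' f' f) (Comp D y y' y'' g' g) \<in> homts P R"
        using h ob ob' ob'' by (intro ptensor_in_tensor_space) (auto simp: e e'' intro: comp_hom)
      have "T P R (?c (homt Q R f' g') (homt P Q f g)) =
          Scl D (\<kappa> l i) (B P R (Comp D x x' x'' f' f) (Comp D y y' y'' g' g))"
        using T(2)[OF PQ(1) R' in_R] h ob ob' ob''
        unfolding eq by (simp add: e e'' comp_hom TB)
      also have "\<dots> = ?d (B Q R f' g') (B P Q f g)"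
        using B_comp[OF ob ob' ob'' that(1) h(2,3) that(4)] by (simp add: e e' e'')
      also have "\<dots> = ?d (T Q R (homt Q R f' g')) (T P Q (homt P Q f g))"
        using h ob ob' ob'' by (simp add: e e' e'' TB)
      finally show ?thesis using in_R fs.subspace_scale[OF homts_subspace] by (simp add: eq)
    qed
    show "T P R (?c G F) = Comp D (case P of (x, y) \<Rightarrow> tb x y) (case Q of (x, y) \<Rightarrow> tb x y)
        (case R of (x, y) \<Rightarrow> tb x y) (T Q R G) (T P Q F)"
      if FG: "F \<in> Hom ?TP P Q" "G \<in> Hom ?TP Q R" for F G
    proof -
      have F: "F \<in> homts P Q" and G: "G \<in> homts Q R" using FG by (simp_all add: twisted_product_def)
      note sc = fs.subspace_scale[OF homts_subspace] and ad = fs.subspace_add[OF homts_subspace]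
      have z0: "?d 0 f = 0" if "f \<in> Hom D (tb x y) (tb x' y')" for f
        using comp_scale_left[OF tob that, of 0 0] subspace_0[OF hom_subspace] tob by simp
      have z0': "?d g 0 = 0" if "g \<in> Hom D (tb x' y') (tb x'' y'')" for g
        using comp_scale_right[OF tob _ that, of 0 0] subspace_0[OF hom_subspace] tob by simp
      have G0: "0 \<in> homts Q R" "0 \<in> homts P Q" "0 \<in> homts P R" by (simp_all add: fs.subspace_0 homts_subspace)
      \<comment> \<open>Linearity is spent one argument at a time: first the right tensor becomes
        arbitrary against a pure left one, then the left tensor is extended too.\<close>
      have right: "?c (homt Q R f' g') F \<in> homts P R \<and>
        T P R (?c (homt Q R f' g') F) = ?d (T Q R (homt Q R f' g')) (T P Q F)"
        if fg: "f' \<in> Grd D k x' x''" "g' \<in> Grd D l y' y''" for f' g' k l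
      proof -
        have h: "f' \<in> Hom D x' x''" "g' \<in> Hom D y' y''" using fg ob' ob'' grd_hom by blast+
        have S: "homt Q R f' g' \<in> homts Q R" using h by (intro ptensor_in_tensor_space) (auto simp: e' e'')
        note SH = T_hom'[OF S]
        \<comment> \<open>For a pure left tensor, composing amounts to evaluating \<open>F\<close>
          at a form that does not depend on \<open>F\<close>; this is what makes the composite
          linear in \<open>F\<close>. The outer evaluation is legitimate by
          \<open>twisted_comp_form\<close>.\<close>
        have val: "\<exists>u. \<forall>F \<in> homts P Q. ?c (homt Q R f' g') F b = F u"
          if b: "bilinear_form (Scl D) (Scl D) (Hom D (fst P) (fst R)) (Hom D (snd P) (snd R)) b" for b
        proof (intro exI ballI)
          fix F assume "F \<in> homts P Q"
          then show "?c (homt Q R f' g') F b = F (\<lambda>f g. \<Sum>i\<in>UNIV. \<Sum>j\<in>UNIV. \<kappa> j i *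
              b (Comp D (fst P) (fst Q) (fst R) f' (component (\<lambda>i. Grd D i (fst P) (fst Q)) i f))
                (Comp D (snd P) (snd Q) (snd R) (component (\<lambda>i. Grd D i (snd Q) (snd R)) j g') g))"
            by (simp only: twisted_product_def cat.simps ptensor_def b twisted_comp_form[OF PQ R' b] if_True)
        qed
        have val0: "?c (homt Q R f' g') F b = 0"
          if "\<not> bilinear_form (Scl D) (Scl D) (Hom D (fst P) (fst R)) (Hom D (snd P) (snd R)) b" for F b
          using that by (simp only: twisted_product_def cat.simps if_False)
        have c_eq: "?c (homt Q R f' g') (fun_scale a F + G) =
            fun_scale a (?c (homt Q R f' g') F) + ?c (homt Q R f' g') G"
          if FG: "F \<in> homts P Q" "G \<in> homts P Q" for a F G
        proof
          fix b
          have FG': "fun_scale a F + G \<in> homts P Q"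
            using FG fs.subspace_add[OF homts_subspace fs.subspace_scale[OF homts_subspace]] by blast
          show "?c (homt Q R f' g') (fun_scale a F + G) b =
            (fun_scale a (?c (homt Q R f' g') F) + ?c (homt Q R f' g') G) b"
          proof (cases "bilinear_form (Scl D) (Scl D) (Hom D (fst P) (fst R)) (Hom D (snd P) (snd R)) b")
            case True
            then obtain u where "\<forall>F \<in> homts P Q. ?c (homt Q R f' g') F b = F u" using val by blast
            then show ?thesis using FG FG' by (simp only: plus_fun_apply fun_scale_def)
          next
            case False
            then show ?thesis by (simp only: plus_fun_apply fun_scale_def[of _ "Comp _ _ _ _ _ _"] val0[OF False] mult_zero_right add_0)
          qed
        qed
        show ?thesis
          using PQ F
        proof (induction rule: homts_induct)
          case zero
          \<comment> \<open>With scalar \<open>-1\<close> and both tensors \<open>0\<close>,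
            linearity says that the composite with \<open>0\<close> equals minus itself plus
            itself.\<close>
          have "?c (homt Q R f' g') 0 = 0"
            using c_eq[OF G0(2,2), of "-1"] by simp
          moreover have "T P R 0 = 0" "T P Q 0 = 0" by (rule T0 PQ R')+
          ultimately show ?case
            using G0 z0' SH by simp
        next
          case (step a f g i j G)
          let ?F = "homt P Q f g"
          have fg': "f \<in> Grd D i x x'" "g \<in> Grd D j y y'" using step.hyps by (auto simp: e e')
          then have Fin: "?F \<in> homts P Q"
            using ob ob' grd_hom by (auto simp: e e' intro!: ptensor_in_tensor_space)
          note Gin = step.hyps(3)
          note g = gen[OF fg' fg]
          note th = T_hom[OF Fin] T_hom[OF Gin]
          have "T P R (?c (homt Q R f' g') (fun_scale a ?F + G)) =
              Scl D a (T P R (?c (homt Q R f' g') ?F)) + T P R (?c (homt Q R f' g') G)"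
            using g step.IH by (simp only: c_eq[OF Fin Gin] T(1,2)[OF PQ(1) R'] sc)
          also have "\<dots> = ?d (T Q R (homt Q R f' g')) (Scl D a (T P Q ?F) + T P Q G)"
            using g step.IH th SH tob subspace_scale[OF hom_subspace]
            by (simp add: comp_add_right comp_scale_right)
          also have "\<dots> = ?d (T Q R (homt Q R f' g')) (T P Q (fun_scale a ?F + G))"
            by (simp only: T(1,2)[OF PQ] sc Fin Gin)
          finally show ?case
            using g step.IH ad[OF sc] by (simp only: c_eq[OF Fin Gin] simp_thms)
        qed
      qed
      \<comment> \<open>In the left argument linearity is immediate: \<open>G\<close> is applied to
        a form determined by \<open>F\<close> and \<open>b\<close> alone, bilinear or not.\<close>
      have c_add: "?c (fun_scale a G + G') F = fun_scale a (?c G F) + ?c G' F" for a G G'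
        by (auto simp: fun_eq_iff plus_fun_apply zero_fun_apply twisted_product_def fun_scale_def)
      have c_zero: "?c 0 F = 0" by (auto simp: fun_eq_iff plus_fun_apply zero_fun_apply twisted_product_def)
      have "?c G F \<in> homts P R \<and> T P R (?c G F) = ?d (T Q R G) (T P Q F)"
        using PQ(2) R' G
      proof (induction rule: homts_induct)
        case zero
        moreover have "T P R 0 = 0" "T Q R 0 = 0" by (rule T0 PQ R')+
        ultimately show ?case
          using G0 z0 T_hom[OF F] c_zero by simp
      next
        case (step a f g i j G')
        let ?G = "homt Q R f g"
        have fg': "f \<in> Grd D i x' x''" "g \<in> Grd D j y' y''" using step.hyps by (auto simp: e'' e')
        then have Gin: "?G \<in> homts Q R"
          using ob'' ob' grd_hom by (auto simp: e'' e' intro!: ptensor_in_tensor_space)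
        note Gin' = step.hyps(3)
        note g = right[OF fg']
        note th = T_hom'[OF Gin] T_hom'[OF Gin']
        have "T P R (?c (fun_scale a ?G + G') F) = Scl D a (T P R (?c ?G F)) + T P R (?c G' F)"
          using g step.IH by (simp only: c_add T(1,2)[OF PQ(1) R'] sc)
        also have "\<dots> = ?d (Scl D a (T Q R ?G) + T Q R G') (T P Q F)"
          using g step.IH th T_hom[OF F] tob subspace_scale[OF hom_subspace]
          by (simp add: comp_add_left comp_scale_left)
        also have "\<dots> = ?d (T Q R (fun_scale a ?G + G')) (T P Q F)"
          by (simp only: T(1,2)[OF PQ(2) R'] sc Gin Gin')
        finally show ?case
          using g step.IH ad[OF sc] by (simp only: c_add simp_thms)
      qed
      then show ?thesis by (simp add: e e' e'')
    qed
  qed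
  have "graded_monoidal_category \<kappa> D I tb T"
    by unfold_locales
      (auto simp: TB I tb assoc unit is_fun B_hom B_assoc B_unit_left B_unit_right id_hom
)
  then show ?thesis using TB by (intro exI[of _ T]) simp
qed

end

section \<open>Arrows with explicit source and target\<close>

context linear_category
begin

lemma zero_hom: "x \<in> ob C \<Longrightarrow> y \<in> ob C \<Longrightarrow> 0 \<in> hom C x y"
  using subspace_0[OF hom_subspace] .

lemma sum_hom: "x \<in> ob C \<Longrightarrow> y \<in> ob C \<Longrightarrow> (\<And>i. i \<in> S \<Longrightarrow> f i \<in> hom C x y) \<Longrightarrow> sum f S \<in> hom C x y"
  using subspace_sum[OF hom_subspace] .

lemma cmp_sum_left:
  assumes "x \<in> ob C" "y \<in> ob C" "z \<in> ob C" "f \<in> hom C x y" "\<And>i. i \<in> S \<Longrightarrow> g i \<in> hom C y z"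
  shows "sum g S \<cdot> f = (\<Sum>i\<in>S. g i \<cdot> f)"
  using assms(5)
proof (induction S rule: infinite_finite_induct)
  case (insert i S)
  then show ?case using cmp_add_left[of x y z f "g i" "sum g S"] assms by (simp add: sum_hom)
qed (use cmp_scale_left[of x y z f 0 0] assms zero_hom in simp_all)

lemma cmp_sum_right:
  assumes "x \<in> ob C" "y \<in> ob C" "z \<in> ob C" "\<And>i. i \<in> S \<Longrightarrow> f i \<in> hom C x y" "g \<in> hom C y z"
  shows "g \<cdot> sum f S = (\<Sum>i\<in>S. g \<cdot> f i)"
  using assms(4)
proof (induction S rule: infinite_finite_induct)
  case (insert i S)
  then show ?case using cmp_add_right[of x y z "f i" "sum f S" g] assms by (simp add: sum_hom)
qed (use cmp_scale_right[of x y z 0 g 0] assms zero_hom in simp_all)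

end

text \<open>Recording source and target turns the side conditions of the category axioms into
  equations between objects, which the simplifier decides. It normalises composites to right-nested
  composites of whiskered arrows \<open>id\<^sub>x \<otimes> f \<otimes> id\<^sub>y\<close>.\<close>

datatype ('o, 'm) arrow = Arrow (src: 'o) (trg: 'o) (mph: 'm)

section \<open>Calculus of whiskered arrows\<close>

context linear_monoidal_category
begin

definition arr :: "('a, 'b) arrow \<Rightarrow> bool"
  where "arr f \<longleftrightarrow> src f \<in> ob C \<and> trg f \<in> ob C \<and> mph f \<in> hom C (src f) (trg f)"

definition ide :: "'a \<Rightarrow> ('a, 'b) arrow"
  where "ide x = Arrow x x (\<i>\<d> x)"

definition acmp :: "('a, 'b) arrow \<Rightarrow> ('a, 'b) arrow \<Rightarrow> ('a, 'b) arrow" (infixr \<open>\<bullet>\<close> 60)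
  where "g \<bullet> f = Arrow (src f) (trg g) (mph g \<cdot> mph f)"

definition atmr :: "('a, 'b) arrow \<Rightarrow> ('a, 'b) arrow \<Rightarrow> ('a, 'b) arrow" (infixr \<open>\<boxtimes>\<close> 70)
  where "f \<boxtimes> g = Arrow (src f \<odot> src g) (trg f \<odot> trg g) (mph f \<otimes> mph g)"

definition ascl :: "'c \<Rightarrow> ('a, 'b) arrow \<Rightarrow> ('a, 'b) arrow"
  where "ascl c f = Arrow (src f) (trg f) (scl C c (mph f))"

definition whisk :: "'a \<Rightarrow> ('a, 'b) arrow \<Rightarrow> 'a \<Rightarrow> ('a, 'b) arrow"
  where "whisk x f y = Arrow (x \<odot> src f \<odot> y) (x \<odot> trg f \<odot> y) (\<i>\<d> x \<otimes> mph f \<otimes> \<i>\<d> y)"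

lemma src_simps [simp]: "src (ide x) = x" "src (g \<bullet> f) = src f" "src (f \<boxtimes> g) = src f \<odot> src g"
    "src (ascl c f) = src f" "src (whisk x f y) = x \<odot> src f \<odot> y"
  and trg_simps [simp]: "trg (ide x) = x" "trg (g \<bullet> f) = trg g" "trg (f \<boxtimes> g) = trg f \<odot> trg g"
    "trg (ascl c f) = trg f" "trg (whisk x f y) = x \<odot> trg f \<odot> y"
  by (simp_all add: ide_def acmp_def atmr_def ascl_def whisk_def)

lemma mph_simps: "mph (ide x) = \<i>\<d> x" "mph (g \<bullet> f) = mph g \<cdot> mph f" "mph (f \<boxtimes> g) = mph f \<otimes> mph g"
    "mph (ascl c f) = scl C c (mph f)" "mph (whisk x f y) = \<i>\<d> x \<otimes> mph f \<otimes> \<i>\<d> y"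
  by (simp_all add: ide_def acmp_def atmr_def ascl_def whisk_def)

lemma arr_Arrow [simp]: "arr (Arrow x y f) \<longleftrightarrow> x \<in> ob C \<and> y \<in> ob C \<and> f \<in> hom C x y"
  by (simp add: arr_def)

declare unt_ob [simp] tob_ob [simp] tob_assoc [simp] tob_unit_left [simp] tob_unit_right [simp]

lemma arr_src: "arr f \<Longrightarrow> src f \<in> ob C" and arr_trg: "arr f \<Longrightarrow> trg f \<in> ob C"
  and arr_mph: "arr f \<Longrightarrow> mph f \<in> hom C (src f) (trg f)"
  by (simp_all add: arr_def)

lemma arr_ide [simp]: "x \<in> ob C \<Longrightarrow> arr (ide x)"
  by (simp add: arr_def ide_def id_hom)

lemma arr_acmp [simp]: "arr g \<Longrightarrow> arr f \<Longrightarrow> trg f = src g \<Longrightarrow> arr (g \<bullet> f)"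
  using cmp_hom[of "src f" "trg f" "trg g"] by (simp add: arr_def acmp_def)

lemma arr_atmr [simp]: "arr f \<Longrightarrow> arr g \<Longrightarrow> arr (f \<boxtimes> g)"
  by (simp add: arr_def atmr_def tmr_hom)

lemma arr_ascl [simp]: "arr f \<Longrightarrow> arr (ascl c f)"
  using subspace_scale[OF hom_subspace] by (simp add: arr_def ascl_def)

lemma whisk_atmr: "x \<in> ob C \<Longrightarrow> y \<in> ob C \<Longrightarrow> arr f \<Longrightarrow> whisk x f y = ide x \<boxtimes> f \<boxtimes> ide y"
  by (simp add: whisk_def atmr_def ide_def arr_def)

lemma arr_whisk [simp]: "x \<in> ob C \<Longrightarrow> y \<in> ob C \<Longrightarrow> arr f \<Longrightarrow> arr (whisk x f y)"
  by (simp add: whisk_atmr)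

lemma arrow_eqI: "src f = src g \<Longrightarrow> trg f = trg g \<Longrightarrow> mph f = mph g \<Longrightarrow> f = g"
  by (rule arrow.expand) simp

lemma acmp_assoc [simp]:
  "arr f \<Longrightarrow> arr g \<Longrightarrow> arr h \<Longrightarrow> trg f = src g \<Longrightarrow> trg g = src h \<Longrightarrow> (h \<bullet> g) \<bullet> f = h \<bullet> (g \<bullet> f)"
  using cmp_assoc[of "src f" "src g" "src h" "trg h" "mph f" "mph g" "mph h"]
  by (simp add: arr_def acmp_def)

lemma ide_acmp [simp]: "arr f \<Longrightarrow> trg f = x \<Longrightarrow> ide x \<bullet> f = f"
  using id_left[of "src f" "trg f" "mph f"] by (intro arrow_eqI) (auto simp: arr_def acmp_def ide_def)

lemma acmp_ide [simp]: "arr f \<Longrightarrow> src f = x \<Longrightarrow> f \<bullet> ide x = f"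
  using id_right[of "src f" "trg f" "mph f"] by (intro arrow_eqI) (auto simp: arr_def acmp_def ide_def)

lemma atmr_assoc: "arr f \<Longrightarrow> arr g \<Longrightarrow> arr h \<Longrightarrow> (f \<boxtimes> g) \<boxtimes> h = f \<boxtimes> (g \<boxtimes> h)"
  by (intro arrow_eqI) (simp_all add: mph_simps arr_mph arr_src arr_trg tmr_assoc[of "src f" "src g" "src h" "trg f" "trg g" "trg h"])

lemma ide_atmr_ide: "x \<in> ob C \<Longrightarrow> y \<in> ob C \<Longrightarrow> ide x \<boxtimes> ide y = ide (x \<odot> y)"
  by (simp add: ide_def atmr_def tmr_id)

lemma interchange:
  "arr f \<Longrightarrow> arr f' \<Longrightarrow> arr g \<Longrightarrow> arr g' \<Longrightarrow> trg f = src f' \<Longrightarrow> trg g = src g' \<Longrightarrow>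
    (f' \<boxtimes> g') \<bullet> (f \<boxtimes> g) = (f' \<bullet> f) \<boxtimes> (g' \<bullet> g)"
  using tmr_cmp[of "src f" "src f'" "trg f'" "src g" "src g'" "trg g'" "mph f" "mph f'" "mph g" "mph g'"]
  by (intro arrow_eqI) (simp_all add: mph_simps arr_def)

declare arr_src [simp] arr_trg [simp]

lemma unit_atmr: "arr f \<Longrightarrow> ide \<one> \<boxtimes> f = f" and atmr_unit: "arr f \<Longrightarrow> f \<boxtimes> ide \<one> = f"
  by (intro arrow_eqI; simp add: mph_simps tmr_unit_left[OF _ _ arr_mph] tmr_unit_right[OF _ _ arr_mph])+

lemma whisk_unit [simp]: "arr f \<Longrightarrow> whisk \<one> f \<one> = f"
  by (simp add: whisk_atmr unit_atmr atmr_unit)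

lemma whisk_ide [simp]: "x \<in> ob C \<Longrightarrow> y \<in> ob C \<Longrightarrow> z \<in> ob C \<Longrightarrow> whisk x (ide y) z = ide (x \<odot> y \<odot> z)"
  by (simp add: whisk_atmr ide_atmr_ide)

lemma whisk_whisk [simp]:
  assumes "x \<in> ob C" "y \<in> ob C" "x' \<in> ob C" "y' \<in> ob C" "arr f"
  shows "whisk x (whisk x' f y') y = whisk (x \<odot> x') f (y' \<odot> y)"
  using assms by (simp add: whisk_atmr atmr_assoc flip: ide_atmr_ide)

lemma whisk_acmp [simp]:
  assumes "x \<in> ob C" "y \<in> ob C" "arr f" "arr g" "trg f = src g"
  shows "whisk x (g \<bullet> f) y = whisk x g y \<bullet> whisk x f y"
  using assms by (simp add: whisk_atmr interchange)

text \<open>Interchange with identities inserted. As a simp rule it commits to applying the right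
  factor first; proofs that must match a tensor product as it stands delete it, and
  \<open>exchange\<close> reverses the order.\<close>

lemma atmr_whisk [simp]:
  assumes "arr f" "arr g"
  shows "f \<boxtimes> g = whisk \<one> f (trg g) \<bullet> whisk (src f) g \<one>"
  using assms by (simp add: whisk_atmr unit_atmr atmr_unit interchange)

text \<open>Arrows on disjoint tensor factors commute. Neither side is preferable in general, so
  this is not a simp rule but is instantiated where two arrows have to pass each other.\<close>

lemma whisk_exchange:
  assumes "arr f" "arr g" "x \<in> ob C" "y \<in> ob C" "z \<in> ob C"
  shows "whisk x f (y \<odot> trg g \<odot> z) \<bullet> whisk (x \<odot> src f \<odot> y) g z
    = whisk (x \<odot> trg f \<odot> y) g z \<bullet> whisk x f (y \<odot> src g \<odot> z)"
proof -
  have "(f \<boxtimes> ide y \<boxtimes> ide (trg g)) \<bullet> (ide (src f) \<boxtimes> ide y \<boxtimes> g) = (ide (trg f) \<boxtimes> ide y \<boxtimes> g) \<bullet> (f \<boxtimes> ide y \<boxtimes> ide (src g))"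
    using assms by (simp add: interchange del: atmr_whisk)
  then have "whisk x ((f \<boxtimes> ide y \<boxtimes> ide (trg g)) \<bullet> (ide (src f) \<boxtimes> ide y \<boxtimes> g)) z
      = whisk x ((ide (trg f) \<boxtimes> ide y \<boxtimes> g) \<bullet> (f \<boxtimes> ide y \<boxtimes> ide (src g))) z" by simp
  then show ?thesis using assms by simp
qed

lemma ascl_simps [simp]:
  "arr f \<Longrightarrow> arr g \<Longrightarrow> trg f = src g \<Longrightarrow> ascl c g \<bullet> f = ascl c (g \<bullet> f)"
  "arr f \<Longrightarrow> arr g \<Longrightarrow> trg f = src g \<Longrightarrow> g \<bullet> ascl c f = ascl c (g \<bullet> f)"
  "x \<in> ob C \<Longrightarrow> y \<in> ob C \<Longrightarrow> arr f \<Longrightarrow> whisk x (ascl c f) y = ascl c (whisk x f y)"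
proof -
  show "arr f \<Longrightarrow> arr g \<Longrightarrow> trg f = src g \<Longrightarrow> ascl c g \<bullet> f = ascl c (g \<bullet> f)"
    using cmp_scale_left[of "src f" "src g" "trg g" "mph f" "mph g" c] arr_mph[of f] arr_mph[of g]
    by (intro arrow_eqI) (simp_all add: mph_simps arr_mph)
  show "arr f \<Longrightarrow> arr g \<Longrightarrow> trg f = src g \<Longrightarrow> g \<bullet> ascl c f = ascl c (g \<bullet> f)"
    using cmp_scale_right[of "src f" "src g" "trg g" "mph f" "mph g" c] arr_mph[of f] arr_mph[of g]
    by (intro arrow_eqI) (simp_all add: mph_simps arr_mph)
  show "x \<in> ob C \<Longrightarrow> y \<in> ob C \<Longrightarrow> arr f \<Longrightarrow> whisk x (ascl c f) y = ascl c (whisk x f y)"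
    using tmr_scale_left[of "src f" y "trg f" y "mph f" "\<i>\<d> y" c]
      tmr_scale_right[of x "src f \<odot> y" x "trg f \<odot> y" "\<i>\<d> x" "mph f \<otimes> \<i>\<d> y" c]
    by (intro arrow_eqI) (simp_all add: mph_simps arr_mph id_hom tmr_hom)
qed

text \<open>Turns an equation between composites into a rewrite rule that also applies at the head of a
  longer right-nested composite.\<close>

lemma acmp_tail:
  assumes "g \<bullet> f = h" "arr f" "arr g" "trg f = src g" "arr k" "trg k = src f"
  shows "g \<bullet> (f \<bullet> k) = h \<bullet> k"
  using assms acmp_assoc[of k f g] by simp

lemma tmr_sum_left:
  assumes "x \<in> ob C" "y \<in> ob C" "x' \<in> ob C" "y' \<in> ob C" "\<And>i. i \<in> S \<Longrightarrow> f i \<in> hom C x x'" "g \<in> hom C y y'"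
  shows "sum f S \<otimes> g = (\<Sum>i\<in>S. f i \<otimes> g)"
  using assms(5)
proof (induction S rule: infinite_finite_induct)
  case (insert i S)
  then show ?case using tmr_add_left[of x y x' y' "f i" "sum f S" g] assms by (simp add: sum_hom)
qed (use tmr_scale_left[of x y x' y' 0 g 0] assms zero_hom in simp_all)

lemma tmr_sum_right:
  assumes "x \<in> ob C" "y \<in> ob C" "x' \<in> ob C" "y' \<in> ob C" "f \<in> hom C x x'" "\<And>i. i \<in> S \<Longrightarrow> g i \<in> hom C y y'"
  shows "f \<otimes> sum g S = (\<Sum>i\<in>S. f \<otimes> g i)"
  using assms(6)
proof (induction S rule: infinite_finite_induct)
  case (insert i S)
  then show ?case using tmr_add_right[of x y x' y' f "g i" "sum g S"] assms by (simp add: sum_hom)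
qed (use tmr_scale_right[of x y x' y' f 0 0] assms zero_hom in simp_all)

lemma exchange:
  "arr f \<Longrightarrow> arr g \<Longrightarrow> whisk \<one> f (trg g) \<bullet> whisk (src f) g \<one> = whisk (trg f) g \<one> \<bullet> whisk \<one> f (src g)"
  using whisk_exchange[of f g \<one> \<one> \<one>] by simp

lemma arrow_eq_iff: "src f = src g \<Longrightarrow> trg f = trg g \<Longrightarrow> f = g \<longleftrightarrow> mph f = mph g"
  using arrow_eqI by metis

text \<open>The ends are taken from the first summand, so the rules below are stated for parallel
  arrows.\<close>

definition aadd :: "('a, 'b) arrow \<Rightarrow> ('a, 'b) arrow \<Rightarrow> ('a, 'b) arrow"
  where "aadd f g = Arrow (src f) (trg f) (mph f + mph g)"

lemma aadd_simps [simp]: "src (aadd f g) = src f" "trg (aadd f g) = trg f"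
  by (simp_all add: aadd_def)

lemma mph_aadd: "mph (aadd f g) = mph f + mph g"
  by (simp add: aadd_def)

lemma arr_aadd [simp]: "arr f \<Longrightarrow> arr g \<Longrightarrow> src f = src g \<Longrightarrow> trg f = trg g \<Longrightarrow> arr (aadd f g)"
  using subspace_add[OF hom_subspace[of "src f" "trg f"], of "mph f" "mph g"] arr_mph[of f] arr_mph[of g]
  by (simp add: aadd_def)

lemma acmp_aadd [simp]:
  assumes "arr f" "arr g" "arr g'" "trg f = src g" "src g' = src g" "trg g = trg g'"
  shows "aadd g g' \<bullet> f = aadd (g \<bullet> f) (g' \<bullet> f)"
  using assms arr_mph[of f] arr_mph[of g] arr_mph[of g']
    cmp_add_left[of "src f" "src g" "trg g" "mph f" "mph g" "mph g'"]
  by (intro arrow_eqI) (simp_all add: mph_simps mph_aadd)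

lemma aadd_acmp [simp]:
  assumes "arr g" "arr f" "arr f'" "trg f = src g" "trg f' = src g" "src f = src f'"
  shows "g \<bullet> aadd f f' = aadd (g \<bullet> f) (g \<bullet> f')"
  using assms arr_mph[of g] arr_mph[of f] arr_mph[of f']
    cmp_add_right[of "src f" "src g" "trg g" "mph f" "mph f'" "mph g"]
  by (intro arrow_eqI) (simp_all add: mph_simps mph_aadd)

lemma whisk_aadd [simp]:
  assumes "arr f" "arr g" "src f = src g" "trg f = trg g" "x \<in> ob C" "y \<in> ob C"
  shows "whisk x (aadd f g) y = aadd (whisk x f y) (whisk x g y)"
  using assms arr_mph[of f] arr_mph[of g]
    tmr_add_left[of "src f" y "trg f" y "mph f" "mph g" "\<i>\<d> y"]
    tmr_add_right[of x "src f \<odot> y" x "trg f \<odot> y" "\<i>\<d> x" "mph f \<otimes> \<i>\<d> y" "mph g \<otimes> \<i>\<d> y"]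
  by (intro arrow_eqI) (simp_all add: mph_simps mph_aadd id_hom tmr_hom)

end

section \<open>Graded-commutative algebras\<close>

context linear_braided_category
begin

definition B :: "'a \<Rightarrow> 'a \<Rightarrow> ('a, 'b) arrow"
  where "B x y = Arrow (x \<odot> y) (y \<odot> x) (\<beta> x y)"

definition Binv :: "'a \<Rightarrow> 'a \<Rightarrow> ('a, 'b) arrow"
  where "Binv x y = (SOME b. arr b \<and> src b = y \<odot> x \<and> trg b = x \<odot> y \<and>
    b \<bullet> B x y = ide (x \<odot> y) \<and> B x y \<bullet> b = ide (y \<odot> x))"

lemma B_simps [simp]: "src (B x y) = x \<odot> y" "trg (B x y) = y \<odot> x"
    "x \<in> ob C \<Longrightarrow> y \<in> ob C \<Longrightarrow> arr (B x y)"
  by (simp_all add: B_def brd_hom)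

lemma Binv:
  assumes "x \<in> ob C" "y \<in> ob C"
  shows "arr (Binv x y) \<and> src (Binv x y) = y \<odot> x \<and> trg (Binv x y) = x \<odot> y \<and>
    Binv x y \<bullet> B x y = ide (x \<odot> y) \<and> B x y \<bullet> Binv x y = ide (y \<odot> x)"
proof -
  obtain b where "b \<in> hom C (y \<odot> x) (x \<odot> y)" "b \<cdot> \<beta> x y = \<i>\<d> (x \<odot> y)" "\<beta> x y \<cdot> b = \<i>\<d> (y \<odot> x)"
    using brd_iso assms by blast
  then have "\<exists>b. arr b \<and> src b = y \<odot> x \<and> trg b = x \<odot> y \<and>
    b \<bullet> B x y = ide (x \<odot> y) \<and> B x y \<bullet> b = ide (y \<odot> x)"
    using assms by (intro exI[of _ "Arrow (y \<odot> x) (x \<odot> y) b"]) (simp add: B_def acmp_def ide_def)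
  then show ?thesis unfolding Binv_def by (rule someI_ex)
qed

lemma Binv_simps [simp]:
  assumes "x \<in> ob C" "y \<in> ob C"
  shows "arr (Binv x y)" "src (Binv x y) = y \<odot> x" "trg (Binv x y) = x \<odot> y"
    "Binv x y \<bullet> B x y = ide (x \<odot> y)" "B x y \<bullet> Binv x y = ide (y \<odot> x)"
  using Binv[OF assms] by auto

lemma B_natural:
  assumes "arr f" "arr g"
  shows "B (trg f) (trg g) \<bullet> (f \<boxtimes> g) = (g \<boxtimes> f) \<bullet> B (src f) (src g)"
  using assms brd_natural[of "src f" "src g" "trg f" "trg g" "mph f" "mph g"]
  by (intro arrow_eqI) (simp_all add: mph_simps arr_mph B_def del: atmr_whisk)

lemma B_natural_left:
  "arr f \<Longrightarrow> y \<in> ob C \<Longrightarrow> B (trg f) y \<bullet> whisk \<one> f y = whisk y f \<one> \<bullet> B (src f) y"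
  using B_natural[of f "ide y"] by simp

lemma B_natural_right:
  "arr f \<Longrightarrow> y \<in> ob C \<Longrightarrow> B y (trg f) \<bullet> whisk y f \<one> = whisk \<one> f y \<bullet> B y (src f)"
  using B_natural[of "ide y" f] by simp

lemma B_tensor_right:
  assumes "x \<in> ob C" "y \<in> ob C" "z \<in> ob C"
  shows "B x (y \<odot> z) = whisk y (B x z) \<one> \<bullet> whisk \<one> (B x y) z"
proof -
  have "B x (y \<odot> z) = (ide y \<boxtimes> B x z) \<bullet> (B x y \<boxtimes> ide z)"
    using hexagon_right[OF assms] assms
    by (intro arrow_eqI) (simp_all add: mph_simps B_def del: atmr_whisk)
  then show ?thesis using assms by simp
qed

lemma B_tensor_left:
  assumes "x \<in> ob C" "y \<in> ob C" "z \<in> ob C"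
  shows "B (x \<odot> y) z = whisk \<one> (B x z) y \<bullet> whisk x (B y z) \<one>"
proof -
  have "B (x \<odot> y) z = (B x z \<boxtimes> ide y) \<bullet> (ide x \<boxtimes> B y z)"
    using hexagon_left[OF assms] assms
    by (intro arrow_eqI) (simp_all add: mph_simps B_def del: atmr_whisk)
  then show ?thesis using assms by simp
qed

text \<open>The hexagon at \<open>\<one> \<odot> \<one> = \<one>\<close> makes this braiding
  idempotent, and an invertible idempotent is an identity.\<close>

lemma B_unit_right [simp]: "x \<in> ob C \<Longrightarrow> B x \<one> = ide x"
proof -
  assume x: "x \<in> ob C"
  have "B x \<one> \<bullet> B x \<one> = B x \<one>" using B_tensor_right[of x \<one> \<one>] x by simp
  then have "Binv x \<one> \<bullet> (B x \<one> \<bullet> B x \<one>) = Binv x \<one> \<bullet> B x \<one>" by simp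
  then show ?thesis using x acmp_assoc[of "B x \<one>" "B x \<one>" "Binv x \<one>"] by (simp del: acmp_assoc)
qed

lemma B_unit_left [simp]: "x \<in> ob C \<Longrightarrow> B \<one> x = ide x"
proof -
  assume x: "x \<in> ob C"
  have "B \<one> x \<bullet> B \<one> x = B \<one> x" using B_tensor_left[of \<one> \<one> x] x by simp
  then have "Binv \<one> x \<bullet> (B \<one> x \<bullet> B \<one> x) = Binv \<one> x \<bullet> B \<one> x" by simp
  then show ?thesis using x acmp_assoc[of "B \<one> x" "B \<one> x" "Binv \<one> x"] by (simp del: acmp_assoc)
qed

end

section \<open>Multiplication and grading in terms of degree projectors\<close>

locale graded_commutative_algebra = linear_braided_category C
  for C :: "('o, 'm::ab_group_add, 'k::field) bmcat" (structure)
    and A :: "('o, 'm, 'g::{finite, ab_group_add}) galg"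
    and \<kappa> :: "'g \<Rightarrow> 'g \<Rightarrow> 'k" +
  assumes bicharacter: "bicharacter \<kappa>"
    and graded_algebra: "graded_algebra C A"
    and graded_commutative: "graded_commutative C \<kappa> A"
begin

abbreviation "a \<equiv> tot A"

definition M where "M = Arrow (a \<odot> a) a (mul A)"
definition U where "U = Arrow \<one> a (eta A)"
definition E where "E i = Arrow (cpt A i) a (emb A i)"
definition R where "R i = Arrow a (cpt A i) (prj A i)"
text \<open>The idempotent on \<open>a\<close> projecting onto degree \<open>i\<close>. Degree
  conditions are phrased as being fixed by it, which avoids factorisations through the
  components.\<close>

definition P where "P i = E i \<bullet> R i"

lemma graded_object: "graded_object C A"
  using graded_algebra by (simp add: graded_algebra_def)

lemma ob_simps [simp]: "a \<in> ob C" "cpt A i \<in> ob C"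
  using graded_object by (simp_all add: graded_object_def)

lemma src_gen [simp]: "src M = a \<odot> a" "src U = \<one>" "src (E i) = cpt A i" "src (R i) = a" "src (P i) = a"
  and trg_gen [simp]: "trg M = a" "trg U = a" "trg (E i) = a" "trg (R i) = cpt A i" "trg (P i) = a"
  by (simp_all add: M_def U_def E_def R_def P_def)

lemma mph_gen: "mph M = mul A" "mph U = eta A" "mph (E i) = emb A i" "mph (R i) = prj A i"
    "mph (P i) = emb A i \<cdot> prj A i"
  by (simp_all add: M_def U_def E_def R_def P_def mph_simps)

lemma arr_gen [simp]: "arr M" "arr U" "arr (E i)" "arr (R i)"
  using graded_object graded_algebra
  by (simp_all add: M_def U_def E_def R_def graded_object_def graded_algebra_def)

lemma arr_P [simp]: "arr (P i)"
  by (simp add: P_def)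

lemma M_assoc: "M \<bullet> whisk \<one> M a = M \<bullet> whisk a M \<one>"
proof -
  have "M \<bullet> (M \<boxtimes> ide a) = M \<bullet> (ide a \<boxtimes> M)"
    using graded_algebra
    by (intro arrow_eqI) (simp_all add: mph_simps mph_gen graded_algebra_def del: atmr_whisk)
  then show ?thesis by simp
qed

lemma M_unit [simp]: "M \<bullet> whisk \<one> U a = ide a" "M \<bullet> whisk a U \<one> = ide a"
proof -
  have "M \<bullet> (U \<boxtimes> ide a) = ide a" "M \<bullet> (ide a \<boxtimes> U) = ide a"
    using graded_algebra
    by (auto intro!: arrow_eqI simp: mph_simps mph_gen graded_algebra_def simp del: atmr_whisk)
  then show "M \<bullet> whisk \<one> U a = ide a" "M \<bullet> whisk a U \<one> = ide a" by simp_all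
qed

lemma R_E [simp]: "R i \<bullet> E i = ide (cpt A i)"
  using graded_object by (intro arrow_eqI) (simp_all add: mph_simps mph_gen graded_object_def)

lemma P_P [simp]: "P i \<bullet> P i = P i"
  by (simp add: P_def acmp_tail[OF R_E])

definition Mc where "Mc i j = Arrow (cpt A i \<odot> cpt A j) (cpt A (i + j)) (mul_cpt C A i j)"

lemma Mc_simps [simp]: "src (Mc i j) = cpt A i \<odot> cpt A j" "trg (Mc i j) = cpt A (i + j)"
  by (simp_all add: Mc_def)

lemma Mc_alt: "Mc i j = R (i + j) \<bullet> M \<bullet> (E i \<boxtimes> E j)"
  by (intro arrow_eqI) (simp_all add: mph_simps mph_gen Mc_def mul_cpt_def del: atmr_whisk)

lemma arr_Mc [simp]: "arr (Mc i j)"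
  by (simp add: Mc_alt del: atmr_whisk)

lemma M_E_E: "M \<bullet> (E i \<boxtimes> E j) = E (i + j) \<bullet> Mc i j"
  using graded_algebra
  by (intro arrow_eqI) (simp_all add: mph_simps mph_gen Mc_def graded_algebra_def del: atmr_whisk)

lemma P_tensor_P: "P i \<boxtimes> P j = (E i \<boxtimes> E j) \<bullet> (R i \<boxtimes> R j)"
  by (simp add: P_def interchange del: atmr_whisk)

lemma M_P_P: "M \<bullet> (P i \<boxtimes> P j) = E (i + j) \<bullet> Mc i j \<bullet> (R i \<boxtimes> R j)"
  by (simp add: P_tensor_P acmp_tail[OF M_E_E] del: atmr_whisk)

text \<open>Compatibility of multiplication and grading, rephrased on \<open>a\<close> alone: by
  \<open>M_E_E\<close> the product already factors through \<open>E (i + j)\<close>, on which the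
  projector acts trivially.\<close>

lemma P_M: "P (i + j) \<bullet> M \<bullet> (P i \<boxtimes> P j) = M \<bullet> (P i \<boxtimes> P j)"
  unfolding M_P_P by (simp add: P_def acmp_tail[OF R_E] del: atmr_whisk)

text \<open>Graded commutativity is assumed on the components; naturality of the braiding carries it
  over to \<open>a\<close> by moving the inclusions across. The braided product lands in degree
  \<open>j + i\<close>, whence the commutations of the sum.\<close>

lemma M_B_P: "M \<bullet> B a a \<bullet> (P i \<boxtimes> P j) = ascl (\<kappa> i j) (M \<bullet> (P i \<boxtimes> P j))"
proof -
  have Mc_B: "Mc j i \<bullet> B (cpt A i) (cpt A j) = ascl (\<kappa> i j) (Mc i j)"
    using graded_commutative
    by (intro arrow_eqI)
       (simp_all add: mph_simps Mc_def B_def graded_commutative_def add.commute[of j i])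
  have B_E: "B a a \<bullet> (E i \<boxtimes> E j) = (E j \<boxtimes> E i) \<bullet> B (cpt A i) (cpt A j)"
    using B_natural[of "E i" "E j"] by (simp del: atmr_whisk)
  have "M \<bullet> B a a \<bullet> (P i \<boxtimes> P j) = M \<bullet> (E j \<boxtimes> E i) \<bullet> B (cpt A i) (cpt A j) \<bullet> (R i \<boxtimes> R j)"
    by (simp add: P_tensor_P acmp_tail[OF B_E] del: atmr_whisk)
  also have "\<dots> = ascl (\<kappa> i j) (E (i + j) \<bullet> Mc i j \<bullet> (R i \<boxtimes> R j))"
    by (simp add: acmp_tail[OF M_E_E] acmp_tail[OF Mc_B] add.commute[of j i] del: atmr_whisk)
  finally show ?thesis unfolding M_P_P .
qed

lemma P_ortho: "i \<noteq> j \<Longrightarrow> mph (P i) \<cdot> mph (P j) = 0"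
proof -
  assume ij: "i \<noteq> j"
  have "prj A i \<cdot> emb A j = 0" using graded_object ij by (simp add: graded_object_def)
  then have "prj A i \<cdot> (emb A j \<cdot> prj A j) = 0"
    using cmp_assoc[of a "cpt A j" a "cpt A i" "prj A j" "emb A j" "prj A i"]
      arr_mph[of "R i"] arr_mph[of "R j"] arr_mph[of "E j"]
      cmp_scale_left[of a "cpt A j" "cpt A i" "prj A j" 0 0] subspace_0[OF hom_subspace]
    by (simp add: mph_gen)
  then show ?thesis
    using cmp_assoc[of a a "cpt A i" a "mph (P j)" "prj A i" "emb A i"]
      arr_mph[of "R i"] arr_mph[of "E i"] arr_mph[of "P j"]
      cmp_scale_right[of a "cpt A i" a 0 "emb A i" 0] subspace_0[OF hom_subspace]
    by (simp add: mph_gen)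
qed

lemma sum_P: "(\<Sum>i\<in>UNIV. mph (P i)) = \<i>\<d> a"
  using graded_object by (simp add: graded_object_def mph_gen)

lemma sum_whisk_P:
  assumes "x \<in> ob C" "y \<in> ob C"
  shows "(\<Sum>i\<in>UNIV. mph (whisk x (P i) y)) = \<i>\<d> (x \<odot> a \<odot> y)"
proof -
  have "(\<Sum>i\<in>UNIV. mph (whisk x (P i) y)) = \<i>\<d> x \<otimes> (\<Sum>i\<in>UNIV. mph (P i)) \<otimes> \<i>\<d> y"
    using assms arr_mph[OF arr_P]
    by (simp add: mph_simps tmr_sum_left[of a y a y] tmr_sum_right[of x "a \<odot> y" x "a \<odot> y"] id_hom tmr_hom)
  then show ?thesis using assms by (simp add: sum_P tmr_id)
qed

text \<open>The resolution of the identity of \<open>a\<close> into projectors, inserted between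
  \<open>h\<close> and \<open>f\<close>. The sum is formed on underlying morphisms, which are the
  vectors; arrows are not.\<close>

lemma sum_components:
  assumes "arr f" "arr h" "src f = x \<odot> a \<odot> y" "trg h = x \<odot> a \<odot> y" "x \<in> ob C" "y \<in> ob C"
  shows "(\<Sum>i\<in>UNIV. mph (f \<bullet> whisk x (P i) y \<bullet> h)) = mph (f \<bullet> h)"
proof -
  have w: "mph (whisk x (P i) y) \<in> hom C (x \<odot> a \<odot> y) (x \<odot> a \<odot> y)" for i
    using arr_mph[of "whisk x (P i) y"] assms by simp
  have wh: "mph (whisk x (P i) y \<bullet> h) \<in> hom C (src h) (x \<odot> a \<odot> y)" for i
    using arr_mph[of "whisk x (P i) y \<bullet> h"] assms by simp
  have "(\<Sum>i\<in>UNIV. mph (f \<bullet> whisk x (P i) y \<bullet> h)) = mph f \<cdot> (\<Sum>i\<in>UNIV. mph (whisk x (P i) y \<bullet> h))"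
    using arr_mph[of f] assms wh
    by (subst cmp_sum_right[of "src h" "x \<odot> a \<odot> y" "trg f"]) (simp_all add: mph_simps(2))
  also have "(\<Sum>i\<in>UNIV. mph (whisk x (P i) y \<bullet> h)) = (\<Sum>i\<in>UNIV. mph (whisk x (P i) y)) \<cdot> mph h"
    using arr_mph[of h] assms w
    by (subst cmp_sum_left[of "src h" "x \<odot> a \<odot> y" "x \<odot> a \<odot> y"]) (simp_all add: mph_simps(2))
  also have "\<dots> = mph h"
    using assms arr_mph[of h] id_left[of "src h" "x \<odot> a \<odot> y"] by (simp add: sum_whisk_P)
  finally show ?thesis by (simp add: mph_simps)
qed

text \<open>The projectors are jointly epic, since they sum to the identity. This is how equations
  known one degree at a time are assembled.\<close>

lemma eq_by_components:
  assumes "arr f" "arr f'" "src f = x \<odot> a \<odot> y" "src f' = x \<odot> a \<odot> y" "trg f = trg f'" "x \<in> ob C" "y \<in> ob C"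
    and eq: "\<And>i. f \<bullet> whisk x (P i) y = f' \<bullet> whisk x (P i) y"
  shows "f = f'"
proof (rule arrow_eqI)
  have "mph f = (\<Sum>i\<in>UNIV. mph (f \<bullet> whisk x (P i) y \<bullet> ide (x \<odot> a \<odot> y)))"
    using assms by (subst sum_components) simp_all
  also have "\<dots> = (\<Sum>i\<in>UNIV. mph (f' \<bullet> whisk x (P i) y \<bullet> ide (x \<odot> a \<odot> y)))"
    using assms by simp
  also have "\<dots> = mph f'" using assms by (subst sum_components) simp_all
  finally show "mph f = mph f'" .
qed (use assms in simp_all)

text \<open>The degree \<open>0\<close> part of the unit is again a left unit for the multiplication, because
  multiplication by the other parts shifts the degree.\<close>

lemma P_U [simp]: "P 0 \<bullet> U = U"
proof -
  have P_M': "P (i + j) \<bullet> M \<bullet> whisk \<one> (P i) a \<bullet> whisk a (P j) \<one> = M \<bullet> whisk \<one> (P i) a \<bullet> whisk a (P j) \<one>" for i j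
    using P_M[of i j] by simp
  have U_P: "whisk \<one> U a \<bullet> P j = whisk a (P j) \<one> \<bullet> whisk \<one> U a" for j
    using exchange[of U "P j"] by simp
  have N: "M \<bullet> whisk \<one> (P 0) a \<bullet> whisk \<one> U a \<bullet> P j = P j" for j
  proof (rule arrow_eqI)
    let ?X = "\<lambda>i. M \<bullet> whisk \<one> (P i) a \<bullet> whisk \<one> U a \<bullet> P j"
    have X: "P (i + j) \<bullet> ?X i = ?X i" for i
      using arg_cong[OF P_M'[of i j], of "\<lambda>t. t \<bullet> whisk \<one> U a"] by (simp add: U_P)
    have "mph (P j) = mph (P j \<bullet> M \<bullet> whisk \<one> U a \<bullet> P j)"
      using acmp_tail[OF M_unit(1), of "P j"] by simp
    also have "\<dots> = (\<Sum>i\<in>UNIV. mph (P j \<bullet> ?X i))"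
      using sum_components[of "P j \<bullet> M" "whisk \<one> U a \<bullet> P j" \<one> a] by simp
    also have "\<dots> = (\<Sum>i::'g\<in>UNIV. if i = 0 then mph (?X 0) else 0)"
    proof (rule sum.cong[OF refl])
      fix i :: 'g
      show "mph (P j \<bullet> ?X i) = (if i = 0 then mph (?X 0) else 0)"
      proof (cases "i = 0")
        case True
        then show ?thesis using X[of 0] by simp
      next
        case False
        then have z: "mph (P j \<bullet> P (i + j)) = 0" using P_ortho[of j "i + j"] by (simp add: mph_simps)
        have "mph (P j \<bullet> ?X i) = mph ((P j \<bullet> P (i + j)) \<bullet> ?X i)" using X[of i] by simp
        also have "\<dots> = 0 \<cdot> mph (?X i)" by (simp only: mph_simps(2)[of "P j \<bullet> P (i + j)"] z)
        also have "\<dots> = 0"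
          using cmp_scale_left[of a a a "mph (?X i)" 0 0] zero_hom arr_mph[of "?X i"] by simp
        finally show ?thesis using False by simp
      qed
    qed
    finally show "mph (?X 0) = mph (P j)" by simp
  qed simp_all
  have "M \<bullet> whisk \<one> (P 0) a \<bullet> whisk \<one> U a = ide a"
    by (rule eq_by_components[of _ _ \<one> \<one>]) (simp_all add: N)
  \<comment> \<open>The usual argument that a left unit equals a right unit: the product of
    \<open>P 0 \<bullet> U\<close> and \<open>U\<close> is computed in two ways.\<close>
  then have "M \<bullet> whisk \<one> (P 0 \<bullet> U) a \<bullet> U = U"
    using acmp_tail[of "M \<bullet> whisk \<one> (P 0) a" "whisk \<one> U a" "ide a" U] by simp
  moreover have "whisk \<one> (P 0 \<bullet> U) a \<bullet> U = whisk a U \<one> \<bullet> (P 0 \<bullet> U)"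
    using exchange[of "P 0 \<bullet> U" U] by simp
  ultimately show ?thesis
    using acmp_tail[OF M_unit(2), of "P 0 \<bullet> U"] by simp
qed

lemma M_assoc_whisk:
  assumes "x \<in> ob C" "y \<in> ob C"
  shows "whisk x M y \<bullet> whisk x M (a \<odot> y) = whisk x M y \<bullet> whisk (x \<odot> a) M y"
  using arg_cong[OF M_assoc, of "\<lambda>t. whisk x t y"] assms by simp

lemmas M_assoc_whisk' = M_assoc_whisk[of _ \<one>, simplified]

lemma M_unit_whisk [simp]:
  assumes "x \<in> ob C" "y \<in> ob C"
  shows "whisk x M y \<bullet> whisk x U (a \<odot> y) = ide (x \<odot> a \<odot> y)"
    "whisk x M y \<bullet> whisk (x \<odot> a) U y = ide (x \<odot> a \<odot> y)"
  using arg_cong[OF M_unit(1), of "\<lambda>t. whisk x t y"] arg_cong[OF M_unit(2), of "\<lambda>t. whisk x t y"] assms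
  by (simp_all del: M_unit)

lemma M_unit_whisk' [simp]:
  assumes "x \<in> ob C"
  shows "whisk x M \<one> \<bullet> whisk x U a = ide (x \<odot> a)" "whisk x M \<one> \<bullet> whisk (x \<odot> a) U \<one> = ide (x \<odot> a)"
  using M_unit_whisk[of x \<one>] assms by simp_all

section \<open>Free extension along the unit of the algebra\<close>

definition ext :: "'o \<Rightarrow> ('o, 'm) arrow \<Rightarrow> ('o, 'm) arrow"
  where "ext y f = whisk y M \<one> \<bullet> whisk \<one> f a"

text \<open>Restriction to the generators \<open>x\<close> of the free module
  \<open>x \<odot> a\<close>. Together with \<open>ext\<close> it forms the bijection of the
  free-module adjunction.\<close>

definition res :: "'o \<Rightarrow> ('o, 'm) arrow \<Rightarrow> ('o, 'm) arrow"
  where "res x h = h \<bullet> whisk x U \<one>"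

definition modmap :: "'o \<Rightarrow> 'o \<Rightarrow> ('o, 'm) arrow \<Rightarrow> bool"
  where "modmap x y h \<longleftrightarrow> x \<in> ob C \<and> y \<in> ob C \<and> arr h \<and> src h = x \<odot> a \<and> trg h = y \<odot> a \<and>
    h \<bullet> whisk x M \<one> = whisk y M \<one> \<bullet> whisk \<one> h a"

lemma modmapD:
  assumes "modmap x y h"
  shows "arr h" "src h = x \<odot> a" "trg h = y \<odot> a" "x \<in> ob C" "y \<in> ob C"
    "h \<bullet> whisk x M \<one> = whisk y M \<one> \<bullet> whisk \<one> h a"
  using assms by (simp_all add: modmap_def)

lemma ext_simps [simp]:
  "arr f \<Longrightarrow> src (ext y f) = src f \<odot> a" "y \<in> ob C \<Longrightarrow> trg (ext y f) = y \<odot> a"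
  "arr f \<Longrightarrow> y \<in> ob C \<Longrightarrow> trg f = y \<odot> a \<Longrightarrow> arr (ext y f)"
  by (simp_all add: ext_def)

lemma res_simps [simp]: "x \<in> ob C \<Longrightarrow> src (res x h) = x" "trg (res x h) = trg h"
  "arr h \<Longrightarrow> src h = x \<odot> a \<Longrightarrow> x \<in> ob C \<Longrightarrow> arr (res x h)"
  by (simp_all add: res_def)

lemma ext_modmap:
  assumes "arr f" "src f = x" "trg f = y \<odot> a" "y \<in> ob C"
  shows "modmap x y (ext y f)"
proof -
  have x: "x \<in> ob C" using assms arr_src by blast
  have e: "whisk \<one> f a \<bullet> whisk x M \<one> = whisk (y \<odot> a) M \<one> \<bullet> whisk \<one> f (a \<odot> a)"
    using exchange[of f M] assms x by simp
  show ?thesis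
    using assms x by (simp add: modmap_def ext_def e acmp_tail[OF M_assoc_whisk'])
qed

lemma res_ext:
  assumes "arr f" "src f = x" "trg f = y \<odot> a" "y \<in> ob C"
  shows "res x (ext y f) = f"
proof -
  have x: "x \<in> ob C" using assms arr_src by blast
  have e: "whisk \<one> f a \<bullet> whisk x U \<one> = whisk (y \<odot> a) U \<one> \<bullet> f"
    using exchange[of f U] assms x by simp
  show ?thesis
    using assms x acmp_tail[OF M_unit_whisk(2)[of y \<one>], of f] by (simp add: res_def ext_def e)
qed

text \<open>Linearity of \<open>h\<close> trades the multiplication after it for one before it,
  where the left unit law removes it.\<close>

lemma ext_res:
  assumes "modmap x y h"
  shows "ext y (res x h) = h"
proof -
  note [simp] = modmapD(1-5)[OF assms]
  show ?thesis
    using acmp_tail[OF modmapD(6)[OF assms, symmetric], of "whisk x U a"]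
    by (simp add: ext_def res_def)
qed

text \<open>Equations between module maps are thereby checked on generators, where degrees are
  visible too.\<close>

lemma modmap_eqI:
  assumes "modmap x y h" "modmap x y h'" "res x h = res x h'"
  shows "h = h'"
  using assms ext_res by metis

lemma modmap_ide: "x \<in> ob C \<Longrightarrow> modmap x x (ide (x \<odot> a))"
  by (simp add: modmap_def)

lemma modmap_cmp:
  assumes "modmap x y f" "modmap y z g"
  shows "modmap x z (g \<bullet> f)"
proof -
  note [simp] = modmapD(1-5)[OF assms(1)] modmapD(1-5)[OF assms(2)]
  show ?thesis
    using modmapD(6)[OF assms(1)] acmp_tail[OF modmapD(6)[OF assms(2)], of "whisk \<one> f a"]
    by (simp add: modmap_def)
qed

lemma modmap_whisk:
  assumes "modmap x y f" "z \<in> ob C"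
  shows "modmap (z \<odot> x) (z \<odot> y) (whisk z f \<one>)"
proof -
  note [simp] = modmapD(1-5)[OF assms(1)] assms(2)
  show ?thesis
    using arg_cong[OF modmapD(6)[OF assms(1)], of "\<lambda>t. whisk z t \<one>"] by (simp add: modmap_def)
qed

lemma modmap_ascl:
  assumes "modmap x y f"
  shows "modmap x y (ascl c f)"
proof -
  note [simp] = modmapD[OF assms(1)]
  show ?thesis by (simp add: modmap_def)
qed

text \<open>For \<open>g\<close> itself an extension, the arrow \<open>g \<bullet> f\<close> is the
  Kleisli composite, so this is functoriality of the passage to module maps. It holds because the
  linear map \<open>g\<close> can be pulled out past the multiplication.\<close>

lemma ext_cmp_modmap:
  assumes "modmap y z g" "arr f" "trg f = y \<odot> a"
  shows "ext z (g \<bullet> f) = g \<bullet> ext y f"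
proof -
  note [simp] = modmapD(1-5)[OF assms(1)] assms(2,3)
  show ?thesis
    using acmp_tail[OF modmapD(6)[OF assms(1)], of "whisk \<one> f a"] by (simp add: ext_def)
qed

end

section \<open>The product of module maps\<close>

context graded_commutative_algebra
begin

section \<open>Conjugation of module maps by the braiding\<close>

lemma whisk_Binv_B [simp]:
  assumes "x \<in> ob C" "y \<in> ob C" "z \<in> ob C" "w \<in> ob C"
  shows "whisk x (Binv y z) w \<bullet> whisk x (B y z) w = ide (x \<odot> y \<odot> z \<odot> w)"
    "whisk x (B y z) w \<bullet> whisk x (Binv y z) w = ide (x \<odot> z \<odot> y \<odot> w)"
  using arg_cong[OF Binv_simps(4)[OF assms(2,3)], of "\<lambda>t. whisk x t w"]
    arg_cong[OF Binv_simps(5)[OF assms(2,3)], of "\<lambda>t. whisk x t w"] assms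
  by (simp_all del: Binv_simps(4,5))

lemma whisk_Binv_B' [simp]:
  assumes "x \<in> ob C" "y \<in> ob C" "z \<in> ob C"
  shows "whisk x (Binv y z) \<one> \<bullet> whisk x (B y z) \<one> = ide (x \<odot> y \<odot> z)"
    "whisk x (B y z) \<one> \<bullet> whisk x (Binv y z) \<one> = ide (x \<odot> z \<odot> y)"
  using whisk_Binv_B[OF assms unt_ob] assms by simp_all

text \<open>Removes inverse braidings from a goal: after precomposing with a braiding,
  \<open>slide_B\<close> applies on both sides.\<close>

lemma B_cancel:
  assumes "f \<bullet> whisk x (B y z) \<one> = f' \<bullet> whisk x (B y z) \<one>" "arr f" "arr f'"
    "src f = x \<odot> z \<odot> y" "src f' = x \<odot> z \<odot> y" "x \<in> ob C" "y \<in> ob C" "z \<in> ob C"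
  shows "f = f'"
  using arg_cong[OF assms(1), of "\<lambda>t. t \<bullet> whisk x (Binv y z) \<one>"] assms(2-) by simp

text \<open>Naturality of the braiding in \<open>M\<close>, with the braiding of
  \<open>a \<odot> a\<close> past \<open>y\<close> resolved by the hexagon.\<close>

lemma B_M_whisk:
  assumes "x \<in> ob C" "y \<in> ob C" "z \<in> ob C"
  shows "whisk x (B a y) z \<bullet> whisk x M (y \<odot> z) =
    whisk (x \<odot> y) M z \<bullet> whisk x (B a y) (a \<odot> z) \<bullet> whisk (x \<odot> a) (B a y) z"
  using arg_cong[OF B_natural_left[of M y], of "\<lambda>t. whisk x t z"] assms
  by (simp add: B_tensor_left)

lemma B_U_whisk:
  assumes "x \<in> ob C" "y \<in> ob C"
  shows "whisk x (B a y) \<one> \<bullet> whisk x U y = whisk (x \<odot> y) U \<one>"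
  using arg_cong[OF B_natural_left[of U y], of "\<lambda>t. whisk x t \<one>"] assms by simp

text \<open>Lets \<open>h\<close> act on the outer factors of \<open>x \<odot> y \<odot> a\<close>
  while \<open>y\<close> is parked behind \<open>a\<close>. Linearity cannot be read off from this
  form; it comes from \<open>slide_ext\<close>.\<close>

definition slide :: "'o \<Rightarrow> 'o \<Rightarrow> ('o, 'm) arrow \<Rightarrow> 'o \<Rightarrow> ('o, 'm) arrow"
  where "slide x x' h y = whisk x' (B a y) \<one> \<bullet> whisk \<one> h y \<bullet> whisk x (Binv a y) \<one>"

lemma slide_simps [simp]:
  assumes "arr h" "src h = x \<odot> a" "trg h = x' \<odot> a" "x \<in> ob C" "x' \<in> ob C" "y \<in> ob C"
  shows "arr (slide x x' h y)" "src (slide x x' h y) = x \<odot> y \<odot> a" "trg (slide x x' h y) = x' \<odot> y \<odot> a"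
  using assms by (simp_all add: slide_def)

lemma slide_B:
  assumes "arr h" "src h = x \<odot> a" "trg h = x' \<odot> a" "x \<in> ob C" "x' \<in> ob C" "y \<in> ob C"
  shows "slide x x' h y \<bullet> whisk x (B a y) \<one> = whisk x' (B a y) \<one> \<bullet> whisk \<one> h y"
  using assms by (simp add: slide_def)

text \<open>The multiplication inside the extension of \<open>f\<close> passes the braiding by
  \<open>B_M_whisk\<close>; the braiding of \<open>y\<close> with the second factor \<open>a\<close>
  that this produces is the one cancelled by \<open>B_cancel\<close>.\<close>

lemma slide_ext:
  assumes "arr f" "src f = x" "trg f = x' \<odot> a" "x' \<in> ob C" "y \<in> ob C"
  shows "slide x x' (ext x' f) y = ext (x' \<odot> y) (whisk x' (B a y) \<one> \<bullet> whisk \<one> f y)"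
proof (rule B_cancel)
  have [simp]: "x \<in> ob C" using assms arr_src by blast
  have "whisk \<one> f (y \<odot> a) \<bullet> whisk x (B a y) \<one> = whisk (x' \<odot> a) (B a y) \<one> \<bullet> whisk \<one> f (a \<odot> y)"
    using exchange[of f "B a y"] assms by simp
  then show "slide x x' (ext x' f) y \<bullet> whisk x (B a y) \<one>
      = ext (x' \<odot> y) (whisk x' (B a y) \<one> \<bullet> whisk \<one> f y) \<bullet> whisk x (B a y) \<one>"
    using assms acmp_tail[OF B_M_whisk[of x' y \<one>], of "whisk \<one> f (a \<odot> y)"]
    by (simp add: slide_B ext_def)
qed (use assms arr_src in auto)

text \<open>A module map is the extension of its restriction, and \<open>slide_ext\<close> presents
  the conjugate of an extension as an extension again.\<close>

lemma modmap_slide: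
  assumes "modmap x x' h" "y \<in> ob C"
  shows "modmap (x \<odot> y) (x' \<odot> y) (slide x x' h y)"
proof -
  note [simp] = modmapD(1-5)[OF assms(1)] assms(2)
  show ?thesis
    using slide_ext[of "res x h" x x' y] ext_modmap[of "whisk x' (B a y) \<one> \<bullet> whisk \<one> (res x h) y" "x \<odot> y" "x' \<odot> y"]
    by (simp add: ext_res[OF assms(1)])
qed

lemma res_slide:
  assumes "modmap x x' h" "y \<in> ob C"
  shows "res (x \<odot> y) (slide x x' h y) = whisk x' (B a y) \<one> \<bullet> whisk \<one> (res x h) y"
proof -
  note [simp] = modmapD(1-5)[OF assms(1)] assms(2)
  show ?thesis
    using slide_ext[of "res x h" x x' y] res_ext[of "whisk x' (B a y) \<one> \<bullet> whisk \<one> (res x h) y" "x \<odot> y" "x' \<odot> y"]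
    by (simp add: ext_res[OF assms(1)])
qed

lemma slide_cmp:
  assumes "modmap x x' h" "modmap x' x'' h'" "y \<in> ob C"
  shows "slide x' x'' h' y \<bullet> slide x x' h y = slide x x'' (h' \<bullet> h) y"
proof -
  note [simp] = modmapD(1-5)[OF assms(1)] modmapD(1-5)[OF assms(2)] assms(3)
  show ?thesis by (simp add: slide_def acmp_tail[OF whisk_Binv_B'(1)])
qed

lemma slide_ide: "x \<in> ob C \<Longrightarrow> y \<in> ob C \<Longrightarrow> slide x x (ide (x \<odot> a)) y = ide (x \<odot> y \<odot> a)"
  by (simp add: slide_def)

text \<open>Moving \<open>a\<close> past \<open>y\<close> and then past \<open>z\<close> is moving
  it past \<open>y \<odot> z\<close>, by the hexagon, so nested conjugations merge into one.\<close>

lemma slide_slide: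
  assumes "modmap x x' h" "y \<in> ob C" "z \<in> ob C"
  shows "slide (x \<odot> y) (x' \<odot> y) (slide x x' h y) z = slide x x' h (y \<odot> z)"
proof (rule B_cancel)
  note [simp] = modmapD(1-5)[OF assms(1)] assms(2,3)
  have B_yz: "whisk w (B a (y \<odot> z)) \<one> = whisk (w \<odot> y) (B a z) \<one> \<bullet> whisk w (B a y) z" if "w \<in> ob C" for w
    using that by (simp add: B_tensor_right)
  have "slide (x \<odot> y) (x' \<odot> y) (slide x x' h y) z \<bullet> whisk (x \<odot> y) (B a z) \<one>
      = whisk (x' \<odot> y) (B a z) \<one> \<bullet> whisk \<one> (slide x x' h y) z"
    using slide_B[of "slide x x' h y" "x \<odot> y" "x' \<odot> y" z] by simp
  moreover have "whisk \<one> (slide x x' h y) z \<bullet> whisk x (B a y) z = whisk x' (B a y) z \<bullet> whisk \<one> h (y \<odot> z)"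
    using arg_cong[OF slide_B[of h x x' y], of "\<lambda>t. whisk \<one> t z"] by simp
  ultimately show "slide (x \<odot> y) (x' \<odot> y) (slide x x' h y) z \<bullet> whisk x (B a (y \<odot> z)) \<one>
      = slide x x' h (y \<odot> z) \<bullet> whisk x (B a (y \<odot> z)) \<one>"
    using acmp_tail[of "slide (x \<odot> y) (x' \<odot> y) (slide x x' h y) z" "whisk (x \<odot> y) (B a z) \<one>" _ "whisk x (B a y) z"]
      slide_B[of h x x' "y \<odot> z"]
    by (simp add: slide_B B_yz)
qed (use modmapD[OF assms(1)] assms in auto)

lemma slide_whisk:
  assumes "modmap x x' h" "y \<in> ob C" "z \<in> ob C"
  shows "slide (z \<odot> x) (z \<odot> x') (whisk z h \<one>) y = whisk z (slide x x' h y) \<one>"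
proof -
  note [simp] = modmapD(1-5)[OF assms(1)] assms(2,3)
  show ?thesis by (simp add: slide_def)
qed

lemma Binv_unit [simp]: "x \<in> ob C \<Longrightarrow> Binv x \<one> = ide x"
  using Binv_simps(4)[of x \<one>] by simp

lemma slide_unit: "modmap x x' h \<Longrightarrow> slide x x' h \<one> = h"
  using modmapD(1-5)[of x x' h] by (simp add: slide_def)

definition tens :: "'o \<Rightarrow> 'o \<Rightarrow> 'o \<Rightarrow> 'o \<Rightarrow> ('o, 'm) arrow \<Rightarrow> ('o, 'm) arrow \<Rightarrow> ('o, 'm) arrow"
  where "tens x x' y y' f g = slide x x' f y' \<bullet> whisk x g \<one>"

lemma modmap_tens:
  "modmap x x' f \<Longrightarrow> modmap y y' g \<Longrightarrow> modmap (x \<odot> y) (x' \<odot> y') (tens x x' y y' f g)"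
  unfolding tens_def by (rule modmap_cmp[OF modmap_whisk modmap_slide]) (auto dest: modmapD)

lemma tens_ide: "x \<in> ob C \<Longrightarrow> y \<in> ob C \<Longrightarrow> tens x x y y (ide (x \<odot> a)) (ide (y \<odot> a)) = ide (x \<odot> y \<odot> a)"
  by (simp add: tens_def slide_ide)

text \<open>Both sides let \<open>h\<close>, then \<open>g\<close>, then \<open>f\<close> act, each
  across the objects to its right: functoriality splits the conjugate of a composite, and nested
  conjugates merge.\<close>

lemma tens_assoc:
  assumes "modmap x x' f" "modmap y y' g" "modmap z z' h"
  shows "tens (x \<odot> y) (x' \<odot> y') z z' (tens x x' y y' f g) h = tens x x' (y \<odot> z) (y' \<odot> z') f (tens y y' z z' g h)"
proof -
  note [simp] = modmapD(1-5)[OF assms(1)] modmapD(1-5)[OF assms(2)] modmapD(1-5)[OF assms(3)]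
  have "slide (x \<odot> y) (x' \<odot> y') (slide x x' f y' \<bullet> whisk x g \<one>) z'
      = slide (x \<odot> y') (x' \<odot> y') (slide x x' f y') z' \<bullet> slide (x \<odot> y) (x \<odot> y') (whisk x g \<one>) z'"
    using slide_cmp[OF modmap_whisk[OF assms(2), of x] modmap_slide[OF assms(1), of y'], of z'] by simp
  then show ?thesis
    using assms by (simp add: tens_def slide_slide slide_whisk)
qed

lemma tens_unit:
  assumes "modmap x x' f"
  shows "tens \<one> \<one> x x' (ide a) f = f" "tens x x' \<one> \<one> f (ide a) = f"
  using assms modmapD(1-5)[OF assms] slide_ide[of \<one> x'] by (simp_all add: tens_def slide_unit)

text \<open>The arrow being extended on the left is the Kleisli product of \<open>f\<close> and
  \<open>g\<close>, so \<open>tens\<close> is the transported product. On the right the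
  multiplication belonging to \<open>g\<close> is pushed past \<open>f\<close> and the braiding by
  \<open>e1\<close> and \<open>e2\<close>; associativity then matches the two
  multiplications.\<close>

lemma tens_ext:
  assumes "arr f" "src f = x" "trg f = x' \<odot> a" "x' \<in> ob C" "arr g" "src g = y" "trg g = y' \<odot> a" "y' \<in> ob C"
  shows "ext (x' \<odot> y') (whisk (x' \<odot> y') M \<one> \<bullet> whisk x' (B a y') a \<bullet> (f \<boxtimes> g))
    = tens x x' y y' (ext x' f) (ext y' g)"
proof -
  have [simp]: "x \<in> ob C" "y \<in> ob C" using assms arr_src by blast+
  note [simp] = assms
  have e1: "whisk \<one> f (y' \<odot> a) \<bullet> whisk (x \<odot> y') M \<one> = whisk (x' \<odot> a \<odot> y') M \<one> \<bullet> whisk \<one> f (y' \<odot> a \<odot> a)"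
    using whisk_exchange[of f M \<one> y' \<one>] by simp
  have e2: "whisk x' (B a y') a \<bullet> whisk (x' \<odot> a \<odot> y') M \<one> = whisk (x' \<odot> y' \<odot> a) M \<one> \<bullet> whisk x' (B a y') (a \<odot> a)"
    using whisk_exchange[of "B a y'" M x' \<one> \<one>] by simp
  show ?thesis
    by (simp add: tens_def slide_ext) (simp add: ext_def acmp_tail[OF e1] acmp_tail[OF e2] acmp_tail[OF M_assoc_whisk'])
qed

text \<open>The degree is tested on the restriction, since the grading of Hom spaces comes from
  arrows \<open>x\<close> to \<open>y \<odot> cpt A i\<close>. Agreement with that description is
  \<open>Grd_IM\<close>.\<close>

definition homog :: "'g \<Rightarrow> 'o \<Rightarrow> 'o \<Rightarrow> ('o, 'm) arrow \<Rightarrow> bool"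
  where "homog i x y h \<longleftrightarrow> modmap x y h \<and> whisk y (P i) \<one> \<bullet> res x h = res x h"

text \<open>The restriction of the identity is the unit of the algebra, so this rests on
  \<open>P_U\<close>.\<close>

lemma homog_ide: "x \<in> ob C \<Longrightarrow> homog 0 x x (ide (x \<odot> a))"
  using arg_cong[OF P_U, of "\<lambda>t. whisk x t \<one>"]
  by (simp add: homog_def modmap_ide res_def del: P_U)

lemma homog_cmp:
  assumes "homog i x y f" "homog j y z g"
  shows "homog (i + j) x z (g \<bullet> f)"
proof -
  have m: "modmap x y f" "modmap y z g" using assms by (auto simp: homog_def)
  note [simp] = modmapD(1-5)[OF m(1)] modmapD(1-5)[OF m(2)]
  define f0 where "f0 = res x f"
  define g0 where "g0 = res y g"
  have [simp]: "arr f0" "src f0 = x" "trg f0 = y \<odot> a" "arr g0" "src g0 = y" "trg g0 = z \<odot> a"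
    by (simp_all add: f0_def g0_def)
  have f0: "whisk y (P i) \<one> \<bullet> f0 = f0" and g0: "whisk z (P j) \<one> \<bullet> g0 = g0"
    using assms by (auto simp: homog_def f0_def g0_def)
  have res: "res x (g \<bullet> f) = whisk z M \<one> \<bullet> whisk \<one> g0 a \<bullet> f0"
    using acmp_tail[of "whisk z M \<one>" "whisk \<one> g0 a" g f0] ext_res[OF m(2)]
    by (simp add: ext_def flip: g0_def) (simp add: res_def f0_def)
  \<comment> \<open>Both degree conditions are transferred to the two factors \<open>a\<close> about
    to be multiplied: the first comes from \<open>g0\<close>, the second from \<open>f0\<close>.
    Then \<open>P_M\<close> adds the degrees.\<close>
  have "whisk \<one> g0 a \<bullet> f0 = whisk z (P j) a \<bullet> whisk \<one> g0 a \<bullet> whisk y (P i) \<one> \<bullet> f0"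
    using acmp_tail[OF arg_cong[OF g0, of "\<lambda>t. whisk \<one> t a", simplified], of f0] by (simp add: f0)
  also have "\<dots> = whisk z (P j \<boxtimes> P i) \<one> \<bullet> whisk \<one> g0 a \<bullet> f0"
    using acmp_tail[OF exchange[of g0 "P i"], of f0] by simp
  finally have e: "whisk \<one> g0 a \<bullet> f0 = whisk z (P j \<boxtimes> P i) \<one> \<bullet> whisk \<one> g0 a \<bullet> f0" .
  have pm: "whisk z (P (i + j)) \<one> \<bullet> whisk z M \<one> \<bullet> whisk z (P j \<boxtimes> P i) \<one> = whisk z M \<one> \<bullet> whisk z (P j \<boxtimes> P i) \<one>"
    using arg_cong[OF P_M[of j i], of "\<lambda>t. whisk z t \<one>"] by (simp add: add.commute[of i j])
  have "whisk z (P (i + j)) \<one> \<bullet> whisk z M \<one> \<bullet> whisk z (P j \<boxtimes> P i) \<one> \<bullet> (whisk \<one> g0 a \<bullet> f0)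
      = whisk z M \<one> \<bullet> whisk z (P j \<boxtimes> P i) \<one> \<bullet> (whisk \<one> g0 a \<bullet> f0)"
    using arg_cong[OF pm, of "\<lambda>t. t \<bullet> (whisk \<one> g0 a \<bullet> f0)"] by simp
  then have "whisk z (P (i + j)) \<one> \<bullet> whisk z M \<one> \<bullet> (whisk \<one> g0 a \<bullet> f0) = whisk z M \<one> \<bullet> (whisk \<one> g0 a \<bullet> f0)"
    unfolding e[symmetric] .
  then show ?thesis
    using modmap_cmp[OF m] by (simp add: homog_def res)
qed

lemma homog_whisk:
  assumes "homog i x y f" "z \<in> ob C"
  shows "homog i (z \<odot> x) (z \<odot> y) (whisk z f \<one>)"
proof -
  have m: "modmap x y f" using assms by (auto simp: homog_def)
  note [simp] = modmapD(1-5)[OF m] assms(2)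
  have "whisk y (P i) \<one> \<bullet> f \<bullet> whisk x U \<one> = f \<bullet> whisk x U \<one>"
    using assms by (simp add: homog_def res_def)
  from arg_cong[OF this, of "\<lambda>t. whisk z t \<one>"] show ?thesis
    using modmap_whisk[OF m] by (simp add: homog_def res_def)
qed

lemma homog_slide:
  assumes "homog i x x' f" "y \<in> ob C"
  shows "homog i (x \<odot> y) (x' \<odot> y) (slide x x' f y)"
proof -
  have m: "modmap x x' f" using assms by (auto simp: homog_def)
  note [simp] = modmapD(1-5)[OF m] assms(2)
  have "whisk x' (P i) \<one> \<bullet> res x f = res x f" using assms by (simp add: homog_def)
  from arg_cong[OF this, of "\<lambda>t. whisk \<one> t y"]
  have f: "whisk x' (P i) y \<bullet> whisk \<one> (res x f) y = whisk \<one> (res x f) y" by simp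
  have e: "whisk (x' \<odot> y) (P i) \<one> \<bullet> whisk x' (B a y) \<one> = whisk x' (B a y) \<one> \<bullet> whisk x' (P i) y"
    using arg_cong[OF B_natural_left[of "P i" y], of "\<lambda>t. whisk x' t \<one>"] by simp
  show ?thesis
    using modmap_slide[OF m] by (simp add: homog_def res_slide[OF m] acmp_tail[OF e] f)
qed

lemma homog_tens:
  "homog i x x' f \<Longrightarrow> homog j y y' g \<Longrightarrow> homog (i + j) (x \<odot> y) (x' \<odot> y') (tens x x' y y' f g)"
  \<comment> \<open>In \<open>tens\<close> the map \<open>g\<close> acts first, so
    \<open>homog_cmp\<close> yields the degree as \<open>j + i\<close>.\<close>
  unfolding tens_def add.commute[of i j]
  by (rule homog_cmp[OF homog_whisk homog_slide]) (auto simp: homog_def dest: modmapD)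

text \<open>Moving \<open>A\<^sub>i\<close> past a map \<open>g\<close> of degree \<open>j\<close> exchanges two factors of \<open>A\<close>, which costs
  \<open>\<kappa> i j\<close> by graded commutativity.\<close>

lemma exchange_homogeneous:
  assumes "arr g" "src g = y" "trg g = y' \<odot> a" "y' \<in> ob C" "whisk y' (P j) \<one> \<bullet> g = g"
  shows "ext y' g \<bullet> B a y \<bullet> whisk \<one> (P i) y =
    ascl (\<kappa> i j) (whisk y' M \<one> \<bullet> whisk \<one> (B a y') a \<bullet> whisk a g \<one> \<bullet> whisk \<one> (P i) y)"
proof -
  note [simp] = assms(1-4)
  have [simp]: "y \<in> ob C" using assms arr_src by blast
  have g: "whisk (a \<odot> y') (P j) \<one> \<bullet> whisk a g \<one> = whisk a g \<one>"
    using arg_cong[OF assms(5), of "\<lambda>t. whisk a t \<one>"] by simp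
  have e1: "whisk \<one> g a \<bullet> B a y = whisk y' (B a a) \<one> \<bullet> whisk \<one> (B a y') a \<bullet> whisk a g \<one>"
    using B_natural_right[of g a] by (simp add: B_tensor_right)
  define X where "X = whisk \<one> (B a y') a \<bullet> whisk a g \<one> \<bullet> whisk \<one> (P i) y"
  have [simp]: "arr X" "src X = a \<odot> y" "trg X = y' \<odot> a \<odot> a" by (simp_all add: X_def)
  have e2: "whisk a g \<one> \<bullet> whisk \<one> (P i) y = whisk \<one> (P i) (y' \<odot> a) \<bullet> whisk a g \<one>"
    using exchange[of "P i" g] by simp
  have e3: "whisk \<one> (B a y') a \<bullet> whisk \<one> (P i) (y' \<odot> a) = whisk y' (P i) a \<bullet> whisk \<one> (B a y') a"
    using arg_cong[OF B_natural_left[of "P i" y'], of "\<lambda>t. whisk \<one> t a"] by simp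
  have e4: "whisk \<one> (B a y') a \<bullet> whisk (a \<odot> y') (P j) \<one> = whisk (y' \<odot> a) (P j) \<one> \<bullet> whisk \<one> (B a y') a"
    using exchange[of "B a y'" "P j"] by simp
  \<comment> \<open>\<open>X\<close> is homogeneous in each of its two factors \<open>a\<close>, so
    both projectors can be reinserted directly before \<open>M \<bullet> B a a\<close>, which is the
    shape \<open>M_B_P\<close> requires.\<close>
  have "X = whisk y' (P i) a \<bullet> whisk \<one> (B a y') a \<bullet> whisk (a \<odot> y') (P j) \<one> \<bullet> whisk a g \<one>"
    by (simp add: X_def e2 acmp_tail[OF e3] g)
  also have "\<dots> = whisk y' (P i \<boxtimes> P j) \<one> \<bullet> (whisk \<one> (B a y') a \<bullet> whisk a g \<one>)"
    by (simp add: acmp_tail[OF e4])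
  finally have X: "X = whisk y' (P i \<boxtimes> P j) \<one> \<bullet> (whisk \<one> (B a y') a \<bullet> whisk a g \<one>)" .
  have "ext y' g \<bullet> B a y \<bullet> whisk \<one> (P i) y = whisk y' (M \<bullet> B a a) \<one> \<bullet> X"
    by (simp add: ext_def acmp_tail[OF e1] X_def)
  also have "\<dots> = whisk y' (M \<bullet> B a a \<bullet> (P i \<boxtimes> P j)) \<one> \<bullet> (whisk \<one> (B a y') a \<bullet> whisk a g \<one>)"
    unfolding X by simp
  also have "\<dots> = ascl (\<kappa> i j) (whisk y' M \<one> \<bullet> X)"
    unfolding X M_B_P by simp
  finally show ?thesis by (simp add: X_def)
qed

text \<open>On generators the two orders of acting differ only in whether the factor of
  \<open>a\<close> produced by \<open>f\<close> is multiplied after or before the one produced by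
  \<open>g\<close>. That is the situation of \<open>exchange_homogeneous\<close>.\<close>

lemma tens_exchange:
  assumes f: "homog i x x' f" and g: "homog j y y' g"
  shows "whisk x' g \<one> \<bullet> slide x x' f y = ascl (\<kappa> i j) (tens x x' y y' f g)"
proof (rule modmap_eqI)
  have m: "modmap x x' f" "modmap y y' g" using assms by (auto simp: homog_def)
  note [simp] = modmapD(1-5)[OF m(1)] modmapD(1-5)[OF m(2)]
  show "modmap (x \<odot> y) (x' \<odot> y') (whisk x' g \<one> \<bullet> slide x x' f y)"
    by (rule modmap_cmp[OF modmap_slide modmap_whisk]) (use m in auto)
  show "modmap (x \<odot> y) (x' \<odot> y') (ascl (\<kappa> i j) (tens x x' y y' f g))"
    using m by (intro modmap_ascl modmap_tens)
  define f0 where "f0 = res x f"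
  define g0 where "g0 = res y g"
  have [simp]: "arr f0" "src f0 = x" "trg f0 = x' \<odot> a" "arr g0" "src g0 = y" "trg g0 = y' \<odot> a"
    by (simp_all add: f0_def g0_def)
  have f0: "whisk x' (P i) \<one> \<bullet> f0 = f0" and g0: "whisk y' (P j) \<one> \<bullet> g0 = g0"
    using assms by (auto simp: homog_def f0_def g0_def)
  have fx: "f = ext x' f0" and gx: "g = ext y' g0"
    using ext_res[OF m(1)] ext_res[OF m(2)] by (simp_all add: f0_def g0_def)
  have f0y: "whisk x' (P i) y \<bullet> whisk \<one> f0 y = whisk \<one> f0 y"
    using arg_cong[OF f0, of "\<lambda>t. whisk \<one> t y"] by simp
  have "res (x \<odot> y) (whisk x' g \<one> \<bullet> slide x x' f y) = whisk x' g \<one> \<bullet> res (x \<odot> y) (slide x x' f y)"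
    by (simp add: res_def)
  also have "\<dots> = whisk x' (ext y' g0 \<bullet> B a y) \<one> \<bullet> whisk \<one> f0 y"
    using res_slide[OF m(1), of y] by (simp add: gx flip: f0_def)
  \<comment> \<open>The projector can be inserted because \<open>f0\<close> has degree
    \<open>i\<close>; it supplies the homogeneous left factor.\<close>
  also have "\<dots> = whisk x' (ext y' g0 \<bullet> B a y \<bullet> whisk \<one> (P i) y) \<one> \<bullet> whisk \<one> f0 y"
    by (simp add: f0y)
  also have "\<dots> = ascl (\<kappa> i j)
      (whisk x' (whisk y' M \<one> \<bullet> whisk \<one> (B a y') a \<bullet> whisk a g0 \<one>) \<one> \<bullet> whisk \<one> f0 y)"
    by (subst exchange_homogeneous[where j = j]) (simp_all add: g0 f0y)
  also have "\<dots> = ascl (\<kappa> i j) (res (x \<odot> y) (tens x x' y y' f g))"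
  proof -
    have e1: "whisk (x' \<odot> a) g0 \<one> \<bullet> whisk \<one> f0 y = whisk \<one> f0 (y' \<odot> a) \<bullet> whisk x g0 \<one>"
      using exchange[of f0 g0] by simp
    have "res (x \<odot> y) (tens x x' y y' f g) = slide x x' f y' \<bullet> whisk x g0 \<one>"
      using m by (simp add: tens_def res_def g0_def)
    also have "\<dots> = whisk (x' \<odot> y') M \<one> \<bullet> whisk x' (B a y') a \<bullet> whisk \<one> f0 (y' \<odot> a) \<bullet> whisk x g0 \<one>"
      unfolding fx by (simp add: slide_ext) (simp add: ext_def)
    finally show ?thesis by (simp add: e1)
  qed
  also have "\<dots> = res (x \<odot> y) (ascl (\<kappa> i j) (tens x x' y y' f g))"
    using modmap_tens[OF m] by (simp add: res_def modmapD)
  finally show "res (x \<odot> y) (whisk x' g \<one> \<bullet> slide x x' f y)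
    = res (x \<odot> y) (ascl (\<kappa> i j) (tens x x' y y' f g))" .
qed

text \<open>Only the inner pair has to change places, \<open>g'\<close> with \<open>f\<close>; after
  that the outer pairs compose by functoriality. Hence these two alone are homogeneous, and the
  scalar depends on their degrees.\<close>

lemma tens_cmp:
  assumes f: "homog i x x' f" and f': "modmap x' x'' f'" and g: "modmap y y' g" and g': "homog j y' y'' g'"
  shows "tens x' x'' y' y'' f' g' \<bullet> tens x x' y y' f g
    = ascl (\<kappa> i j) (tens x x'' y y'' (f' \<bullet> f) (g' \<bullet> g))"
proof -
  have m: "modmap x x' f" "modmap y' y'' g'" using f g' by (auto simp: homog_def)
  note [simp] = modmapD(1-5)[OF m(1)] modmapD(1-5)[OF m(2)] modmapD(1-5)[OF f'] modmapD(1-5)[OF g]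
  have e: "whisk x' g' \<one> \<bullet> slide x x' f y' = ascl (\<kappa> i j) (slide x x' f y'' \<bullet> whisk x g' \<one>)"
    using tens_exchange[OF f g'] by (simp add: tens_def)
  have c: "slide x' x'' f' y'' \<bullet> slide x x' f y'' = slide x x'' (f' \<bullet> f) y''"
    using m f' by (simp add: slide_cmp)
  show ?thesis
    by (simp add: tens_def acmp_tail[OF e] acmp_tail[OF c])
qed

end

section \<open>The category of induced modules\<close>

context graded_commutative_algebra
begin

lemma modmap_aadd:
  assumes "modmap x y f" "modmap x y g"
  shows "modmap x y (aadd f g)"
proof -
  note [simp] = modmapD[OF assms(1)] modmapD[OF assms(2)]
  show ?thesis by (simp add: modmap_def)
qed

lemma modmap_zero: "x \<in> ob C \<Longrightarrow> y \<in> ob C \<Longrightarrow> modmap x y (Arrow (x \<odot> a) (y \<odot> a) 0)"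
  using modmap_ascl[OF ext_modmap[of "Arrow x (y \<odot> a) 0" x y], of 0] zero_hom
  by (simp add: ascl_def)

lemma homog_aadd:
  assumes "homog i x y f" "homog i x y g"
  shows "homog i x y (aadd f g)"
proof -
  have m: "modmap x y f" "modmap x y g" using assms by (auto simp: homog_def)
  note [simp] = modmapD(1-5)[OF m(1)] modmapD(1-5)[OF m(2)]
  have "res x (aadd f g) = aadd (res x f) (res x g)" by (simp add: res_def)
  then show ?thesis using assms modmap_aadd[OF m] by (simp add: homog_def)
qed

lemma homog_ascl:
  assumes "homog i x y f"
  shows "homog i x y (ascl c f)"
proof -
  have m: "modmap x y f" using assms by (auto simp: homog_def)
  note [simp] = modmapD(1-5)[OF m]
  have "res x (ascl c f) = ascl c (res x f)" by (simp add: res_def)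
  then show ?thesis using assms modmap_ascl[OF m] by (simp add: homog_def)
qed

definition degree_part :: "'o \<Rightarrow> 'o \<Rightarrow> 'g \<Rightarrow> ('o, 'm) arrow \<Rightarrow> ('o, 'm) arrow"
  where "degree_part x y i h = ext y (whisk y (P i) \<one> \<bullet> res x h)"

lemma whisk_P_P:
  "x \<in> ob C \<Longrightarrow> y \<in> ob C \<Longrightarrow> whisk x (P i) y \<bullet> whisk x (P i) y = whisk x (P i) y"
  using arg_cong[OF P_P[of i], of "\<lambda>t. whisk x t y"] by (simp del: P_P)

lemma homog_degree_part:
  assumes "modmap x y h"
  shows "homog i x y (degree_part x y i h)"
proof -
  note [simp] = modmapD(1-5)[OF assms]
  show ?thesis
    using acmp_tail[OF whisk_P_P[of y \<one> i], of "res x h"]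
    by (simp add: homog_def degree_part_def ext_modmap res_ext)
qed

lemma homog_zero: "x \<in> ob C \<Longrightarrow> y \<in> ob C \<Longrightarrow> homog i x y (Arrow (x \<odot> a) (y \<odot> a) 0)"
  using homog_ascl[OF homog_degree_part[OF modmap_zero[of x y], of i], of 0]
  by (simp add: ascl_def degree_part_def zero_hom)

lemma sum_degree_part:
  assumes "modmap x y h"
  shows "(\<Sum>i\<in>UNIV. mph (degree_part x y i h)) = mph h"
proof -
  note [simp] = modmapD(1-5)[OF assms]
  have "mph (degree_part x y i h) = mph (whisk y M \<one> \<bullet> whisk y (P i) a \<bullet> whisk \<one> (res x h) a)" for i
    by (simp add: degree_part_def ext_def)
  then show ?thesis
    using sum_components[of "whisk y M \<one>" "whisk \<one> (res x h) a" y a] ext_res[OF assms]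
    by (simp add: ext_def)
qed

text \<open>Projecting the restriction of the sum to degree \<open>k\<close> annihilates every
  summand but the \<open>k\<close>-th, by orthogonality of the projectors; a module map is then
  recovered from its restriction.\<close>

lemma degree_part_unique:
  assumes h: "modmap x y h" and w: "\<And>i. homog i x y (w i)" and eq: "mph h = (\<Sum>i\<in>UNIV. mph (w i))"
  shows "w k = degree_part x y k h"
proof -
  have m: "modmap x y (w i)" for i using w by (auto simp: homog_def)
  note [simp] = modmapD(1-5)[OF h] modmapD(1-5)[OF m]
  have xU: "mph (whisk x U \<one>) \<in> hom C x (x \<odot> a)" using arr_mph[of "whisk x U \<one>"] by simp
  have yP: "mph (whisk y (P k) \<one>) \<in> hom C (y \<odot> a) (y \<odot> a)" using arr_mph[of "whisk y (P k) \<one>"] by simp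
  have wh: "mph (w i) \<in> hom C (x \<odot> a) (y \<odot> a)" for i using arr_mph[of "w i"] by simp
  have rh: "mph (res x (w i)) \<in> hom C x (y \<odot> a)" for i using arr_mph[of "res x (w i)"] by simp
  have "mph (whisk y (P k) \<one> \<bullet> res x h) = mph (whisk y (P k) \<one>) \<cdot> (\<Sum>i\<in>UNIV. mph (res x (w i)))"
    using cmp_sum_left[of x "x \<odot> a" "y \<odot> a" "mph (whisk x U \<one>)" UNIV "\<lambda>i. mph (w i)"] xU wh
    by (simp add: mph_simps(2) res_def eq)
  also have "\<dots> = (\<Sum>i\<in>UNIV. mph (whisk y (P k) \<one>) \<cdot> mph (res x (w i)))"
    using rh yP by (intro cmp_sum_right[of x "y \<odot> a" "y \<odot> a"]) simp_all
  also have "\<dots> = (\<Sum>i\<in>UNIV. if i = k then mph (res x (w k)) else 0)"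
  proof (rule sum.cong[OF refl])
    fix i
    have wi: "whisk y (P i) \<one> \<bullet> res x (w i) = res x (w i)" using w by (simp add: homog_def)
    show "mph (whisk y (P k) \<one>) \<cdot> mph (res x (w i)) = (if i = k then mph (res x (w k)) else 0)"
    proof (cases "i = k")
      case True
      then show ?thesis using arg_cong[OF wi, of mph] by (simp add: mph_simps(2))
    next
      case False
      have "whisk y (P k) \<one> \<bullet> res x (w i) = whisk y (P k \<bullet> P i) \<one> \<bullet> res x (w i)"
        by (simp add: wi)
      \<comment> \<open>The zero arrow is written as a multiple by \<open>0\<close>, so that the
        rules for \<open>ascl\<close> carry it through the composite.\<close>
      moreover have "P k \<bullet> P i = ascl 0 (P k)"
        using False P_ortho[of k i] by (intro arrow_eqI) (simp_all add: mph_simps(2,4))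
      ultimately have "mph (whisk y (P k) \<one> \<bullet> res x (w i)) = mph (ascl 0 (whisk y (P k) \<one> \<bullet> res x (w i)))"
        by simp
      then show ?thesis using False by (simp add: mph_simps(2,4))
    qed
  qed
  finally have "whisk y (P k) \<one> \<bullet> res x h = res x (w k)"
    by (intro arrow_eqI) simp_all
  then show ?thesis using ext_res[OF m] by (simp add: degree_part_def)
qed

section \<open>Induced modules as a graded category, and the Kleisli equivalence\<close>

abbreviation "IM \<equiv> induced_modules C A"
abbreviation "KL \<equiv> kleisli C A"

text \<open>A morphism of \<open>IM\<close> does not record its ends; restoring them makes the arrow
  calculus applicable.\<close>

definition ind_arrow :: "'o \<Rightarrow> 'o \<Rightarrow> 'm \<Rightarrow> ('o, 'm) arrow"
  where "ind_arrow x y h = Arrow (x \<odot> a) (y \<odot> a) h"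

lemma ind_arrow_simps [simp]: "src (ind_arrow x y h) = x \<odot> a" "trg (ind_arrow x y h) = y \<odot> a" "mph (ind_arrow x y h) = h"
  by (simp_all add: ind_arrow_def)

lemma ind_arrow_mph: "modmap x y h \<Longrightarrow> ind_arrow x y (mph h) = h"
  by (intro arrow_eqI) (simp_all add: modmapD)

lemma IM_simps [simp]: "Obj IM = ob C" "Idm IM x = \<i>\<d> (x \<odot> a)" "Comp IM x y z g f = g \<cdot> f" "Scl IM = scl C"
  by (simp_all add: induced_modules_def)

lemma Hom_IM:
  assumes "x \<in> ob C" "y \<in> ob C"
  shows "h \<in> Hom IM x y \<longleftrightarrow> modmap x y (ind_arrow x y h)"
proof -
  have "h \<in> Hom IM x y \<longleftrightarrow> h \<in> hom C (x \<odot> a) (y \<odot> a) \<and>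
      h \<cdot> (\<i>\<d> x \<otimes> mul A) = (\<i>\<d> y \<otimes> mul A) \<cdot> (h \<otimes> \<i>\<d> a)"
    by (simp add: induced_modules_def right_module_hom_def underlying_def Ind_def)
  also have "\<dots> \<longleftrightarrow> h \<in> hom C (x \<odot> a) (y \<odot> a) \<and>
      ind_arrow x y h \<bullet> (ide x \<boxtimes> M) = (ide y \<boxtimes> M) \<bullet> (ind_arrow x y h \<boxtimes> ide a)"
    using assms by (subst arrow_eq_iff) (simp_all add: mph_simps mph_gen del: atmr_whisk)
  also have "\<dots> \<longleftrightarrow> modmap x y (ind_arrow x y h)"
    using assms by (auto simp: modmap_def ind_arrow_def)
  finally show ?thesis .
qed

lemma kleisli_to_ind_ext:
  assumes "x \<in> ob C" "y \<in> ob C" "f \<in> hom C x (y \<odot> a)"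
  shows "kleisli_to_ind C A x y f = mph (ext y (Arrow x (y \<odot> a) f))"
proof -
  have "ext y (Arrow x (y \<odot> a) f) = (ide y \<boxtimes> M) \<bullet> (Arrow x (y \<odot> a) f \<boxtimes> ide a)"
    using assms by (simp add: ext_def)
  then show ?thesis by (simp add: kleisli_to_ind_def mph_simps mph_gen del: atmr_whisk)
qed

lemma Hom_KL: "Hom KL x y = hom C x (y \<odot> a)"
  by (simp add: kleisli_def)

lemma kleisli_to_ind_res:
  assumes "x \<in> ob C" "y \<in> ob C" "h \<in> Hom IM x y"
  shows "mph (res x (ind_arrow x y h)) \<in> hom C x (y \<odot> a)"
    "kleisli_to_ind C A x y (mph (res x (ind_arrow x y h))) = h"
proof -
  have m: "modmap x y (ind_arrow x y h)" using assms Hom_IM by simp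
  note [simp] = assms(1,2) modmapD(1)[OF m]
  show r: "mph (res x (ind_arrow x y h)) \<in> hom C x (y \<odot> a)" using arr_mph[of "res x (ind_arrow x y h)"] by simp
  have "Arrow x (y \<odot> a) (mph (res x (ind_arrow x y h))) = res x (ind_arrow x y h)" by (intro arrow_eqI) simp_all
  then show "kleisli_to_ind C A x y (mph (res x (ind_arrow x y h))) = h"
    using r ext_res[OF m] by (simp add: kleisli_to_ind_ext)
qed

lemma bij_kleisli_to_ind:
  assumes "x \<in> ob C" "y \<in> ob C"
  shows "bij_betw (kleisli_to_ind C A x y) (Hom KL x y) (Hom IM x y)"
proof (rule bij_betw_byWitness[where f' = "\<lambda>h. mph (res x (ind_arrow x y h))"])
  have K: "modmap x y (ext y (Arrow x (y \<odot> a) f))" if "f \<in> hom C x (y \<odot> a)" for f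
    using assms that by (intro ext_modmap) simp_all
  show "\<forall>f\<in>Hom KL x y. mph (res x (ind_arrow x y (kleisli_to_ind C A x y f))) = f"
    using assms K by (simp add: Hom_KL kleisli_to_ind_ext ind_arrow_mph res_ext)
  show "kleisli_to_ind C A x y ` Hom KL x y \<subseteq> Hom IM x y"
    using assms K by (auto simp: Hom_KL kleisli_to_ind_ext Hom_IM ind_arrow_mph)
  show "\<forall>h\<in>Hom IM x y. kleisli_to_ind C A x y (mph (res x (ind_arrow x y h))) = h"
    "(\<lambda>h. mph (res x (ind_arrow x y h))) ` Hom IM x y \<subseteq> Hom KL x y"
    using kleisli_to_ind_res[OF assms] by (auto simp: Hom_KL)
qed

text \<open>Makes the abstract inverse in \<open>ind_tensor\<close> explicit as precomposition with
  the unit.\<close>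

lemma inv_kleisli_to_ind:
  assumes "x \<in> ob C" "y \<in> ob C" "h \<in> Hom IM x y"
  shows "inv_into (Hom KL x y) (kleisli_to_ind C A x y) h = mph (res x (ind_arrow x y h))"
  using bij_kleisli_to_ind[OF assms(1,2)] kleisli_to_ind_res[OF assms]
  by (intro inv_into_f_eq) (auto simp: bij_betw_def Hom_KL)

lemma ind_tensor_tens:
  assumes "x \<in> ob C" "y \<in> ob C" "x' \<in> ob C" "y' \<in> ob C" "f \<in> Hom IM x x'" "g \<in> Hom IM y y'"
  shows "ind_tensor C A (x, y) (x', y') f g = mph (tens x x' y y' (ind_arrow x x' f) (ind_arrow y y' g))"
proof -
  have m: "modmap x x' (ind_arrow x x' f)" "modmap y y' (ind_arrow y y' g)" using assms Hom_IM by simp_all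
  note [simp] = assms(1-4) modmapD(1)[OF m(1)] modmapD(1)[OF m(2)]
  let ?f = "res x (ind_arrow x x' f)" and ?g = "res y (ind_arrow y y' g)"
  let ?k = "(ide x' \<boxtimes> ide y' \<boxtimes> M) \<bullet> (ide x' \<boxtimes> B a y' \<boxtimes> ide a) \<bullet> (?f \<boxtimes> ?g)"
  have k: "?k = whisk (x' \<odot> y') M \<one> \<bullet> whisk x' (B a y') a \<bullet> (?f \<boxtimes> ?g)" by simp
  then have k_arr: "arr ?k" "src ?k = x \<odot> y" "trg ?k = (x' \<odot> y') \<odot> a" by simp_all
  have "ind_tensor C A (x, y) (x', y') f g = kleisli_to_ind C A (x \<odot> y) (x' \<odot> y') (mph ?k)"
    using assms
    by (simp add: ind_tensor_def inv_kleisli_to_ind kleisli_tensor_def mph_simps mph_gen B_def del: atmr_whisk)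
  also have "\<dots> = mph (ext (x' \<odot> y') (Arrow (x \<odot> y) ((x' \<odot> y') \<odot> a) (mph ?k)))"
    using arr_mph[OF k_arr(1)] unfolding k_arr(2,3) by (intro kleisli_to_ind_ext) simp_all
  also have "Arrow (x \<odot> y) ((x' \<odot> y') \<odot> a) (mph ?k) = ?k"
    using k_arr by (intro arrow_eqI) (simp_all del: atmr_whisk)
  also have "ext (x' \<odot> y') ?k = tens x x' y y' (ext x' ?f) (ext y' ?g)"
    unfolding k by (rule tens_ext) simp_all
  finally show ?thesis using m by (simp add: ext_res)
qed

lemma Grd_IM:
  assumes "x \<in> ob C" "y \<in> ob C"
  shows "h \<in> Grd IM i x y \<longleftrightarrow> homog i x y (ind_arrow x y h)"
proof
  assume "h \<in> Grd IM i x y"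
  then obtain k where k: "k \<in> hom C x (y \<odot> cpt A i)" "h = kleisli_to_ind C A x y ((\<i>\<d> y \<otimes> emb A i) \<cdot> k)"
    by (auto simp: induced_modules_def kleisli_def)
  let ?F = "(ide y \<boxtimes> E i) \<bullet> Arrow x (y \<odot> cpt A i) k"
  have F: "arr ?F" "src ?F = x" "trg ?F = y \<odot> a" "mph ?F = (\<i>\<d> y \<otimes> emb A i) \<cdot> k"
    using assms k by (simp_all add: mph_simps mph_gen del: atmr_whisk)
  have "?F = Arrow x (y \<odot> a) ((\<i>\<d> y \<otimes> emb A i) \<cdot> k)" using F by (intro arrow_eqI) simp_all
  then have h: "h = mph (ext y ?F)"
    using k assms arr_mph[OF F(1)] F by (simp add: kleisli_to_ind_ext)
  have "P i \<bullet> E i = E i" by (simp add: P_def)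
  from arg_cong[OF this, of "\<lambda>t. whisk y t \<one>"] have "whisk y (P i) \<one> \<bullet> whisk y (E i) \<one> = whisk y (E i) \<one>"
    using assms by simp
  then have "whisk y (P i) \<one> \<bullet> ?F = ?F" using assms k acmp_tail by fastforce
  moreover have "modmap x y (ext y ?F)" using F assms by (intro ext_modmap) simp_all
  ultimately show "homog i x y (ind_arrow x y h)"
    using F assms by (simp add: homog_def h ind_arrow_mph res_ext del: atmr_whisk)
next
  assume h: "homog i x y (ind_arrow x y h)"
  then have m: "modmap x y (ind_arrow x y h)" by (simp add: homog_def)
  note [simp] = assms modmapD(1)[OF m]
  let ?r = "res x (ind_arrow x y h)"
  \<comment> \<open>The component of the restriction in degree \<open>i\<close>. Including it again
    recovers the restriction, because \<open>P i\<close> is \<open>E i \<bullet> R i\<close> and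
    fixes it.\<close>
  let ?k = "(ide y \<boxtimes> R i) \<bullet> ?r"
  have "?r = (ide y \<boxtimes> E i) \<bullet> ?k" using h by (simp add: homog_def P_def)
  from arg_cong[OF this, of mph] have r: "mph ?r = (\<i>\<d> y \<otimes> emb A i) \<cdot> mph ?k"
    by (simp only: mph_simps(1,2,3) mph_gen)
  have "mph ?k \<in> hom C x (y \<odot> cpt A i)" using arr_mph[of ?k] by simp
  moreover have "h = kleisli_to_ind C A x y (mph ?r)"
    using kleisli_to_ind_res[OF assms] m Hom_IM by simp
  ultimately show "h \<in> Grd IM i x y"
    unfolding r by (auto simp: induced_modules_def kleisli_def)
qed

lemma ind_arrow_add: "ind_arrow x y (f + g) = aadd (ind_arrow x y f) (ind_arrow x y g)"
  and ind_arrow_scl: "ind_arrow x y (scl C c f) = ascl c (ind_arrow x y f)"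
  and ind_arrow_cmp: "ind_arrow x z (g \<cdot> f) = ind_arrow y z g \<bullet> ind_arrow x y f"
  and ind_arrow_id: "ind_arrow x x (\<i>\<d> (x \<odot> a)) = ide (x \<odot> a)"
  by (simp_all add: ind_arrow_def aadd_def ascl_def acmp_def ide_def)

lemma Hom_IM_hom: "x \<in> ob C \<Longrightarrow> y \<in> ob C \<Longrightarrow> f \<in> Hom IM x y \<Longrightarrow> f \<in> hom C (x \<odot> a) (y \<odot> a)"
  using modmapD(1)[of x y "ind_arrow x y f"] arr_mph[of "ind_arrow x y f"] by (simp add: Hom_IM)

lemma graded_category_IM: "graded_category IM"
proof -
  \<comment> \<open>Hom spaces and their graded pieces are both cut out by predicates on arrows
    closed under sums and multiples, so one subspace argument covers both.\<close>
  have sub: "module.subspace (scl C) {h. X (ind_arrow x y h)}"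
    if "X (ind_arrow x y 0)" "\<And>f g. X f \<Longrightarrow> X g \<Longrightarrow> X (aadd f g)" "\<And>f c. X f \<Longrightarrow> X (ascl c f)" for X x y
    using that by (auto intro!: subspaceI simp: ind_arrow_add ind_arrow_scl)
  have Hom_eq: "Hom IM x y = {h. modmap x y (ind_arrow x y h)}" if "x \<in> ob C" "y \<in> ob C" for x y
    using Hom_IM[OF that] by auto
  have Grd_eq: "Grd IM i x y = {h. homog i x y (ind_arrow x y h)}" if "x \<in> ob C" "y \<in> ob C" for x y i
    using Grd_IM[OF that] by auto
  have homogD: "homog i x y h \<Longrightarrow> modmap x y h" for i x y h by (simp add: homog_def)
  have dir: "direct_sum_of (Hom IM x y) (\<lambda>i. Grd IM i x y)" if ob: "x \<in> ob C" "y \<in> ob C" for x y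
    unfolding direct_sum_of_def
  proof (intro conjI allI ballI)
    show "Grd IM i x y \<subseteq> Hom IM x y" for i using homogD by (auto simp: Grd_eq Hom_eq ob)
    fix h assume "h \<in> Hom IM x y"
    then have h: "modmap x y (ind_arrow x y h)" by (simp add: Hom_eq ob)
    show "\<exists>!w. (\<forall>i. w i \<in> Grd IM i x y) \<and> h = (\<Sum>i\<in>UNIV. w i)"
    proof (rule ex1I[of _ "\<lambda>i. mph (degree_part x y i (ind_arrow x y h))"])
      show "(\<forall>i. mph (degree_part x y i (ind_arrow x y h)) \<in> Grd IM i x y) \<and> h = (\<Sum>i\<in>UNIV. mph (degree_part x y i (ind_arrow x y h)))"
        using homog_degree_part[OF h] ind_arrow_mph[OF homogD[OF homog_degree_part[OF h]]] sum_degree_part[OF h]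
        by (simp add: Grd_eq ob)
      fix w assume w: "(\<forall>i. w i \<in> Grd IM i x y) \<and> h = (\<Sum>i\<in>UNIV. w i)"
      show "w = (\<lambda>i. mph (degree_part x y i (ind_arrow x y h)))"
      proof
        fix k
        have "ind_arrow x y (w k) = degree_part x y k (ind_arrow x y h)"
          by (rule degree_part_unique[OF h]) (use w in \<open>simp_all add: Grd_eq ob\<close>)
        from arg_cong[OF this, of mph] show "w k = mph (degree_part x y k (ind_arrow x y h))" by simp
      qed
    qed
  qed
  have hom: "x \<odot> a \<in> ob C" if "x \<in> ob C" for x using that by simp
  show ?thesis
  \<comment> \<open>Goals without a case of their own are the vector space axioms; they are
    discharged at the end.\<close>
  proof (unfold_locales, goal_cases)
    case (1 x) then show ?case by (simp add: Hom_IM ind_arrow_id modmap_ide)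
  next
    case (2 x y z f g) then show ?case by (simp add: Hom_IM ind_arrow_cmp[of x z g f y] modmap_cmp)
  next
    case (3 x y f) then show ?case using id_left[OF hom hom Hom_IM_hom] by simp
  next
    case (4 x y f) then show ?case using id_right[OF hom hom Hom_IM_hom] by simp
  next
    case (5 w x y z f g h)
    then show ?case using cmp_assoc[OF hom hom hom hom Hom_IM_hom Hom_IM_hom Hom_IM_hom] by simp
  next
    case (10 x y)
    then show ?case
      using sub[of "modmap x y"] by (simp add: Hom_eq modmap_zero[unfolded ind_arrow_def[symmetric]] modmap_aadd modmap_ascl)
  next
    case (11 x y i)
    then show ?case
      using sub[of "homog i x y"] by (simp add: Grd_eq homog_zero[unfolded ind_arrow_def[symmetric]] homog_aadd homog_ascl)
  next
    case (12 x y) then show ?case using dir by simp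
  next
    case (13 x y z f g g')
    then show ?case using cmp_add_left[OF hom hom hom Hom_IM_hom Hom_IM_hom Hom_IM_hom] by simp
  next
    case (14 x y z f f' g)
    then show ?case using cmp_add_right[OF hom hom hom Hom_IM_hom Hom_IM_hom Hom_IM_hom] by simp
  next
    case (15 x y z f g c)
    then show ?case using cmp_scale_left[OF hom hom hom Hom_IM_hom Hom_IM_hom] by simp
  next
    case (16 x y z f g c)
    then show ?case using cmp_scale_right[OF hom hom hom Hom_IM_hom Hom_IM_hom] by simp
  next
    case (17 x) then show ?case by (simp add: Grd_IM ind_arrow_id homog_ide)
  next
    case (18 x y z f i g j) then show ?case by (simp add: Grd_IM ind_arrow_cmp[of x z g f y] homog_cmp)
  qed (simp_all add: scale_right_distrib scale_left_distrib)
qed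

lemma graded_functor_kleisli_to_ind: "graded_functor KL IM (\<lambda>x. x) (kleisli_to_ind C A)"
proof -
  have KL: "Obj KL = ob C" "Idm KL x = \<i>\<d> x \<otimes> eta A" "Scl KL = scl C"
    "Comp KL x y z g f = (\<i>\<d> z \<otimes> mul A) \<cdot> ((g \<otimes> \<i>\<d> a) \<cdot> f)" for x y z f g
    by (simp_all add: kleisli_def)
  have K_mod: "modmap x y (ext y (Arrow x (y \<odot> a) f))"
    if "x \<in> ob C" "y \<in> ob C" "f \<in> hom C x (y \<odot> a)" for x y f
    using that by (intro ext_modmap) simp_all
  show ?thesis
    unfolding graded_functor_def is_functor_def KL Hom_KL IM_simps
  proof (intro conjI ballI allI)
    fix x assume x: "x \<in> ob C"
    then show "x \<in> ob C" .
    have U: "ide x \<boxtimes> U = Arrow x (x \<odot> a) (\<i>\<d> x \<otimes> eta A)"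
      using x by (intro arrow_eqI) (simp_all add: mph_simps mph_gen del: atmr_whisk)
    moreover have "arr (ide x \<boxtimes> U)" using x by simp
    ultimately have "\<i>\<d> x \<otimes> eta A \<in> hom C x (x \<odot> a)" by simp
    then have "kleisli_to_ind C A x x (\<i>\<d> x \<otimes> eta A) = mph (ext x (ide x \<boxtimes> U))"
      using x by (simp add: kleisli_to_ind_ext flip: U)
    also have "ext x (ide x \<boxtimes> U) = ide (x \<odot> a)" using x by (simp add: ext_def)
    finally show "kleisli_to_ind C A x x (\<i>\<d> x \<otimes> eta A) = \<i>\<d> (x \<odot> a)" by (simp add: mph_simps)
    fix y assume y: "y \<in> ob C"
    show "kleisli_to_ind C A x y f \<in> Hom IM x y" if "f \<in> hom C x (y \<odot> a)" for f
      using bij_kleisli_to_ind[OF x y] that by (auto simp: bij_betw_def Hom_KL)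
    show "kleisli_to_ind C A x y (f + f') = kleisli_to_ind C A x y f + kleisli_to_ind C A x y f'"
      if "f \<in> hom C x (y \<odot> a)" "f' \<in> hom C x (y \<odot> a)" for f f'
    proof -
      have "Arrow x (y \<odot> a) (f + f') = aadd (Arrow x (y \<odot> a) f) (Arrow x (y \<odot> a) f')"
        by (simp add: aadd_def)
      moreover have "f + f' \<in> hom C x (y \<odot> a)" using x y that subspace_add[OF hom_subspace] by simp
      ultimately show ?thesis
        using x y that by (simp add: kleisli_to_ind_ext) (simp add: ext_def mph_aadd)
    qed
    show "kleisli_to_ind C A x y (scl C c f) = scl C c (kleisli_to_ind C A x y f)"
      if "f \<in> hom C x (y \<odot> a)" for f c
    proof -
      have "Arrow x (y \<odot> a) (scl C c f) = ascl c (Arrow x (y \<odot> a) f)"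
        by (simp add: ascl_def)
      moreover have "scl C c f \<in> hom C x (y \<odot> a)" using x y that subspace_scale[OF hom_subspace] by simp
      ultimately show ?thesis
        using x y that by (simp add: kleisli_to_ind_ext) (simp add: ext_def mph_simps(4))
    qed
    show "kleisli_to_ind C A x y f \<in> Grd IM i x y" if "f \<in> Grd KL i x y" for f i
      using that by (auto simp: induced_modules_def)
    fix z f g assume z: "z \<in> ob C" and f: "f \<in> hom C x (y \<odot> a)" and g: "g \<in> hom C y (z \<odot> a)"
    let ?F = "Arrow x (y \<odot> a) f" and ?G = "Arrow y (z \<odot> a) g"
    let ?c = "(ide z \<boxtimes> M) \<bullet> (?G \<boxtimes> ide a) \<bullet> ?F"
    \<comment> \<open>Reads the Kleisli composite as an extension after \<open>?F\<close>, the form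
      to which \<open>ext_cmp_modmap\<close> applies.\<close>
    have c: "?c = ext z ?G \<bullet> ?F" using x y z f g by (simp add: ext_def)
    have c_arr: "arr ?c" "src ?c = x" "trg ?c = z \<odot> a" using x y z f g by simp_all
    have c_mph: "mph ?c = (\<i>\<d> z \<otimes> mul A) \<cdot> ((g \<otimes> \<i>\<d> a) \<cdot> f)" by (simp add: mph_simps mph_gen del: atmr_whisk)
    have "?c = Arrow x (z \<odot> a) (mph ?c)" using c_arr by (intro arrow_eqI) simp_all
    then have "kleisli_to_ind C A x z (mph ?c) = mph (ext z ?c)"
      using x z arr_mph[OF c_arr(1)] unfolding c_arr(2,3) by (simp add: kleisli_to_ind_ext del: atmr_whisk)
    also have "ext z ?c = ext z ?G \<bullet> ext y ?F"
      unfolding c using x y z f g K_mod by (intro ext_cmp_modmap[where y = y]) simp_all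
    finally show "kleisli_to_ind C A x z ((\<i>\<d> z \<otimes> mul A) \<cdot> ((g \<otimes> \<i>\<d> a) \<cdot> f)) =
        kleisli_to_ind C A y z g \<cdot> kleisli_to_ind C A x y f"
      using x y z f g unfolding c_mph by (simp add: kleisli_to_ind_ext mph_simps(2))
  qed
qed

section \<open>The graded-monoidal structure on induced modules\<close>

lemma tens_mph:
  assumes "x \<in> ob C" "y \<in> ob C" "x' \<in> ob C" "y' \<in> ob C" "f \<in> Hom IM x x'" "g \<in> Hom IM y y'"
  shows "ind_arrow (x \<odot> y) (x' \<odot> y') (ind_tensor C A (x, y) (x', y') f g) = tens x x' y y' (ind_arrow x x' f) (ind_arrow y y' g)"
  using assms by (simp add: ind_tensor_tens ind_arrow_mph modmap_tens Hom_IM)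

lemma tens_hom:
  assumes "x \<in> ob C" "y \<in> ob C" "x' \<in> ob C" "y' \<in> ob C" "f \<in> Hom IM x x'" "g \<in> Hom IM y y'"
  shows "ind_tensor C A (x, y) (x', y') f g \<in> Hom IM (x \<odot> y) (x' \<odot> y')"
  using assms by (simp add: Hom_IM tens_mph modmap_tens)

lemma ind_arrow_eqI: "ind_arrow x y f = ind_arrow x y g \<Longrightarrow> f = g"
  by (metis ind_arrow_simps(3))

lemma tens_id_IM:
  assumes "x \<in> ob C" "y \<in> ob C"
  shows "ind_tensor C A (x, y) (x, y) (\<i>\<d> (x \<odot> a)) (\<i>\<d> (y \<odot> a)) = \<i>\<d> ((x \<odot> y) \<odot> a)"
proof (rule ind_arrow_eqI)
  show "ind_arrow (x \<odot> y) (x \<odot> y) (ind_tensor C A (x, y) (x, y) (\<i>\<d> (x \<odot> a)) (\<i>\<d> (y \<odot> a)))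
    = ind_arrow (x \<odot> y) (x \<odot> y) (\<i>\<d> ((x \<odot> y) \<odot> a))"
    using assms ind_arrow_id[of "x \<odot> y"] by (simp add: tens_mph Hom_IM ind_arrow_id modmap_ide tens_ide)
qed

lemma tens_cmp_IM:
  assumes ob: "x \<in> ob C" "y \<in> ob C" "x' \<in> ob C" "y' \<in> ob C" "x'' \<in> ob C" "y'' \<in> ob C"
    and f: "f \<in> Grd IM i x x'" and g: "g \<in> Hom IM y y'" and f': "f' \<in> Hom IM x' x''" and g': "g' \<in> Grd IM j y' y''"
  shows "ind_tensor C A (x', y') (x'', y'') f' g' \<cdot> ind_tensor C A (x, y) (x', y') f g
    = scl C (\<kappa> i j) (ind_tensor C A (x, y) (x'', y'') (f' \<cdot> f) (g' \<cdot> g))"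
proof (rule ind_arrow_eqI)
  interpret IM: graded_category IM by (rule graded_category_IM)
  have h: "f \<in> Hom IM x x'" "g' \<in> Hom IM y' y''" using assms IM.grd_hom by simp_all
  have c: "f' \<cdot> f \<in> Hom IM x x''" "g' \<cdot> g \<in> Hom IM y y''"
    using IM.comp_hom[of x x' x'' f f'] IM.comp_hom[of y y' y'' g g'] h assms by simp_all
  have "ind_arrow (x \<odot> y) (x'' \<odot> y'') (ind_tensor C A (x', y') (x'', y'') f' g' \<cdot> ind_tensor C A (x, y) (x', y') f g)
      = tens x' x'' y' y'' (ind_arrow x' x'' f') (ind_arrow y' y'' g') \<bullet> tens x x' y y' (ind_arrow x x' f) (ind_arrow y y' g)"
    using assms h by (simp add: ind_arrow_cmp[of "x \<odot> y" "x'' \<odot> y''" _ _ "x' \<odot> y'"] tens_mph)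
  also have "\<dots> = ascl (\<kappa> i j) (tens x x'' y y'' (ind_arrow x' x'' f' \<bullet> ind_arrow x x' f) (ind_arrow y' y'' g' \<bullet> ind_arrow y y' g))"
    using assms by (intro tens_cmp) (simp_all add: Hom_IM Grd_IM)
  also have "\<dots> = ind_arrow (x \<odot> y) (x'' \<odot> y'') (scl C (\<kappa> i j) (ind_tensor C A (x, y) (x'', y'') (f' \<cdot> f) (g' \<cdot> g)))"
    using ob c by (simp add: ind_arrow_scl tens_mph flip: ind_arrow_cmp)
  finally show "ind_arrow (x \<odot> y) (x'' \<odot> y'') (ind_tensor C A (x', y') (x'', y'') f' g' \<cdot> ind_tensor C A (x, y) (x', y') f g)
    = ind_arrow (x \<odot> y) (x'' \<odot> y'') (scl C (\<kappa> i j) (ind_tensor C A (x, y) (x'', y'') (f' \<cdot> f) (g' \<cdot> g)))" .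
qed

text \<open>The generic construction expects the scalar as the twist evaluated at the degree of
  \<open>g'\<close>, then that of \<open>f\<close>, while \<open>tens_cmp_IM\<close> delivers
  \<kappa> with the degree of \<open>f\<close> first; the transposed twist reconciles them.
  Bilinearity holds because \<open>tens\<close> is built from whiskering and composition.\<close>

lemma ex_tensor:
  "\<exists>T. graded_monoidal_category (\<lambda>i j. \<kappa> j i) IM \<one> (tob C) T \<and>
    (\<forall>x \<in> ob C. \<forall>y \<in> ob C. \<forall>x' \<in> ob C. \<forall>y' \<in> ob C. \<forall>f \<in> Hom IM x x'. \<forall>g \<in> Hom IM y y'.
      T (x, y) (x', y') (hom_tensor IM IM (x, y) (x', y') f g) = ind_tensor C A (x, y) (x', y') f g)"
proof -
  interpret IM: graded_category IM by (rule graded_category_IM)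
  note ids = IM.id_hom[unfolded IM_simps]
  note grd = IM.grd_hom[unfolded IM_simps]
  have "\<exists>T. graded_monoidal_category (\<lambda>i j. \<kappa> j i) IM \<one> (tob C) T \<and>
    (\<forall>x \<in> Obj IM. \<forall>y \<in> Obj IM. \<forall>x' \<in> Obj IM. \<forall>y' \<in> Obj IM. \<forall>f \<in> Hom IM x x'. \<forall>g \<in> Hom IM y y'.
      T (x, y) (x', y') (hom_tensor IM IM (x, y) (x', y') f g) = ind_tensor C A (x, y) (x', y') f g)"
  proof (rule IM.ex_graded_monoidal_category, unfold IM_simps, goal_cases)
    case (6 x y x' y' f g)
    then show ?case by (rule tens_hom)
  next
    case (7 x y x' y' f f' g)
    note m = 7(5-7)[unfolded Hom_IM[OF 7(1,3)] Hom_IM[OF 7(2,4)]]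
    note [simp] = 7(1-4) modmapD(1)[OF m(1)] modmapD(1)[OF m(2)] modmapD(1)[OF m(3)]
    have "f + f' \<in> Hom IM x x'" using 7 by (simp add: Hom_IM ind_arrow_add modmap_aadd)
    then show ?case
      using 7 by (simp add: ind_tensor_tens ind_arrow_add) (simp add: tens_def slide_def mph_aadd)
  next
    case (8 x y x' y' f g g')
    note m = 8(5-7)[unfolded Hom_IM[OF 8(1,3)] Hom_IM[OF 8(2,4)]]
    note [simp] = 8(1-4) modmapD(1)[OF m(1)] modmapD(1)[OF m(2)] modmapD(1)[OF m(3)]
    have "g + g' \<in> Hom IM y y'" using 8 by (simp add: Hom_IM ind_arrow_add modmap_aadd)
    then show ?case
      using 8 by (simp add: ind_tensor_tens ind_arrow_add) (simp add: tens_def mph_aadd)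
  next
    case (9 x y x' y' c f g)
    note m = 9(5,6)[unfolded Hom_IM[OF 9(1,3)] Hom_IM[OF 9(2,4)]]
    note [simp] = 9(1-4) modmapD(1)[OF m(1)] modmapD(1)[OF m(2)]
    have "scl C c f \<in> Hom IM x x'" using 9 by (simp add: Hom_IM ind_arrow_scl modmap_ascl)
    then show ?case
      using 9 by (simp add: ind_tensor_tens ind_arrow_scl) (simp add: tens_def slide_def mph_simps(4))
  next
    case (10 x y x' y' c f g)
    note m = 10(5,6)[unfolded Hom_IM[OF 10(1,3)] Hom_IM[OF 10(2,4)]]
    note [simp] = 10(1-4) modmapD(1)[OF m(1)] modmapD(1)[OF m(2)]
    have "scl C c g \<in> Hom IM y y'" using 10 by (simp add: Hom_IM ind_arrow_scl modmap_ascl)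
    then show ?case
      using 10 by (simp add: ind_tensor_tens ind_arrow_scl) (simp add: tens_def mph_simps(4))
  next
    case (11 x y x' y' f g i j)
    then show ?case
      using grd[of x x' f i] grd[of y y' g j] by (simp add: Grd_IM tens_mph homog_tens)
  next
    case (12 x y)
    then show ?case by (rule tens_id_IM)
  next
    case (13 x y x' y' x'' y'' f g f' g' i j)
    then show ?case by (rule tens_cmp_IM)
  next
    case (14 x y z x' y' z' f g h)
    note t = tens_hom[OF 14(1,2,4,5,7,8)] tens_hom[OF 14(2,3,5,6,8,9)]
    show ?case
    proof (rule ind_arrow_eqI)
      have "ind_arrow ((x \<odot> y) \<odot> z) ((x' \<odot> y') \<odot> z')
          (ind_tensor C A (x \<odot> y, z) (x' \<odot> y', z') (ind_tensor C A (x, y) (x', y') f g) h)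
        = tens (x \<odot> y) (x' \<odot> y') z z' (tens x x' y y' (ind_arrow x x' f) (ind_arrow y y' g)) (ind_arrow z z' h)"
        using 14 t by (subst tens_mph) (simp_all add: tens_mph del: tob_assoc)
      also have "\<dots> = tens x x' (y \<odot> z) (y' \<odot> z') (ind_arrow x x' f) (tens y y' z z' (ind_arrow y y' g) (ind_arrow z z' h))"
        using 14 by (intro tens_assoc) (simp_all add: Hom_IM)
      also have "\<dots> = ind_arrow (x \<odot> y \<odot> z) (x' \<odot> y' \<odot> z')
          (ind_tensor C A (x, y \<odot> z) (x', y' \<odot> z') f (ind_tensor C A (y, z) (y', z') g h))"
        using 14 t by (subst tens_mph) (simp_all add: tens_mph)
      finally show "ind_arrow (x \<odot> y \<odot> z) (x' \<odot> y' \<odot> z')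
          (ind_tensor C A (x \<odot> y, z) (x' \<odot> y', z') (ind_tensor C A (x, y) (x', y') f g) h)
        = ind_arrow (x \<odot> y \<odot> z) (x' \<odot> y' \<odot> z')
          (ind_tensor C A (x, y \<odot> z) (x', y' \<odot> z') f (ind_tensor C A (y, z) (y', z') g h))"
        using 14 by simp
    qed
  next
    case (15 x y f)
    then show ?case
      using tens_mph[of \<one> x \<one> y "\<i>\<d> (\<one> \<odot> a)" f] ids[of \<one>] ind_arrow_id[of \<one>]
      by (intro ind_arrow_eqI[of x y]) (simp add: tens_unit Hom_IM)
  next
    case (16 x y f)
    then show ?case
      using tens_mph[of x \<one> y \<one> f "\<i>\<d> (\<one> \<odot> a)"] ids[of \<one>] ind_arrow_id[of \<one>]
      by (intro ind_arrow_eqI[of x y]) (simp add: tens_unit Hom_IM)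
  qed simp_all
  then show ?thesis by simp
qed

end

section \<open>Comparison with the tensor product over the algebra\<close>

context graded_commutative_algebra
begin

section \<open>The left action on an induced module\<close>

definition lact :: "'o \<Rightarrow> ('o, 'm) arrow"
  where "lact y = whisk y M \<one> \<bullet> whisk \<one> (B a y) a"

lemma lact_simps [simp]: "y \<in> ob C \<Longrightarrow> arr (lact y)" "y \<in> ob C \<Longrightarrow> src (lact y) = a \<odot> y \<odot> a" "y \<in> ob C \<Longrightarrow> trg (lact y) = y \<odot> a"
  by (simp_all add: lact_def)

lemma kappa_inverse: "inverse (\<kappa> i j) * \<kappa> i j = 1"
  using bicharacter by (simp add: bicharacter_def)

lemma kappa_zero: "\<kappa> i 0 = 1"
proof -
  have "\<kappa> i (0 + 0) = \<kappa> i 0 * \<kappa> i 0" "\<kappa> i 0 \<noteq> 0" using bicharacter unfolding bicharacter_def by blast+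
  then show ?thesis by simp
qed

lemma ascl_ascl: "ascl c (ascl d f) = ascl (c * d) f" and ascl_one: "ascl 1 f = f"
  by (simp_all add: ascl_def)

text \<open>The hexagon splits the braiding of the degree \<open>i\<close> part with
  \<open>y \<odot> a\<close> into a passage past \<open>y\<close>, which remains, and one past the
  degree \<open>j\<close> part. The latter is absorbed into the multiplication at the cost of
  \<kappa>(i, j), cancelling the inverse in the definition of the left action.\<close>

lemma left_action_component:
  assumes "y \<in> ob C"
  shows "(ide y \<boxtimes> E (i + j)) \<bullet> (ascl (inverse (\<kappa> i j))
      (((ide y \<boxtimes> R (i + j)) \<bullet> ((ide y \<boxtimes> M) \<bullet> ((ide y \<boxtimes> E j) \<boxtimes> E i))) \<bullet> B (cpt A i) (y \<odot> cpt A j))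
      \<bullet> (R i \<boxtimes> (ide y \<boxtimes> R j)))
    = lact y \<bullet> whisk \<one> (P i) (y \<odot> a) \<bullet> whisk (a \<odot> y) (P j) \<one>" (is "?T = _")
proof -
  note [simp] = assms
  have n: "B a (y \<odot> a) \<bullet> (E i \<boxtimes> (ide y \<boxtimes> E j)) = ((ide y \<boxtimes> E j) \<boxtimes> E i) \<bullet> B (cpt A i) (y \<odot> cpt A j)"
    using B_natural[of "E i" "ide y \<boxtimes> E j"] by (simp del: atmr_whisk)
  have p: "(E i \<boxtimes> (ide y \<boxtimes> E j)) \<bullet> (R i \<boxtimes> (ide y \<boxtimes> R j)) = P i \<boxtimes> (ide y \<boxtimes> P j)"
    by (simp add: interchange P_def del: atmr_whisk)
  have e: "whisk \<one> (B a y) a \<bullet> whisk \<one> (P i) (y \<odot> a) = whisk y (P i) a \<bullet> whisk \<one> (B a y) a"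
    using arg_cong[OF B_natural_left[of "P i" y], of "\<lambda>t. whisk \<one> t a"] by simp
  have e': "whisk \<one> (B a y) a \<bullet> whisk (a \<odot> y) (P j) \<one> = whisk (y \<odot> a) (P j) \<one> \<bullet> whisk \<one> (B a y) a"
    using exchange[of "B a y" "P j"] by simp
  have "?T = ascl (inverse (\<kappa> i j)) ((ide y \<boxtimes> E (i + j)) \<bullet> (ide y \<boxtimes> R (i + j)) \<bullet> (ide y \<boxtimes> M) \<bullet>
      (((ide y \<boxtimes> E j) \<boxtimes> E i) \<bullet> B (cpt A i) (y \<odot> cpt A j)) \<bullet> (R i \<boxtimes> (ide y \<boxtimes> R j)))"
    by (simp del: atmr_whisk)
  also have "\<dots> = ascl (inverse (\<kappa> i j)) ((ide y \<boxtimes> E (i + j)) \<bullet> (ide y \<boxtimes> R (i + j)) \<bullet> (ide y \<boxtimes> M) \<bullet>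
      B a (y \<odot> a) \<bullet> ((E i \<boxtimes> (ide y \<boxtimes> E j)) \<bullet> (R i \<boxtimes> (ide y \<boxtimes> R j))))"
    unfolding n[symmetric] by (simp del: atmr_whisk)
  also have "\<dots> = ascl (inverse (\<kappa> i j))
      (whisk y (P (i + j) \<bullet> (M \<bullet> B a a \<bullet> (P i \<boxtimes> P j))) \<one> \<bullet> whisk \<one> (B a y) a)"
    unfolding p by (simp add: B_tensor_right P_def[of "i + j"] acmp_tail[OF e] e')
  also have "\<dots> = whisk y (P (i + j) \<bullet> M \<bullet> (P i \<boxtimes> P j)) \<one> \<bullet> whisk \<one> (B a y) a"
    unfolding M_B_P by (simp add: ascl_ascl kappa_inverse ascl_one)
  also have "\<dots> = lact y \<bullet> whisk \<one> (P i) (y \<odot> a) \<bullet> whisk (a \<odot> y) (P j) \<one>"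
    unfolding P_M by (simp add: lact_def acmp_tail[OF e] e')
  finally show ?thesis .
qed

lemma graded_bimodule_Ind:
  assumes "y \<in> ob C"
  shows "graded_bimodule C \<kappa> A (Ind C A y) = (y \<odot> a, mph (lact y), \<i>\<d> y \<otimes> mul A)"
proof -
  note [simp] = assms
  have "(\<Sum>i\<in>UNIV. \<Sum>j\<in>UNIV. emb (Ind C A y) (i + j) \<cdot>
       (scl C (inverse (\<kappa> i j)) (act_cpt C A (Ind C A y) j i \<cdot> \<beta> (cpt A i) (cpt (Ind C A y) j))
         \<cdot> (prj A i \<otimes> prj (Ind C A y) j)))
    = (\<Sum>i\<in>UNIV. \<Sum>j\<in>UNIV. mph ((lact y \<bullet> whisk \<one> (P i) (y \<odot> a)) \<bullet> whisk (a \<odot> y) (P j) \<one> \<bullet> ide (a \<odot> y \<odot> a)))"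
  proof (intro sum.cong refl)
    fix i j :: 'g
    from arg_cong[OF left_action_component[OF assms, of i j], of mph]
    show "emb (Ind C A y) (i + j) \<cdot>
       (scl C (inverse (\<kappa> i j)) (act_cpt C A (Ind C A y) j i \<cdot> \<beta> (cpt A i) (cpt (Ind C A y) j))
         \<cdot> (prj A i \<otimes> prj (Ind C A y) j))
      = mph ((lact y \<bullet> whisk \<one> (P i) (y \<odot> a)) \<bullet> whisk (a \<odot> y) (P j) \<one> \<bullet> ide (a \<odot> y \<odot> a))"
      by (simp add: Ind_def act_cpt_def mph_simps(1-4) mph_gen(1-4) B_def del: atmr_whisk)
  qed
  also have "\<dots> = (\<Sum>i\<in>UNIV. mph (lact y \<bullet> whisk \<one> (P i) (y \<odot> a) \<bullet> ide (a \<odot> y \<odot> a)))"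
    by (subst sum_components) simp_all
  also have "\<dots> = mph (lact y)"
    by (subst sum_components) simp_all
  finally show ?thesis by (simp add: graded_bimodule_def) (simp add: Ind_def)
qed

text \<open>Modules on arbitrary objects are needed for the coequalizer, whose underlying object
  need not literally be of the form \<open>x \<odot> a\<close>.\<close>

definition rmod :: "'o \<Rightarrow> ('o, 'm) arrow \<Rightarrow> bool"
  where "rmod m r \<longleftrightarrow> m \<in> ob C \<and> arr r \<and> src r = m \<odot> a \<and> trg r = m \<and>
    r \<bullet> whisk \<one> r a = r \<bullet> whisk m M \<one> \<and> r \<bullet> whisk m U \<one> = ide m"

definition rhom :: "'o \<Rightarrow> ('o, 'm) arrow \<Rightarrow> 'o \<Rightarrow> ('o, 'm) arrow \<Rightarrow> ('o, 'm) arrow \<Rightarrow> bool"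
  where "rhom m r n s h \<longleftrightarrow> arr h \<and> src h = m \<and> trg h = n \<and> h \<bullet> r = s \<bullet> whisk \<one> h a"

lemma right_module_rmod:
  assumes "rmod m r"
  shows "right_module C A (m, mph r)"
proof -
  have r: "m \<in> ob C" "arr r" "src r = m \<odot> a" "trg r = m" using assms by (simp_all add: rmod_def)
  have "r \<bullet> (r \<boxtimes> ide a) = r \<bullet> (ide m \<boxtimes> M)" "r \<bullet> (ide m \<boxtimes> U) = ide m"
    using assms by (simp_all add: rmod_def)
  from this[THEN arg_cong, of mph] show ?thesis
    using r arr_mph[of r] by (simp add: right_module_def mph_simps mph_gen del: atmr_whisk)
qed

lemma right_module_hom_rhom:
  assumes "rhom m r n s h" "rmod m r" "rmod n s"
  shows "mph h \<in> right_module_hom C A (m, mph r) (n, mph s)"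
proof -
  have "h \<bullet> r = s \<bullet> (h \<boxtimes> ide a)" using assms by (simp add: rhom_def rmod_def)
  from this[THEN arg_cong, of mph] show ?thesis
    using assms arr_mph[of h] by (simp add: right_module_hom_def rhom_def mph_simps del: atmr_whisk)
qed

lemma rmod_Ind: "x \<in> ob C \<Longrightarrow> rmod (x \<odot> a) (whisk x M \<one>)"
  using M_unit_whisk(2)[of x \<one>] by (simp add: rmod_def M_assoc_whisk')

lemma underlying_Ind: "x \<in> ob C \<Longrightarrow> underlying (Ind C A x) = (x \<odot> a, mph (whisk x M \<one>))"
proof -
  assume x: "x \<in> ob C"
  then have "whisk x M \<one> = ide x \<boxtimes> M" by simp
  then show ?thesis by (simp add: underlying_def Ind_def mph_simps mph_gen del: atmr_whisk)
qed

text \<open>Two passages past \<open>y\<close> merge into the passage of the product, by naturality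
  of the braiding in \<open>M\<close> and the hexagon; the rest is associativity.\<close>

lemma lact_lact:
  assumes "y \<in> ob C"
  shows "lact y \<bullet> whisk a (lact y) \<one> = lact y \<bullet> whisk \<one> M (y \<odot> a)"
proof -
  note [simp] = assms
  have e: "whisk \<one> (B a y) a \<bullet> whisk (a \<odot> y) M \<one> = whisk (y \<odot> a) M \<one> \<bullet> whisk \<one> (B a y) (a \<odot> a)"
    using exchange[of "B a y" M] by simp
  have "lact y \<bullet> whisk a (lact y) \<one>
      = whisk y M \<one> \<bullet> whisk (y \<odot> a) M \<one> \<bullet> whisk \<one> (B a y) (a \<odot> a) \<bullet> whisk a (B a y) a"
    by (simp add: lact_def acmp_tail[OF e])
  also have "\<dots> = whisk y M \<one> \<bullet> whisk y M a \<bullet> whisk \<one> (B a y) (a \<odot> a) \<bullet> whisk a (B a y) a"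
    by (simp add: acmp_tail[OF M_assoc_whisk'])
  also have "\<dots> = lact y \<bullet> whisk \<one> M (y \<odot> a)"
    using B_M_whisk[of \<one> y a] by (simp add: lact_def)
  finally show ?thesis .
qed

lemma lact_U: "y \<in> ob C \<Longrightarrow> lact y \<bullet> whisk \<one> U (y \<odot> a) = ide (y \<odot> a)"
  using arg_cong[OF B_U_whisk[of \<one> y], of "\<lambda>t. whisk \<one> t a"] M_unit_whisk(1)[of y \<one>] by (simp add: lact_def)

text \<open>The right action touches only the last factor, so it slips past the braiding and
  associativity does the rest.\<close>

lemma lact_R:
  assumes "y \<in> ob C"
  shows "whisk y M \<one> \<bullet> whisk \<one> (lact y) a = lact y \<bullet> whisk (a \<odot> y) M \<one>"
proof -
  note [simp] = assms
  have e: "whisk \<one> (B a y) a \<bullet> whisk (a \<odot> y) M \<one> = whisk (y \<odot> a) M \<one> \<bullet> whisk \<one> (B a y) (a \<odot> a)"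
    using exchange[of "B a y" M] by simp
  show ?thesis by (simp add: lact_def e acmp_tail[OF M_assoc_whisk'])
qed

lemma left_module_lact:
  assumes "y \<in> ob C"
  shows "left_module C A (y \<odot> a, mph (lact y))"
proof -
  note [simp] = assms
  have "lact y \<bullet> (ide a \<boxtimes> lact y) = lact y \<bullet> (M \<boxtimes> ide (y \<odot> a))" "lact y \<bullet> (U \<boxtimes> ide (y \<odot> a)) = ide (y \<odot> a)"
    by (simp_all add: lact_lact lact_U)
  from this[THEN arg_cong, of mph] show ?thesis
    using arr_mph[of "lact y"] by (simp add: left_module_def mph_simps mph_gen del: atmr_whisk)
qed

lemma bimodule_Ind:
  assumes "y \<in> ob C"
  shows "bimodule C A (graded_bimodule C \<kappa> A (Ind C A y))"
proof -
  note [simp] = assms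
  have "whisk y M \<one> \<bullet> (lact y \<boxtimes> ide a) = lact y \<bullet> (ide a \<boxtimes> whisk y M \<one>)"
    by (simp add: lact_R)
  from this[THEN arg_cong, of mph]
  have "mph (whisk y M \<one>) \<cdot> (mph (lact y) \<otimes> \<i>\<d> a) = mph (lact y) \<cdot> (\<i>\<d> a \<otimes> mph (whisk y M \<one>))"
    by (simp only: mph_simps(1-3))
  moreover have "\<i>\<d> y \<otimes> mul A = mph (whisk y M \<one>)"
    using underlying_Ind[OF assms] by (simp add: underlying_def Ind_def)
  ultimately show ?thesis
    using left_module_lact[OF assms] right_module_rmod[OF rmod_Ind[OF assms]]
    by (simp add: graded_bimodule_Ind bimodule_def)
qed

lemma lact_natural:
  assumes "homog 0 y y' g"
  shows "lact y' \<bullet> whisk a g \<one> = g \<bullet> lact y"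
proof -
  have m: "modmap y y' g" using assms by (simp add: homog_def)
  note [simp] = modmapD(1-5)[OF m]
  define g0 where "g0 = res y g"
  have [simp]: "arr g0" "src g0 = y" "trg g0 = y' \<odot> a" by (simp_all add: g0_def)
  have g0: "whisk y' (P 0) \<one> \<bullet> g0 = g0" using assms by (simp add: homog_def g0_def)
  have g: "ext y' g0 = g" using ext_res[OF m] by (simp add: g0_def)
  \<comment> \<open>Naturality on generators only, compared one degree of the acting factor at a
    time; each scalar is \<kappa>(i, 0) = 1. Right linearity of \<open>g\<close> then extends it to
    all of \<open>y \<odot> a\<close>.\<close>
  have core: "g \<bullet> B a y = lact y' \<bullet> whisk a g0 \<one>"
  proof (rule eq_by_components[of _ _ \<one> y])
    fix i
    show "(g \<bullet> B a y) \<bullet> whisk \<one> (P i) y = (lact y' \<bullet> whisk a g0 \<one>) \<bullet> whisk \<one> (P i) y"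
      using exchange_homogeneous[of g0 y y' 0 i] g0 by (simp add: g kappa_zero ascl_one lact_def)
  qed simp_all
  have e: "whisk \<one> (B a y') a \<bullet> whisk (a \<odot> y') M \<one> = whisk (y' \<odot> a) M \<one> \<bullet> whisk \<one> (B a y') (a \<odot> a)"
    using exchange[of "B a y'" M] by simp
  have "g \<bullet> lact y = whisk y' M \<one> \<bullet> whisk \<one> (g \<bullet> B a y) a"
    using acmp_tail[OF modmapD(6)[OF m], of "whisk \<one> (B a y) a"] by (simp add: lact_def)
  also have "\<dots> = whisk y' M \<one> \<bullet> whisk (y' \<odot> a) M \<one> \<bullet> whisk \<one> (B a y') (a \<odot> a) \<bullet> whisk a g0 a"
    unfolding core by (simp add: lact_def acmp_tail[OF M_assoc_whisk'])
  also have "\<dots> = lact y' \<bullet> whisk a (ext y' g0) \<one>"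
    by (simp add: lact_def ext_def acmp_tail[OF e])
  finally show ?thesis by (simp add: g)
qed

text \<open>The conjugate of \<open>f\<close> passes the braiding by \<open>slide_B\<close>,
  whatever its degree. Only \<open>g\<close> meets the left action, and \<open>lact_natural\<close>
  asks it to have degree 0.\<close>

lemma tens_lact:
  assumes f: "modmap x x' f" and g: "homog 0 y y' g"
  shows "tens x x' y y' f g \<bullet> whisk x (lact y) \<one> = whisk x' (lact y') \<one> \<bullet> (f \<boxtimes> g)"
proof -
  have m: "modmap y y' g" using g by (simp add: homog_def)
  note [simp] = modmapD(1-5)[OF f] modmapD(1-5)[OF m]
  have "whisk x' (lact y') \<one> \<bullet> whisk \<one> f (y' \<odot> a) = whisk (x' \<odot> y') M \<one> \<bullet> whisk \<one> (slide x x' f y' \<bullet> whisk x (B a y') \<one>) a"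
    using slide_B[of f x x' y'] by (simp add: lact_def)
  also have "\<dots> = slide x x' f y' \<bullet> whisk x (lact y') \<one>"
    using acmp_tail[OF modmapD(6)[OF modmap_slide[OF f, of y']], of "whisk x (B a y') a"] by (simp add: lact_def)
  finally have e1: "whisk x' (lact y') \<one> \<bullet> whisk \<one> f (y' \<odot> a) = slide x x' f y' \<bullet> whisk x (lact y') \<one>" .
  have e2: "whisk x (lact y') \<one> \<bullet> whisk (x \<odot> a) g \<one> = whisk x g \<one> \<bullet> whisk x (lact y) \<one>"
    using arg_cong[OF lact_natural[OF g], of "\<lambda>t. whisk x t \<one>"] by simp
  show ?thesis by (simp add: tens_def acmp_tail[OF e1] e2)
qed

end

section \<open>The coequalizer of two induced modules and its comparison map\<close>

locale tensor_over_algebra = graded_commutative_algebra C A \<kappa>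
  for C :: "('o, 'm::ab_group_add, 'k::field) bmcat" (structure)
    and A :: "('o, 'm, 'g::{finite, ab_group_add}) galg" and \<kappa> :: "'g \<Rightarrow> 'g \<Rightarrow> 'k" +
  fixes TA :: "'o \<times> 'm \<Rightarrow> 'o \<times> 'm \<Rightarrow> 'o \<times> 'm"
  assumes tensor_over: "tensor_over C A TA"
begin

definition quot :: "'o \<Rightarrow> 'o \<Rightarrow> 'o"
  where "quot x y = fst (TA (x \<odot> a, \<i>\<d> x \<otimes> mul A) (y \<odot> a, mph (lact y)))"

definition qmap :: "'o \<Rightarrow> 'o \<Rightarrow> ('o, 'm) arrow"
  where "qmap x y = Arrow (x \<odot> a \<odot> y \<odot> a) (quot x y) (snd (TA (x \<odot> a, \<i>\<d> x \<otimes> mul A) (y \<odot> a, mph (lact y))))"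

lemma qmap_simps [simp]: "src (qmap x y) = x \<odot> a \<odot> y \<odot> a" "trg (qmap x y) = quot x y"
  by (simp_all add: qmap_def)

lemma proj_Ind: "x \<in> ob C \<Longrightarrow> y \<in> ob C \<Longrightarrow>
    bimodule_proj TA (graded_bimodule C \<kappa> A (Ind C A x)) (graded_bimodule C \<kappa> A (Ind C A y)) = (quot x y, mph (qmap x y))"
  by (simp add: bimodule_proj_def graded_bimodule_Ind quot_def qmap_def)

lemma coequalizer:
  assumes "x \<in> ob C" "y \<in> ob C"
  shows "is_coequalizer C ((x \<odot> a) \<odot> a \<odot> (y \<odot> a)) ((x \<odot> a) \<odot> (y \<odot> a))
    ((\<i>\<d> x \<otimes> mul A) \<otimes> \<i>\<d> (y \<odot> a)) (\<i>\<d> (x \<odot> a) \<otimes> mph (lact y)) (quot x y) (mph (qmap x y))"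
proof -
  have "right_module C A (x \<odot> a, \<i>\<d> x \<otimes> mul A)"
    using right_module_rmod[OF rmod_Ind[OF assms(1)]] underlying_Ind[OF assms(1)]
    by (simp add: underlying_def Ind_def)
  then show ?thesis
    using tensor_over left_module_lact[OF assms(2)] unfolding tensor_over_def by (simp add: quot_def qmap_def)
qed

lemma quot_ob [simp]: "x \<in> ob C \<Longrightarrow> y \<in> ob C \<Longrightarrow> quot x y \<in> ob C"
  using coequalizer by (simp add: is_coequalizer_def)

lemma qmap_arr [simp]:
  assumes "x \<in> ob C" "y \<in> ob C"
  shows "arr (qmap x y)"
  using assms coequalizer[OF assms] by (simp add: is_coequalizer_def qmap_def)

lemma pair_mph:
  assumes "x \<in> ob C" "y \<in> ob C"
  shows "(\<i>\<d> x \<otimes> mul A) \<otimes> \<i>\<d> (y \<odot> a) = mph (whisk x M (y \<odot> a))"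
    "\<i>\<d> (x \<odot> a) \<otimes> mph (lact y) = mph (whisk (x \<odot> a) (lact y) \<one>)"
proof -
  have "(ide x \<boxtimes> M) \<boxtimes> ide (y \<odot> a) = whisk x M (y \<odot> a)" "ide (x \<odot> a) \<boxtimes> lact y = whisk (x \<odot> a) (lact y) \<one>"
    using assms by simp_all
  from this[THEN arg_cong, of mph]
  show "(\<i>\<d> x \<otimes> mul A) \<otimes> \<i>\<d> (y \<odot> a) = mph (whisk x M (y \<odot> a))"
    "\<i>\<d> (x \<odot> a) \<otimes> mph (lact y) = mph (whisk (x \<odot> a) (lact y) \<one>)"
    by (simp_all only: mph_simps(1-3) mph_gen)
qed

lemma qmap_coeq:
  assumes "x \<in> ob C" "y \<in> ob C"
  shows "qmap x y \<bullet> whisk (x \<odot> a) (lact y) \<one> = qmap x y \<bullet> whisk x M (y \<odot> a)"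
  using assms coequalizer[OF assms, unfolded pair_mph[OF assms]]
  by (intro arrow_eqI) (simp_all add: is_coequalizer_def mph_simps(2))

lemma qmap_universal:
  assumes "x \<in> ob C" "y \<in> ob C" "arr h" "src h = x \<odot> a \<odot> y \<odot> a"
    and eq: "h \<bullet> whisk (x \<odot> a) (lact y) \<one> = h \<bullet> whisk x M (y \<odot> a)"
  shows "\<exists>u. arr u \<and> src u = quot x y \<and> trg u = trg h \<and> u \<bullet> qmap x y = h"
proof -
  have "mph h \<cdot> mph (whisk x M (y \<odot> a)) = mph h \<cdot> mph (whisk (x \<odot> a) (lact y) \<one>)"
    using arg_cong[OF eq, of mph] by (simp add: mph_simps(2))
  moreover have "mph h \<in> hom C ((x \<odot> a) \<odot> (y \<odot> a)) (trg h)" "trg h \<in> ob C"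
    using arr_mph[OF assms(3)] assms by simp_all
  moreover note coequalizer[OF assms(1,2), unfolded pair_mph[OF assms(1,2)] is_coequalizer_def,
      THEN conjunct2, THEN conjunct2, THEN conjunct2]
  ultimately have "\<exists>!u. u \<in> hom C (quot x y) (trg h) \<and> u \<cdot> mph (qmap x y) = mph h" by simp
  then obtain u where "u \<in> hom C (quot x y) (trg h)" "u \<cdot> mph (qmap x y) = mph h" by blast
  then show ?thesis
    using assms by (intro exI[of _ "Arrow (quot x y) (trg h) u"]) (auto intro!: arrow_eqI simp: mph_simps(2))
qed

definition pmap :: "'o \<Rightarrow> 'o \<Rightarrow> ('o, 'm) arrow"
  where "pmap x y = whisk x (lact y) \<one>"

definition sect :: "'o \<Rightarrow> 'o \<Rightarrow> ('o, 'm) arrow"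
  where "sect x y = whisk x U (y \<odot> a)"

definition \<phi> :: "'o \<Rightarrow> 'o \<Rightarrow> ('o, 'm) arrow"
  where "\<phi> x y = (SOME u. arr u \<and> src u = quot x y \<and> trg u = x \<odot> y \<odot> a \<and> u \<bullet> qmap x y = pmap x y)"

definition \<psi> :: "'o \<Rightarrow> 'o \<Rightarrow> ('o, 'm) arrow"
  where "\<psi> x y = qmap x y \<bullet> sect x y"

lemma ps_simps [simp]:
  assumes "x \<in> ob C" "y \<in> ob C"
  shows "arr (pmap x y)" "src (pmap x y) = x \<odot> a \<odot> y \<odot> a" "trg (pmap x y) = x \<odot> y \<odot> a"
    "arr (sect x y)" "src (sect x y) = x \<odot> y \<odot> a" "trg (sect x y) = x \<odot> a \<odot> y \<odot> a"
    "arr (\<psi> x y)" "src (\<psi> x y) = x \<odot> y \<odot> a" "trg (\<psi> x y) = quot x y"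
  using assms by (simp_all add: pmap_def sect_def \<psi>_def)

lemma pmap_sect: "x \<in> ob C \<Longrightarrow> y \<in> ob C \<Longrightarrow> pmap x y \<bullet> sect x y = ide (x \<odot> y \<odot> a)"
  using arg_cong[OF lact_U, of y "\<lambda>t. whisk x t \<one>"] by (simp add: pmap_def sect_def)

text \<open>The pair coequalized by \<open>pmap\<close> is split by inserting units, so that any arrow coequalizing it
  factors through \<open>pmap\<close> along \<open>sect\<close>.\<close>

lemma coequalizing_factor:
  assumes "x \<in> ob C" "y \<in> ob C" "arr h" "src h = x \<odot> a \<odot> y \<odot> a"
    and eq: "h \<bullet> whisk (x \<odot> a) (lact y) \<one> = h \<bullet> whisk x M (y \<odot> a)"
  shows "h \<bullet> sect x y \<bullet> pmap x y = h"
proof -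
  note [simp] = assms(1-4)
  have e: "whisk x U (y \<odot> a) \<bullet> whisk x (lact y) \<one> = whisk (x \<odot> a) (lact y) \<one> \<bullet> whisk x U (a \<odot> y \<odot> a)"
    using whisk_exchange[of U "lact y" x \<one> \<one>] by simp
  show ?thesis
    using M_unit_whisk(1)[of x "y \<odot> a"] acmp_tail[OF eq, of "whisk x U (a \<odot> y \<odot> a)"]
    by (simp add: sect_def pmap_def e)
qed

lemma qmap_sect_pmap: "x \<in> ob C \<Longrightarrow> y \<in> ob C \<Longrightarrow> qmap x y \<bullet> sect x y \<bullet> pmap x y = qmap x y"
  by (rule coequalizing_factor) (simp_all add: qmap_coeq)

lemma \<phi>:
  assumes "x \<in> ob C" "y \<in> ob C"
  shows "arr (\<phi> x y) \<and> src (\<phi> x y) = quot x y \<and> trg (\<phi> x y) = x \<odot> y \<odot> a \<and> \<phi> x y \<bullet> qmap x y = pmap x y"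
proof -
  have "pmap x y \<bullet> whisk (x \<odot> a) (lact y) \<one> = pmap x y \<bullet> whisk x M (y \<odot> a)"
    using arg_cong[OF lact_lact, of y "\<lambda>t. whisk x t \<one>"] assms by (simp add: pmap_def)
  then have "\<exists>u. arr u \<and> src u = quot x y \<and> trg u = x \<odot> y \<odot> a \<and> u \<bullet> qmap x y = pmap x y"
    using qmap_universal[of x y "pmap x y"] assms by simp
  then show ?thesis unfolding \<phi>_def by (rule someI_ex)
qed

lemma \<phi>_simps [simp]:
  assumes "x \<in> ob C" "y \<in> ob C"
  shows "arr (\<phi> x y)" "src (\<phi> x y) = quot x y" "trg (\<phi> x y) = x \<odot> y \<odot> a"
  using \<phi>[OF assms] by auto

lemma \<phi>_qmap: "x \<in> ob C \<Longrightarrow> y \<in> ob C \<Longrightarrow> \<phi> x y \<bullet> qmap x y = pmap x y"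
  using \<phi> by blast

lemma \<phi>_\<psi>: "x \<in> ob C \<Longrightarrow> y \<in> ob C \<Longrightarrow> \<phi> x y \<bullet> \<psi> x y = ide (x \<odot> y \<odot> a)"
  by (simp add: \<psi>_def acmp_tail[OF \<phi>_qmap] pmap_sect)

text \<open>The composite and the identity both leave the quotient map unchanged, so they agree by
  the uniqueness half of the universal property.\<close>

lemma \<psi>_\<phi>:
  assumes "x \<in> ob C" "y \<in> ob C"
  shows "\<psi> x y \<bullet> \<phi> x y = ide (quot x y)"
proof -
  note [simp] = assms
  have "\<exists>!u. u \<in> hom C (quot x y) (quot x y) \<and> u \<cdot> mph (qmap x y) = mph (qmap x y)"
    using coequalizer[OF assms] unfolding is_coequalizer_def by simp
  moreover have "mph (\<psi> x y \<bullet> \<phi> x y) \<in> hom C (quot x y) (quot x y)" "\<i>\<d> (quot x y) \<in> hom C (quot x y) (quot x y)"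
    using arr_mph[of "\<psi> x y \<bullet> \<phi> x y"] by (simp_all add: id_hom)
  moreover have "(\<psi> x y \<bullet> \<phi> x y) \<bullet> qmap x y = qmap x y" "ide (quot x y) \<bullet> qmap x y = qmap x y"
    by (simp_all add: \<phi>_qmap) (simp add: \<psi>_def qmap_sect_pmap)
  then have "mph (\<psi> x y \<bullet> \<phi> x y) \<cdot> mph (qmap x y) = mph (qmap x y)" "\<i>\<d> (quot x y) \<cdot> mph (qmap x y) = mph (qmap x y)"
    by (metis mph_simps(1,2))+
  ultimately have "mph (\<psi> x y \<bullet> \<phi> x y) = \<i>\<d> (quot x y)" by blast
  then show ?thesis by (intro arrow_eqI) (simp_all add: mph_simps(1))
qed

text \<open>The quotient map has the right inverse \<open>sect x y \<bullet> \<phi> x y\<close>.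
  Being split epi, it remains cancellable after whiskering.\<close>

lemma qmap_cancel:
  assumes "u \<bullet> qmap x y = v \<bullet> qmap x y" "arr u" "arr v" "src u = quot x y" "src v = quot x y" "x \<in> ob C" "y \<in> ob C"
  shows "u = v"
proof -
  note [simp] = assms(2-)
  have "(u \<bullet> qmap x y) \<bullet> (sect x y \<bullet> \<phi> x y) = (v \<bullet> qmap x y) \<bullet> (sect x y \<bullet> \<phi> x y)" using assms(1) by simp
  moreover have "qmap x y \<bullet> sect x y \<bullet> \<phi> x y = ide (quot x y)" using \<psi>_\<phi>[of x y] by (simp add: \<psi>_def)
  ultimately show ?thesis by simp
qed

text \<open>The right action of \<open>Ind(x \<otimes> y)\<close> carried over along the
  isomorphism, which gives the module laws by transport. That it is the action induced on the
  coequalizer is \<open>tilde_tensor_Ind\<close>.\<close>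

definition qact :: "'o \<Rightarrow> 'o \<Rightarrow> ('o, 'm) arrow"
  where "qact x y = \<psi> x y \<bullet> whisk (x \<odot> y) M \<one> \<bullet> whisk \<one> (\<phi> x y) a"

lemma qact_simps [simp]:
  assumes "x \<in> ob C" "y \<in> ob C"
  shows "arr (qact x y)" "src (qact x y) = quot x y \<odot> a" "trg (qact x y) = quot x y"
  using assms by (simp_all add: qact_def)

lemma whisk_\<phi>_\<psi>:
  "x \<in> ob C \<Longrightarrow> y \<in> ob C \<Longrightarrow> z \<in> ob C \<Longrightarrow> whisk \<one> (\<phi> x y) z \<bullet> whisk \<one> (\<psi> x y) z = ide (x \<odot> y \<odot> a \<odot> z)"
  using arg_cong[OF \<phi>_\<psi>[of x y], of "\<lambda>t. whisk \<one> t z"] by simp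

lemma rmod_qact:
  assumes "x \<in> ob C" "y \<in> ob C"
  shows "rmod (quot x y) (qact x y)"
proof -
  note [simp] = assms
  have e1: "whisk \<one> (\<phi> x y) a \<bullet> whisk (quot x y) M \<one> = whisk (x \<odot> y \<odot> a) M \<one> \<bullet> whisk \<one> (\<phi> x y) (a \<odot> a)"
    using exchange[of "\<phi> x y" M] by simp
  have e2: "whisk \<one> (\<phi> x y) a \<bullet> whisk (quot x y) U \<one> = whisk (x \<odot> y \<odot> a) U \<one> \<bullet> \<phi> x y"
    using exchange[of "\<phi> x y" U] by simp
  have u: "whisk (x \<odot> y) M \<one> \<bullet> whisk (x \<odot> y \<odot> a) U \<one> = ide (x \<odot> y \<odot> a)"
    using M_unit_whisk'(2)[of "x \<odot> y"] by simp
  have m: "whisk (x \<odot> y) M \<one> \<bullet> whisk (x \<odot> y) M a = whisk (x \<odot> y) M \<one> \<bullet> whisk (x \<odot> y \<odot> a) M \<one>"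
    using M_assoc_whisk'[of "x \<odot> y"] by simp
  have "qact x y \<bullet> whisk \<one> (qact x y) a = qact x y \<bullet> whisk (quot x y) M \<one>"
    by (simp add: qact_def e1 acmp_tail[OF whisk_\<phi>_\<psi>] acmp_tail[OF m])
  moreover have "qact x y \<bullet> whisk (quot x y) U \<one> = ide (quot x y)"
    by (simp add: qact_def e2 acmp_tail[OF u] \<psi>_\<phi>)
  ultimately show ?thesis by (simp add: rmod_def)
qed

lemma rhom_\<phi>:
  assumes "x \<in> ob C" "y \<in> ob C"
  shows "rhom (quot x y) (qact x y) (x \<odot> y \<odot> a) (whisk (x \<odot> y) M \<one>) (\<phi> x y)"
  using assms by (simp add: rhom_def qact_def acmp_tail[OF \<phi>_\<psi>])

lemma rhom_\<psi>:
  assumes "x \<in> ob C" "y \<in> ob C"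
  shows "rhom (x \<odot> y \<odot> a) (whisk (x \<odot> y) M \<one>) (quot x y) (qact x y) (\<psi> x y)"
  using assms by (simp add: rhom_def qact_def whisk_\<phi>_\<psi>)

lemma rhom_modmap:
  "modmap x y f \<Longrightarrow> rhom (x \<odot> a) (whisk x M \<one>) (y \<odot> a) (whisk y M \<one>) f"
  by (simp add: rhom_def modmap_def)

lemma rhom_cmp:
  assumes "rhom k t m u f" "rhom m u n v g" "rmod k t" "rmod m u" "rmod n v"
  shows "rhom k t n v (g \<bullet> f)"
proof -
  note [simp] = assms(1)[unfolded rhom_def, THEN conjunct1] assms(2)[unfolded rhom_def, THEN conjunct1]
  have [simp]: "src f = k" "trg f = m" "src g = m" "trg g = n" "arr t" "arr u" "arr v" "src t = k \<odot> a" "trg t = k"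
    "src u = m \<odot> a" "trg u = m" "src v = n \<odot> a" "trg v = n" "k \<in> ob C" "m \<in> ob C" "n \<in> ob C"
    using assms by (simp_all add: rhom_def rmod_def)
  have "f \<bullet> t = u \<bullet> whisk \<one> f a" "g \<bullet> u = v \<bullet> whisk \<one> g a"
    using assms by (simp_all add: rhom_def)
  then show ?thesis by (simp add: rhom_def acmp_tail[of g u])
qed

text \<open>The action on the coequalizer is given by a definite description: \<open>qact\<close>
  meets its defining equation because \<open>lact\<close> commutes with the right action, and
  uniqueness follows as the whiskered quotient map is split epi.\<close>

lemma tilde_tensor_Ind:
  assumes "x \<in> ob C" "y \<in> ob C"
  shows "tilde_tensor C \<kappa> A TA (Ind C A x) (Ind C A y) = (quot x y, mph (qact x y))"
proof -
  note [simp] = assms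
  have LR: "whisk (x \<odot> y) M \<one> \<bullet> whisk x (lact y) a = whisk x (lact y) \<one> \<bullet> whisk (x \<odot> a \<odot> y) M \<one>"
    using arg_cong[OF lact_R[of y], of "\<lambda>t. whisk x t \<one>"] by simp
  have ph: "whisk \<one> (\<phi> x y) a \<bullet> whisk \<one> (qmap x y) a = whisk x (lact y) a"
    using arg_cong[OF \<phi>_qmap[of x y], of "\<lambda>t. whisk \<one> t a"] by (simp add: pmap_def)
  have "qact x y \<bullet> whisk \<one> (qmap x y) a = qmap x y \<bullet> sect x y \<bullet> pmap x y \<bullet> whisk (x \<odot> a \<odot> y) M \<one>"
    by (simp add: qact_def ph LR) (simp add: \<psi>_def pmap_def)
  also have "\<dots> = qmap x y \<bullet> whisk (x \<odot> a \<odot> y) M \<one>"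
    using acmp_assoc[of "whisk (x \<odot> a \<odot> y) M \<one>" "sect x y \<bullet> pmap x y" "qmap x y"] by (simp add: qmap_sect_pmap del: acmp_assoc)
      (simp add: qmap_sect_pmap)
  finally have qact_qmap: "qact x y \<bullet> (qmap x y \<boxtimes> ide a) = qmap x y \<bullet> (ide (x \<odot> a) \<boxtimes> (ide y \<boxtimes> M))" by simp
  have "(THE u. u \<in> hom C (quot x y \<odot> a) (quot x y) \<and>
      u \<cdot> (mph (qmap x y) \<otimes> \<i>\<d> a) = mph (qmap x y) \<cdot> (\<i>\<d> (x \<odot> a) \<otimes> (\<i>\<d> y \<otimes> mul A))) = mph (qact x y)"
  proof (rule the_equality)
    show "mph (qact x y) \<in> hom C (quot x y \<odot> a) (quot x y) \<and>
      mph (qact x y) \<cdot> (mph (qmap x y) \<otimes> \<i>\<d> a) = mph (qmap x y) \<cdot> (\<i>\<d> (x \<odot> a) \<otimes> (\<i>\<d> y \<otimes> mul A))"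
      using arr_mph[of "qact x y"] arg_cong[OF qact_qmap, of mph] by (simp add: mph_simps(1-3) mph_gen del: atmr_whisk)
  next
    fix u assume u: "u \<in> hom C (quot x y \<odot> a) (quot x y) \<and>
      u \<cdot> (mph (qmap x y) \<otimes> \<i>\<d> a) = mph (qmap x y) \<cdot> (\<i>\<d> (x \<odot> a) \<otimes> (\<i>\<d> y \<otimes> mul A))"
    let ?u = "Arrow (quot x y \<odot> a) (quot x y) u"
    note [simp] = u[THEN conjunct1]
    have "?u \<bullet> (qmap x y \<boxtimes> ide a) = qmap x y \<bullet> (ide (x \<odot> a) \<boxtimes> (ide y \<boxtimes> M))"
      using u by (intro arrow_eqI) (simp_all add: mph_simps(1-3) mph_gen del: atmr_whisk)
    then have "?u \<bullet> whisk \<one> (qmap x y) a = qact x y \<bullet> whisk \<one> (qmap x y) a" using qact_qmap by simp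
    \<comment> \<open>Precomposing with the whiskered right inverse turns the quotient map into
      \<open>\<psi> x y \<bullet> \<phi> x y\<close>, an identity.\<close>
    from arg_cong[OF this, of "\<lambda>t. t \<bullet> whisk \<one> (sect x y \<bullet> \<phi> x y) a"]
    have "?u \<bullet> whisk \<one> (\<psi> x y \<bullet> \<phi> x y) a = qact x y \<bullet> whisk \<one> (\<psi> x y \<bullet> \<phi> x y) a"
      by (simp add: \<psi>_def)
    then have "?u = qact x y" by (simp add: \<psi>_\<phi> del: whisk_acmp)
    from arg_cong[OF this, of mph] show "u = mph (qact x y)" by simp
  qed
  then show ?thesis
    using proj_Ind[OF assms]
    by (simp add: tilde_tensor_def bimodule_tensor_def graded_bimodule_Ind)
qed

definition tilde_mor :: "'o \<Rightarrow> 'o \<Rightarrow> 'o \<Rightarrow> 'o \<Rightarrow> ('o, 'm) arrow \<Rightarrow> ('o, 'm) arrow \<Rightarrow> ('o, 'm) arrow"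
  where "tilde_mor x x' y y' f g = \<psi> x' y' \<bullet> tens x x' y y' f g \<bullet> \<phi> x y"

text \<open>Shows that conjugation by the isomorphism yields the morphism induced between the
  coequalizers. This is the essential content of naturality, and it comes from
  \<open>tens_lact\<close>.\<close>

lemma tilde_mor_qmap:
  assumes f: "modmap x x' f" and g: "homog 0 y y' g"
  shows "tilde_mor x x' y y' f g \<bullet> qmap x y = qmap x' y' \<bullet> (f \<boxtimes> g)"
proof -
  have m: "modmap y y' g" using g by (simp add: homog_def)
  note [simp] = modmapD(1-5)[OF f] modmapD(1-5)[OF m] modmapD(1-3)[OF modmap_tens[OF f m], simplified]
  have "tilde_mor x x' y y' f g \<bullet> qmap x y = \<psi> x' y' \<bullet> tens x x' y y' f g \<bullet> whisk x (lact y) \<one>"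
    by (simp add: tilde_mor_def \<phi>_qmap) (simp add: pmap_def)
  also have "\<dots> = (qmap x' y' \<bullet> sect x' y' \<bullet> pmap x' y') \<bullet> (f \<boxtimes> g)"
    unfolding tens_lact[OF f g] by (simp add: \<psi>_def pmap_def)
  finally show ?thesis by (simp only: qmap_sect_pmap modmapD(5)[OF f] modmapD(5)[OF m])
qed

lemma tilde_tensor_mor_Ind:
  assumes f: "modmap x x' (ind_arrow x x' f)" and g: "homog 0 y y' (ind_arrow y y' g)"
  shows "tilde_tensor_mor C \<kappa> A TA (Ind C A x) (Ind C A y) (Ind C A x') (Ind C A y') f g
    = mph (tilde_mor x x' y y' (ind_arrow x x' f) (ind_arrow y y' g))"
proof -
  have m: "modmap y y' (ind_arrow y y' g)" using g by (simp add: homog_def)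
  note [simp] = modmapD(1,4,5)[OF f] modmapD(1,4,5)[OF m] modmapD(1-3)[OF modmap_tens[OF f m], simplified]
  let ?h = "tilde_mor x x' y y' (ind_arrow x x' f) (ind_arrow y y' g)"
  have h: "arr ?h" "src ?h = quot x y" "trg ?h = quot x' y'" by (simp_all add: tilde_mor_def)
  have "(THE h. h \<in> hom C (quot x y) (quot x' y') \<and> h \<cdot> mph (qmap x y) = mph (qmap x' y') \<cdot> (f \<otimes> g)) = mph ?h"
  proof (rule the_equality)
    show "mph ?h \<in> hom C (quot x y) (quot x' y') \<and> mph ?h \<cdot> mph (qmap x y) = mph (qmap x' y') \<cdot> (f \<otimes> g)"
      using arr_mph[OF h(1)] h arg_cong[OF tilde_mor_qmap[OF f g], of mph] by (simp add: mph_simps(2,3) del: atmr_whisk)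
  next
    fix u assume u: "u \<in> hom C (quot x y) (quot x' y') \<and> u \<cdot> mph (qmap x y) = mph (qmap x' y') \<cdot> (f \<otimes> g)"
    have "Arrow (quot x y) (quot x' y') u \<bullet> qmap x y = qmap x' y' \<bullet> (ind_arrow x x' f \<boxtimes> ind_arrow y y' g)"
      using u by (intro arrow_eqI) (simp_all add: mph_simps(2,3) del: atmr_whisk)
    then have "Arrow (quot x y) (quot x' y') u \<bullet> qmap x y = ?h \<bullet> qmap x y" by (simp only: tilde_mor_qmap[OF f g])
    then have "Arrow (quot x y) (quot x' y') u = ?h"
      by (rule qmap_cancel) (simp_all add: u h)
    from arg_cong[OF this, of mph] show "u = mph ?h" by simp
  qed
  then show ?thesis
    by (simp add: tilde_tensor_mor_def bimodule_tensor_mor_def proj_Ind)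
qed

section \<open>The natural isomorphism in degree 0\<close>

abbreviation "IM0 \<equiv> induced_modules_0 C A"
abbreviation "RM \<equiv> right_modules C A"
abbreviation "PIM \<equiv> product_category IM0 IM0"

lemma RM_simps [simp]: "M' \<in> Obj RM \<longleftrightarrow> right_module C A M'" "Hom RM M' N = right_module_hom C A M' N"
    "Idm RM M' = \<i>\<d> (fst M')" "Comp RM M' N N' v u = v \<cdot> u"
  by (simp_all add: right_modules_def)

lemma PIM_simps [simp]: "Obj PIM = ob C \<times> ob C"
    "Hom PIM (x, y) (x', y') = Grd IM 0 x x' \<times> Grd IM 0 y y'"
    "Idm PIM (x, y) = (\<i>\<d> (x \<odot> a), \<i>\<d> (y \<odot> a))"
    "Comp PIM (x, y) (x', y') (x'', y'') (f', g') (f, g) = (f' \<cdot> f, g' \<cdot> g)"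
  by (simp_all add: product_category_def induced_modules_0_def)

text \<open>In degree 0 the scalar of the interchange law is 1, so the product restricts to a
  functor on the ordinary product category.\<close>

lemma tens_cmp_0:
  assumes "homog 0 x x' f" "homog 0 x' x'' f'" "homog 0 y y' g" "homog 0 y' y'' g'"
  shows "tens x' x'' y' y'' f' g' \<bullet> tens x x' y y' f g = tens x x'' y y'' (f' \<bullet> f) (g' \<bullet> g)"
  using tens_cmp[of 0 x x' f x'' f' y y' g 0 y'' g'] assms by (simp add: homog_def kappa_zero ascl_one)

lemma rmod_tens: "x \<in> ob C \<Longrightarrow> y \<in> ob C \<Longrightarrow> rmod (x \<odot> y \<odot> a) (whisk (x \<odot> y) M \<one>)"
  using rmod_Ind[of "x \<odot> y"] by simp

lemma rhom_tens:
  assumes "modmap x x' f" "modmap y y' g"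
  shows "rhom (x \<odot> y \<odot> a) (whisk (x \<odot> y) M \<one>) (x' \<odot> y' \<odot> a) (whisk (x' \<odot> y') M \<one>) (tens x x' y y' f g)"
  using rhom_modmap[OF modmap_tens[OF assms]] modmapD(4,5)[OF assms(1)] modmapD(4,5)[OF assms(2)] by simp

lemma rhom_tilde_mor:
  assumes "modmap x x' f" "modmap y y' g"
  shows "rhom (quot x y) (qact x y) (quot x' y') (qact x' y') (tilde_mor x x' y y' f g)"
proof -
  note ob = modmapD(4,5)[OF assms(1)] modmapD(4,5)[OF assms(2)]
  note R = rmod_tens[OF ob(1,3)] rmod_tens[OF ob(2,4)] rmod_qact[OF ob(1,3)] rmod_qact[OF ob(2,4)]
  have "rhom (quot x y) (qact x y) (x' \<odot> y' \<odot> a) (whisk (x' \<odot> y') M \<one>) (tens x x' y y' f g \<bullet> \<phi> x y)"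
    using rhom_cmp[OF rhom_\<phi> rhom_tens] assms ob R by simp
  then show ?thesis
    unfolding tilde_mor_def using rhom_cmp[OF _ rhom_\<psi>] ob R by simp
qed

lemma tilde_mor_cmp:
  assumes "homog 0 x x' f" "homog 0 x' x'' f'" "homog 0 y y' g" "homog 0 y' y'' g'"
  shows "tilde_mor x' x'' y' y'' f' g' \<bullet> tilde_mor x x' y y' f g = tilde_mor x x'' y y'' (f' \<bullet> f) (g' \<bullet> g)"
proof -
  have m: "modmap x x' f" "modmap x' x'' f'" "modmap y y' g" "modmap y' y'' g'"
    using assms by (simp_all add: homog_def)
  note [simp] = modmapD(1-5)[OF m(1)] modmapD(1-5)[OF m(2)] modmapD(1-5)[OF m(3)] modmapD(1-5)[OF m(4)]
    modmapD(1-3)[OF modmap_tens[OF m(1,3)], simplified] modmapD(1-3)[OF modmap_tens[OF m(2,4)], simplified]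
  show ?thesis
    using acmp_tail[OF tens_cmp_0[OF assms], of "\<phi> x y"] by (simp add: tilde_mor_def acmp_tail[OF \<phi>_\<psi>])
qed

lemma \<phi>_tilde_mor:
  assumes "modmap x x' f" "modmap y y' g"
  shows "\<phi> x' y' \<bullet> tilde_mor x x' y y' f g = tens x x' y y' f g \<bullet> \<phi> x y"
proof -
  note [simp] = modmapD(1-5)[OF assms(1)] modmapD(1-5)[OF assms(2)] modmapD(1-3)[OF modmap_tens[OF assms], simplified]
  show ?thesis by (simp add: tilde_mor_def acmp_tail[OF \<phi>_\<psi>])
qed

text \<open>Once \<open>tilde_tensor_mor\<close> is identified with a conjugate by
  \<open>\<phi>\<close>, both functoriality and naturality reduce to cancelling
  \<open>\<phi>\<close> against \<open>\<psi>\<close>.\<close>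

lemma natural_isomorphism_tilde:
  "natural_isomorphism PIM RM
    (\<lambda>(x, y). tilde_tensor C \<kappa> A TA (Ind C A x) (Ind C A y))
    (\<lambda>(x, y) (x', y') (f, g).
       tilde_tensor_mor C \<kappa> A TA (Ind C A x) (Ind C A y) (Ind C A x') (Ind C A y') f g)
    (\<lambda>(x, y). underlying (Ind C A (tob C x y)))
    (\<lambda>(x, y) (x', y') (f, g). ind_tensor C A (x, y) (x', y') f g)
    (\<lambda>(x, y). mph (\<phi> x y))"
proof -
  interpret IM: graded_category IM by (rule graded_category_IM)
  have homogD: "homog i x y h \<Longrightarrow> modmap x y h" for i x y h by (simp add: homog_def)
  have und: "underlying (Ind C A (x \<odot> y)) = (x \<odot> y \<odot> a, mph (whisk (x \<odot> y) M \<one>))"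
    if "x \<in> ob C" "y \<in> ob C" for x y
    using underlying_Ind[of "x \<odot> y"] that by simp
  have Grd_cmp: "f' \<cdot> f \<in> Grd IM 0 x x''"
    if "x \<in> ob C" "x' \<in> ob C" "x'' \<in> ob C" "f \<in> Grd IM 0 x x'" "f' \<in> Grd IM 0 x' x''" for x x' x'' f f'
    using IM.comp_grade[of x x' x'' f 0 f' 0] that by simp
  have tmor: "tilde_tensor_mor C \<kappa> A TA (Ind C A x) (Ind C A y) (Ind C A x') (Ind C A y') f g
      = mph (tilde_mor x x' y y' (ind_arrow x x' f) (ind_arrow y y' g))"
    if "x \<in> ob C" "y \<in> ob C" "x' \<in> ob C" "y' \<in> ob C" "f \<in> Grd IM 0 x x'" "g \<in> Grd IM 0 y y'" for x y x' y' f g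
    using that by (simp add: tilde_tensor_mor_Ind Grd_IM homogD)
  have tens: "ind_tensor C A (x, y) (x', y') f g = mph (tens x x' y y' (ind_arrow x x' f) (ind_arrow y y' g))"
    if "x \<in> ob C" "y \<in> ob C" "x' \<in> ob C" "y' \<in> ob C" "f \<in> Grd IM 0 x x'" "g \<in> Grd IM 0 y y'" for x y x' y' f g
    using that IM.grd_hom by (simp add: ind_tensor_tens)
  have id0: "\<i>\<d> (x \<odot> a) \<in> Grd IM 0 x x" if "x \<in> ob C" for x
    using that by (simp add: Grd_IM ind_arrow_id homog_ide)
  have F: "is_functor PIM RM
      (\<lambda>(x, y). tilde_tensor C \<kappa> A TA (Ind C A x) (Ind C A y))
      (\<lambda>(x, y) (x', y') (f, g).
         tilde_tensor_mor C \<kappa> A TA (Ind C A x) (Ind C A y) (Ind C A x') (Ind C A y') f g)"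
    unfolding is_functor_def
  proof (intro conjI ballI, goal_cases)
    case (1 X)
    then show ?case by (auto simp: tilde_tensor_Ind intro!: right_module_rmod rmod_qact)
  next
    case (2 X Y u)
    then show ?case
      by (auto simp: tilde_tensor_Ind tmor Grd_IM homogD intro!: right_module_hom_rhom rmod_qact rhom_tilde_mor)
  next
    case (3 X)
    have "tilde_mor x x y y (ide (x \<odot> a)) (ide (y \<odot> a)) = ide (quot x y)" if "x \<in> ob C" "y \<in> ob C" for x y
      using that by (simp add: tilde_mor_def tens_ide \<psi>_\<phi>)
    then show ?case using 3 by (auto simp: tilde_tensor_Ind tmor id0 ind_arrow_id mph_simps(1))
  next
    case (4 X Y Z u v)
    have "tilde_mor x x'' y y'' (ind_arrow x x'' (f' \<cdot> f)) (ind_arrow y y'' (g' \<cdot> g))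
        = tilde_mor x' x'' y' y'' (ind_arrow x' x'' f') (ind_arrow y' y'' g') \<bullet> tilde_mor x x' y y' (ind_arrow x x' f) (ind_arrow y y' g)"
      if "x \<in> ob C" "y \<in> ob C" "x' \<in> ob C" "y' \<in> ob C" "x'' \<in> ob C" "y'' \<in> ob C" "f \<in> Grd IM 0 x x'" "g \<in> Grd IM 0 y y'"
        "f' \<in> Grd IM 0 x' x''" "g' \<in> Grd IM 0 y' y''" for x y x' y' x'' y'' f g f' g'
      using that by (simp add: ind_arrow_cmp[of x x'' f' f x'] ind_arrow_cmp[of y y'' g' g y'] tilde_mor_cmp Grd_IM)
    then show ?case using 4 by (auto simp: tmor Grd_cmp mph_simps(2))
  qed
  have G: "is_functor PIM RM (\<lambda>(x, y). underlying (Ind C A (tob C x y)))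
      (\<lambda>(x, y) (x', y') (f, g). ind_tensor C A (x, y) (x', y') f g)"
    unfolding is_functor_def
  proof (intro conjI ballI, goal_cases)
    case (1 X)
    then show ?case by (auto simp: und intro!: right_module_rmod rmod_tens)
  next
    case (2 X Y u)
    then show ?case
      by (auto simp: und tens Grd_IM homogD intro!: right_module_hom_rhom rmod_tens rhom_tens)
  next
    case (3 X)
    then show ?case by (auto simp: und tens_id_IM)
  next
    case (4 X Y Z u v)
    have "tens x x'' y y'' (ind_arrow x x'' (f' \<cdot> f)) (ind_arrow y y'' (g' \<cdot> g))
        = tens x' x'' y' y'' (ind_arrow x' x'' f') (ind_arrow y' y'' g') \<bullet> tens x x' y y' (ind_arrow x x' f) (ind_arrow y y' g)"
      if "x \<in> ob C" "y \<in> ob C" "x' \<in> ob C" "y' \<in> ob C" "x'' \<in> ob C" "y'' \<in> ob C" "f \<in> Grd IM 0 x x'" "g \<in> Grd IM 0 y y'"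
        "f' \<in> Grd IM 0 x' x''" "g' \<in> Grd IM 0 y' y''" for x y x' y' x'' y'' f g f' g'
      using that by (simp add: ind_arrow_cmp[of x x'' f' f x'] ind_arrow_cmp[of y y'' g' g y'] tens_cmp_0 Grd_IM)
    then show ?case using 4 by (auto simp: tens Grd_cmp mph_simps(2))
  qed
  show ?thesis
    unfolding natural_isomorphism_def
  proof (intro conjI F G ballI, goal_cases)
    case (1 X)
    then show ?case by (auto simp: und tilde_tensor_Ind intro!: right_module_hom_rhom rhom_\<phi> rmod_qact rmod_tens)
  next
    case (2 X)
    then obtain x y where X: "X = (x, y)" and ob: "x \<in> ob C" "y \<in> ob C" by auto
    have "mph (\<psi> x y) \<in> right_module_hom C A (x \<odot> y \<odot> a, mph (whisk (x \<odot> y) M \<one>)) (quot x y, mph (qact x y))"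
      using ob by (intro right_module_hom_rhom rhom_\<psi> rmod_qact rmod_tens)
    moreover have "mph (\<psi> x y) \<cdot> mph (\<phi> x y) = \<i>\<d> (quot x y)" "mph (\<phi> x y) \<cdot> mph (\<psi> x y) = \<i>\<d> (x \<odot> y \<odot> a)"
      using arg_cong[OF \<psi>_\<phi>[OF ob], of mph] arg_cong[OF \<phi>_\<psi>[OF ob], of mph] by (simp_all only: mph_simps(1,2))
    ultimately show ?case using ob by (auto simp: X und tilde_tensor_Ind)
  next
    case (3 X Y u)
    have "mph (\<phi> x' y') \<cdot> mph (tilde_mor x x' y y' (ind_arrow x x' f) (ind_arrow y y' g)) = mph (tens x x' y y' (ind_arrow x x' f) (ind_arrow y y' g)) \<cdot> mph (\<phi> x y)"
      if "x \<in> ob C" "y \<in> ob C" "x' \<in> ob C" "y' \<in> ob C" "f \<in> Grd IM 0 x x'" "g \<in> Grd IM 0 y y'" for x y x' y' f g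
      using that arg_cong[OF \<phi>_tilde_mor[of x x' "ind_arrow x x' f" y y' "ind_arrow y y' g"], of mph]
      by (simp add: Grd_IM homogD mph_simps(2))
    then show ?case using 3 by (auto simp: tmor tens)
  qed
qed

text \<open>After the quotient map, the isomorphism is the explicit arrow \<open>pmap\<close>, made
  of a braiding and a multiplication, and both respect the component inclusions.\<close>

lemma \<phi>_grade_preserving:
  assumes "x \<in> ob C" "y \<in> ob C"
  shows "tilde_grade_preserving C \<kappa> A TA (Ind C A x) (Ind C A y) (Ind C A (x \<odot> y)) (mph (\<phi> x y))"
  unfolding tilde_grade_preserving_def
proof (intro allI)
  fix i j
  note [simp] = assms
  \<comment> \<open>The same recipe as \<open>pmap\<close>, carried out on components: the degree
    \<open>i\<close> part is braided past \<open>y\<close> and then multiplied with the degree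
    \<open>j\<close> part.\<close>
  let ?u = "whisk (x \<odot> y) (Mc i j) \<one> \<bullet> whisk x (B (cpt A i) y) (cpt A j)"
  have e1: "whisk x (B a y) a \<bullet> whisk x (E i) (y \<odot> a) = whisk (x \<odot> y) (E i) a \<bullet> whisk x (B (cpt A i) y) a"
    using arg_cong[OF B_natural_left[of "E i" y], of "\<lambda>t. whisk x t a"] by simp
  have e2: "whisk x (B (cpt A i) y) a \<bullet> whisk (x \<odot> cpt A i \<odot> y) (E j) \<one>
      = whisk (x \<odot> y \<odot> cpt A i) (E j) \<one> \<bullet> whisk x (B (cpt A i) y) (cpt A j)"
    using whisk_exchange[of "B (cpt A i) y" "E j" x \<one> \<one>] by simp
  have e3: "whisk (x \<odot> y) M \<one> \<bullet> whisk (x \<odot> y) (E i) a \<bullet> whisk (x \<odot> y \<odot> cpt A i) (E j) \<one>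
      = whisk (x \<odot> y) (E (i + j)) \<one> \<bullet> whisk (x \<odot> y) (Mc i j) \<one>"
    using arg_cong[OF M_E_E[of i j], of "\<lambda>t. whisk (x \<odot> y) t \<one>"] by simp
  have "\<phi> x y \<bullet> qmap x y \<bullet> ((ide x \<boxtimes> E i) \<boxtimes> (ide y \<boxtimes> E j))
      = pmap x y \<bullet> ((ide x \<boxtimes> E i) \<boxtimes> (ide y \<boxtimes> E j))"
    using acmp_tail[OF \<phi>_qmap[OF assms], of "(ide x \<boxtimes> E i) \<boxtimes> (ide y \<boxtimes> E j)"] by (simp del: atmr_whisk)
  also have "\<dots> = (whisk (x \<odot> y) M \<one> \<bullet> whisk (x \<odot> y) (E i) a \<bullet> whisk (x \<odot> y \<odot> cpt A i) (E j) \<one>)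
      \<bullet> whisk x (B (cpt A i) y) (cpt A j)"
    by (simp add: pmap_def lact_def acmp_tail[OF e1] e2)
  also have "\<dots> = (ide (x \<odot> y) \<boxtimes> E (i + j)) \<bullet> ?u"
    unfolding e3 by simp
  finally have eq: "\<phi> x y \<bullet> qmap x y \<bullet> ((ide x \<boxtimes> E i) \<boxtimes> (ide y \<boxtimes> E j)) = (ide (x \<odot> y) \<boxtimes> E (i + j)) \<bullet> ?u" .
  have "mph ?u \<in> hom C ((x \<odot> cpt A i) \<odot> (y \<odot> cpt A j)) ((x \<odot> y) \<odot> cpt A (i + j))"
    using arr_mph[of ?u] by simp
  moreover have "mph (\<phi> x y) \<cdot> (mph (qmap x y) \<cdot> ((\<i>\<d> x \<otimes> emb A i) \<otimes> (\<i>\<d> y \<otimes> emb A j))) = (\<i>\<d> (x \<odot> y) \<otimes> emb A (i + j)) \<cdot> mph ?u"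
    using arg_cong[OF eq, of mph] by (simp only: mph_simps(1-3) mph_gen)
  ultimately show "\<exists>u \<in> hom C (cpt (Ind C A x) i \<odot> cpt (Ind C A y) j) (cpt (Ind C A (x \<odot> y)) (i + j)).
      mph (\<phi> x y) \<cdot> (snd (bimodule_proj TA (graded_bimodule C \<kappa> A (Ind C A x)) (graded_bimodule C \<kappa> A (Ind C A y)))
        \<cdot> (emb (Ind C A x) i \<otimes> emb (Ind C A y) j)) = emb (Ind C A (x \<odot> y)) (i + j) \<cdot> u"
    unfolding proj_Ind[OF assms] by (intro bexI[of _ "mph ?u"]) (simp_all add: Ind_def)
qed

end

theorem theorem5p7:
  fixes C :: "('o, 'm::ab_group_add, 'k::alg_closed_field) bmcat"
    and A :: "('o, 'm, 'g::{finite, ab_group_add}) galg"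
    and \<kappa> :: "'g \<Rightarrow> 'g \<Rightarrow> 'k"
  assumes "CHAR('k) = 0 \<or> coprime CHAR('k) CARD('g)"
    and "bicharacter \<kappa>"
    and "linear_braided_category C"
    and "graded_algebra C A"
    and "graded_commutative C \<kappa> A"
  shows
    "graded_functor (kleisli C A) (induced_modules C A) (\<lambda>x. x) (kleisli_to_ind C A) \<and>
     (\<forall>x \<in> ob C. \<forall>y \<in> ob C.
        bij_betw (kleisli_to_ind C A x y) (Hom (kleisli C A) x y) (Hom (induced_modules C A) x y)) \<and>
     (\<exists>T. graded_monoidal_category (\<lambda>i j. \<kappa> j i) (induced_modules C A) (unt C) (tob C) T \<and>
        (\<forall>x \<in> ob C. \<forall>y \<in> ob C. \<forall>x' \<in> ob C. \<forall>y' \<in> ob C.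
         \<forall>f \<in> Hom (induced_modules C A) x x'. \<forall>g \<in> Hom (induced_modules C A) y y'.
           T (x, y) (x', y')
             (hom_tensor (induced_modules C A) (induced_modules C A) (x, y) (x', y') f g)
           = ind_tensor C A (x, y) (x', y') f g)) \<and>
     (\<forall>TA. tensor_over C A TA \<and> coproduct_separable_Frobenius C A \<longrightarrow>
     (\<forall>x \<in> ob C. bimodule C A (graded_bimodule C \<kappa> A (Ind C A x))) \<and>
     (\<exists>\<phi>. natural_isomorphism
        (product_category (induced_modules_0 C A) (induced_modules_0 C A)) (right_modules C A)
        (\<lambda>(x, y). tilde_tensor C \<kappa> A TA (Ind C A x) (Ind C A y))
        (\<lambda>(x, y) (x', y') (f, g).
           tilde_tensor_mor C \<kappa> A TA (Ind C A x) (Ind C A y) (Ind C A x') (Ind C A y') f g)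
        (\<lambda>(x, y). underlying (Ind C A (tob C x y)))
        (\<lambda>(x, y) (x', y') (f, g). ind_tensor C A (x, y) (x', y') f g)
        \<phi> \<and>
      (\<forall>x \<in> ob C. \<forall>y \<in> ob C.
         tilde_grade_preserving C \<kappa> A TA (Ind C A x) (Ind C A y) (Ind C A (tob C x y)) (\<phi> (x, y)))))"
proof -
  interpret linear_braided_category C by fact
  interpret graded_commutative_algebra C A \<kappa> by unfold_locales fact+
  have part_ii: "(\<forall>x \<in> ob C. bimodule C A (graded_bimodule C \<kappa> A (Ind C A x))) \<and>
     (\<exists>\<phi>. natural_isomorphism
        (product_category (induced_modules_0 C A) (induced_modules_0 C A)) (right_modules C A)
        (\<lambda>(x, y). tilde_tensor C \<kappa> A TA (Ind C A x) (Ind C A y))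
        (\<lambda>(x, y) (x', y') (f, g).
           tilde_tensor_mor C \<kappa> A TA (Ind C A x) (Ind C A y) (Ind C A x') (Ind C A y') f g)
        (\<lambda>(x, y). underlying (Ind C A (tob C x y)))
        (\<lambda>(x, y) (x', y') (f, g). ind_tensor C A (x, y) (x', y') f g)
        \<phi> \<and>
      (\<forall>x \<in> ob C. \<forall>y \<in> ob C.
         tilde_grade_preserving C \<kappa> A TA (Ind C A x) (Ind C A y) (Ind C A (tob C x y)) (\<phi> (x, y))))"
    if "tensor_over C A TA" for TA
  proof -
    \<comment> \<open>The locale fixes one choice of coequalizers, so the comparison is carried out
      for each \<open>TA\<close> separately.\<close>
    interpret tensor_over_algebra C A \<kappa> TA by unfold_locales fact
    show ?thesis
      using natural_isomorphism_tilde \<phi>_grade_preserving bimodule_Ind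
      by (intro conjI ballI exI[of _ "\<lambda>(x, y). mph (\<phi> x y)"]) simp_all
  qed
  show ?thesis
    using graded_functor_kleisli_to_ind bij_kleisli_to_ind ex_tensor part_ii by blast
qed

end
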